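(* Assume that for every positive integer $m$ the series $f(x_1,\dots,x_m;s_1,\dots,s_m,q,t)$ satisfies $$D^1(s_1,\dots,s_m,q,t)\,f(x_1,\dots,x_m;s_1,\dots,s_m,q,t)=\Big(\sum_{i=1}^m s_i\Big)f(x_1,\dots,x_m;s_1,\dots,s_m,q,t)$$ (with $f$, $D^1$ as defined in the context). Let $\lambda=(\lambda_1,\dots,\lambda_n)$ be a partition, and set $s_i=t^{n-i}q^{\lambda_i}$ for $1\le i\le n$. Then the Macdonald symmetric function $Q_\lambda=Q_\lambda(x;q,t)$ is given by $$Q_{(\lambda_1,\dots,\lambda_n)}=\prod_{1\le k<\ell\le n}(1-R_{k\ell})\sum_{(\theta)\in \mathsf{M}^{(n)}}c_n(\{\theta_{i,j};1\le i<j\le n\};s_1,\dots,s_n,q,t)\prod_{1\le i<j\le n}R_{ij}^{\theta_{i,j}}\;g_\lambda .$$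
   Context: Notation: $(a;q)_m=(1-a)(1-aq)\cdots(1-aq^{m-1})$, $(a;q)_\infty=\prod_{i\ge0}(1-aq^i)$. $\mathsf{M}^{(n)}$ is the set of upper triangular $n\times n$ matrices $(\theta_{i,j})$ with nonnegative integer entries and $0$ on the diagonal. The coefficients $c_n$ are defined recursively, for indeterminates $s_1,\dots,s_n,q,t$, by $c_1(-;s_1,q,t)=1$ and $$\begin{aligned}c_n(\{\theta_{i,j};1\le i<j\le n\};s_1,\dots,s_n,q,t)={}&c_{n-1}(\{\theta_{i,j};1\le i<j\le n-1\};q^{\theta_{1,n}}s_1,\dots,q^{\theta_{n-1,n}}s_{n-1},q,t)\\&\times\prod_{k=1}^{n-1}t^{\theta_{k,n}}\frac{(qt^{-1};q)_{\theta_{k,n}}}{(q;q)_{\theta_{k,n}}}\frac{(qt^{-1}s_k/s_n;q)_{\theta_{k,n}}}{(qs_k/s_n;q)_{\theta_{k,n}}}\\&\times\prod_{1\le\ell<m\le n-1}\frac{(qt^{-1}s_\ell/s_m;q)_{\theta_{\ell,n}}}{(qs_\ell/s_m;q)_{\theta_{\ell,n}}}\frac{(q^{-\theta_{m,n}}ts_\ell/s_m;q)_{\theta_{\ell,n}}}{(q^{-\theta_{m,n}}s_\ell/s_m;q)_{\theta_{\ell,n}}}.\end{aligned}$$ The series $f$ and operator $D^1$ (with $s_1,\dots,s_n$ indeterminates): in $\mathbf{Q}(q,t,s_1,\dots,s_n)[[x_2/x_1,x_3/x_2,\dots,x_n/x_{n-1}]]$, $$f(x_1,\dots,x_n;s_1,\dots,s_n,q,t)=\prod_{1\le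 k<\ell\le n}(1-x_\ell/x_k)\sum_{(\theta)\in\mathsf{M}^{(n)}}c_n(\{\theta_{i,j}\};s_1,\dots,s_n,q,t)\prod_{1\le i<j\le n}(x_j/x_i)^{\theta_{i,j}},$$ $$D^1(s_1,\dots,s_n,q,t)=\sum_{i=1}^n s_i\prod_{j<i}\frac{1-q^{-1}t\,x_i/x_j}{1-q^{-1}x_i/x_j}\prod_{k>i}\frac{1-qt^{-1}x_k/x_i}{1-qx_k/x_i}\;T_{q^{-1},x_i},$$ where $T_{q^{-1},x_i}$ replaces $x_i$ by $q^{-1}x_i$ and the rational factors are expanded as $\frac{1-q^{\pm1}t^{\mp1}x}{1-q^{\pm1}x}=1+\sum_{m\ge1}(1-t^{\mp1})q^{\pm m}x^m$. Macdonald functions: let $\Lambda_F$ be the ring of symmetric functions (in infinitely many variables $x=(x_1,x_2,\dots)$) over $F=\mathbf{Q}(q,t)$, with scalar product on power sums $\langle p_\lambda,p_\mu\rangle_{q,t}=\delta_{\lambda,\mu}\prod_{i\ge1}i^{m_i}m_i!\prod_{j\ge1}\frac{1-q^{\lambda_j}}{1-t^{\lambda_j}}$ (the last product over nonzero parts $\lambda_j$), $m_i$ being the multiplicity of $i$ in $\lambda$. $P_\lambda(x;q,t)\in\Lambda_F$ is uniquely characterized by $P_\lambda=m_\lambda+\sum_{\mu<\lambda}u_{\lambda\mu}m_\mu$ with $u_{\lambda\mu}\in F$ ($m_\lambda$ monomial symmetric functions, $<$ the dominance order) and $\langle P_\lambda,P_\mu\rangle_{q,t}=0$ for $\lambda\ne\mu$.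 Then $Q_\lambda=\langle P_\lambda,P_\lambda\rangle_{q,t}^{-1}P_\lambda$. The functions $g_m=g_m(x;q,t)$ are defined by $\prod_{i\ge1}\frac{(tx_iy;q)_\infty}{(x_iy;q)_\infty}=\sum_{m\ge0}g_m(x;q,t)y^m$, with $g_m=0$ for $m<0$, and $g_a=g_{a_1}\cdots g_{a_n}$ for $a\in\mathbf{Z}^n$. For $i<j$, $R_{ij}(a_1,\dots,a_n)=(a_1,\dots,a_i+1,\dots,a_j-1,\dots,a_n)$; a raising operator is a product $R=\prod_{i<j}R_{ij}^{\theta_{i,j}}$, and $Rg_\lambda$ means $g_{R\lambda}$ (extended linearly after formally expanding the product of factors; only finitely many terms are nonzero). *)

theory Defs
  imports
    "HOL-Library.Multiset"
    "HOL-Library.Poly_Mapping"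
    "HOL-Computational_Algebra.Polynomial"
    "HOL-Computational_Algebra.Formal_Power_Series"
    "HOL-Computational_Algebra.Fraction_Field"
begin

section \<open>Formal power series in arbitrarily many variables\<close>

text \<open>
  Variables are indexed by a type \<open>'v\<close>, and a monomial is a finite multiset of variables.
  Infinitely many monomials of the same degree may occur, so the type contains the symmetric
  functions in infinitely many variables.
\<close>

typedef ('v, 'a) mfps = "UNIV :: ('v multiset \<Rightarrow> 'a) set"
  morphisms mfps_nth Abs_mfps
  by auto

lemma mfps_nth_Abs_mfps [simp]: "mfps_nth (Abs_mfps f) M = f M"
  by (simp add: Abs_mfps_inverse)

lemma mfps_eqI: "(\<And>M. mfps_nth f M = mfps_nth g M) \<Longrightarrow> f = g"
  by (metis ext mfps_nth_inject)

lemma finite_submultisets: "finite {A. A \<subseteq># (M :: 'v multiset)}"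
proof (induction M)
  case (add x M)
  have "{A. A \<subseteq># add_mset x M} \<subseteq> {A. A \<subseteq># M} \<union> add_mset x ` {A. A \<subseteq># M}"
  proof
    fix A assume A: "A \<in> {A. A \<subseteq># add_mset x M}"
    show "A \<in> {A. A \<subseteq># M} \<union> add_mset x ` {A. A \<subseteq># M}"
    proof (cases "x \<in># A")
      case True
      then obtain B where "A = add_mset x B" by (metis mset_add)
      then show ?thesis using A by simp
    next
      case False
      then have "A \<subseteq># M" using A
        by (metis diff_single_trivial mem_Collect_eq subset_eq_diff_conv add_mset_add_single)
      then show ?thesis by simp
    qed
  qed
  then show ?case using add finite_subset by fastforce
qed simp

instantiation mfps :: (type, comm_ring_1) comm_ring_1
begin

definition "0 = Abs_mfps (\<lambda>_. 0)"
definition "1 = Abs_mfps (\<lambda>M. if M = {#} then 1 else 0)"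
definition "f + g = Abs_mfps (\<lambda>M. mfps_nth f M + mfps_nth g M)"
definition "f - g = Abs_mfps (\<lambda>M. mfps_nth f M - mfps_nth g M)"
definition "- f = Abs_mfps (\<lambda>M. - mfps_nth f M)"
definition "f * g = Abs_mfps (\<lambda>M. \<Sum>A | A \<subseteq># M. mfps_nth f A * mfps_nth g (M - A))"

instance
proof
  fix f g h :: "('a, 'b) mfps"
  show "f + g + h = f + (g + h)" "f + g = g + f" "0 + f = f" "- f + f = 0" "f - g = f + - g"
    by (auto intro!: mfps_eqI simp: plus_mfps_def zero_mfps_def uminus_mfps_def minus_mfps_def
        algebra_simps)
  have "mfps_nth (0 :: ('a, 'b) mfps) {#} \<noteq> mfps_nth (1 :: ('a, 'b) mfps) {#}"
    by (simp add: zero_mfps_def one_mfps_def)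
  then show "(0 :: ('a, 'b) mfps) \<noteq> 1" by auto
  show "(f + g) * h = f * h + g * h"
    by (auto intro!: mfps_eqI
        simp: plus_mfps_def times_mfps_def algebra_simps sum.distrib)
  show "1 * f = f"
  proof (rule mfps_eqI)
    fix M
    have "mfps_nth (1 * f) M = (\<Sum>A | A \<subseteq># M. if A = {#} then mfps_nth f (M - A) else 0)"
      by (auto simp: times_mfps_def one_mfps_def intro!: sum.cong)
    also have "\<dots> = mfps_nth f M"
      by (simp add: sum.delta[OF finite_submultisets])
    finally show "mfps_nth (1 * f) M = mfps_nth f M" .
  qed
  have co: "M - (M - A) = A" if "A \<subseteq># M" for A M :: "'a multiset"
    using that by (metis add_implies_diff subset_mset.add_diff_inverse)
  show "f * g = g * f"
  proof (rule mfps_eqI)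
    fix M
    show "mfps_nth (f * g) M = mfps_nth (g * f) M"
      unfolding times_mfps_def mfps_nth_Abs_mfps
      by (rule sum.reindex_bij_witness[of _ "\<lambda>A. M - A" "\<lambda>A. M - A"])
        (auto simp: co mult.commute)
  qed
  have ac: "A - B \<subseteq># M - B" if "A \<subseteq># M" "B \<subseteq># A" for A B M :: "'a multiset"
    using that by (metis mset_subset_eq_multiset_union_diff_commute subset_mset.le_iff_add)
  have diff_diff: "M - B - (A - B) = M - A" if "A \<subseteq># M" "B \<subseteq># A" for A B M :: "'a multiset"
    using that by (simp add: subset_mset.le_imp_diff_is_add)
  have sub: "B + C \<subseteq># M" if "B \<subseteq># M" "C \<subseteq># M - B" for B C M :: "'a multiset"
    using that by (simp add: add.commute subset_mset.le_diff_conv2)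
  show "f * g * h = f * (g * h)"
  proof (rule mfps_eqI)
    fix M
    have "mfps_nth (f * g * h) M =
        (\<Sum>A | A \<subseteq># M. \<Sum>B | B \<subseteq># A. mfps_nth f B * mfps_nth g (A - B) * mfps_nth h (M - A))"
      by (simp add: times_mfps_def sum_distrib_right)
    also have "\<dots> = (\<Sum>(A, B) \<in> (SIGMA A:{A. A \<subseteq># M}. {B. B \<subseteq># A}).
        mfps_nth f B * mfps_nth g (A - B) * mfps_nth h (M - A))"
      by (rule sum.Sigma) (auto simp: finite_submultisets)
    also have "\<dots> = (\<Sum>(B, C) \<in> (SIGMA B:{B. B \<subseteq># M}. {C. C \<subseteq># M - B}).
        mfps_nth f B * (mfps_nth g C * mfps_nth h (M - B - C)))"
      by (rule sum.reindex_bij_witness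
            [of _ "\<lambda>(B, C). (B + C, B)" "\<lambda>(A, B). (B, A - B)"])
        (auto simp: mult.assoc ac diff_diff sub add.commute intro: subset_mset.order_trans)
    also have "\<dots> = (\<Sum>B | B \<subseteq># M. \<Sum>C | C \<subseteq># M - B.
        mfps_nth f B * (mfps_nth g C * mfps_nth h (M - B - C)))"
      by (rule sum.Sigma[symmetric]) (auto simp: finite_submultisets)
    also have "\<dots> = mfps_nth (f * (g * h)) M"
      by (simp add: times_mfps_def sum_distrib_left)
    finally show "mfps_nth (f * g * h) M = mfps_nth (f * (g * h)) M" .
  qed
qed

end

definition mfps_const :: "'a::comm_ring_1 \<Rightarrow> ('v, 'a) mfps" where
  "mfps_const a = Abs_mfps (\<lambda>M. if M = {#} then a else 0)"

definition mfps_var :: "'v \<Rightarrow> ('v, 'a::comm_ring_1) mfps" where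
  "mfps_var v = Abs_mfps (\<lambda>M. if M = {#v#} then 1 else 0)"

text \<open>
  Formal infinite sum, coefficient by coefficient; meaningful when every monomial occurs in only
  finitely many of the summands, as is the case wherever it is used below.
\<close>
definition mfps_sum :: "('b \<Rightarrow> ('v, 'a::comm_ring_1) mfps) \<Rightarrow> 'b set \<Rightarrow> ('v, 'a) mfps" where
  "mfps_sum h I = Abs_mfps (\<lambda>M. \<Sum>b | b \<in> I \<and> mfps_nth (h b) M \<noteq> 0. mfps_nth (h b) M)"

text \<open>Limit of a sequence of series each of whose coefficients is eventually constant.\<close>
definition mfps_lim :: "(nat \<Rightarrow> ('v, 'a::comm_ring_1) mfps) \<Rightarrow> ('v, 'a) mfps" where
  "mfps_lim S = Abs_mfps (\<lambda>M. THE c. \<forall>\<^sub>F N in sequentially. mfps_nth (S N) M = c)"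


section \<open>The coefficients \<open>c\<^sub>n\<close>\<close>

definition qpoch :: "'a::comm_ring_1 \<Rightarrow> 'a \<Rightarrow> nat \<Rightarrow> 'a" where
  "qpoch a q m = (\<Prod>i<m. 1 - a * q ^ i)"

definition pairs :: "nat \<Rightarrow> (nat \<times> nat) set" where
  "pairs n = {(i, j). 1 \<le> i \<and> i < j \<and> j \<le> n}"

definition Mats :: "nat \<Rightarrow> (nat \<Rightarrow> nat \<Rightarrow> nat) set" where
  "Mats n = {\<theta>. \<forall>i j. (i, j) \<notin> pairs n \<longrightarrow> \<theta> i j = 0}"

text \<open>
  Defined over any field, so that it can be used both for indeterminate \<open>s\<^sub>i\<close> and for
  \<open>s\<^sub>i = t\<^sup>n\<^sup>-\<^sup>i q\<^sup>\<lambda>\<^sup>i\<close>. In both cases no denominator vanishes: for the latter,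
  \<open>s\<^sub>l / s\<^sub>m\<close> is, for \<open>l < m\<close>, a positive power of \<open>t\<close> times a power of \<open>q\<close>.
  The value at \<open>n = 0\<close> is a dummy.
\<close>
fun cc :: "nat \<Rightarrow> (nat \<Rightarrow> nat \<Rightarrow> nat) \<Rightarrow> (nat \<Rightarrow> 'a::field) \<Rightarrow> 'a \<Rightarrow> 'a \<Rightarrow> 'a" where
  "cc 0 \<theta> s q t = 1"
| "cc (Suc 0) \<theta> s q t = 1"
| "cc (Suc (Suc r)) \<theta> s q t = (let n = Suc (Suc r) in
     cc (Suc r) \<theta> (\<lambda>i. q ^ \<theta> i n * s i) q t
     * (\<Prod>k = 1..n - 1. t ^ \<theta> k n
          * (qpoch (q / t) q (\<theta> k n) / qpoch q q (\<theta> k n))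
          * (qpoch (q / t * s k / s n) q (\<theta> k n) / qpoch (q * s k / s n) q (\<theta> k n)))
     * (\<Prod>(l, m) \<in> pairs (n - 1).
          (qpoch (q / t * s l / s m) q (\<theta> l n) / qpoch (q * s l / s m) q (\<theta> l n))
          * (qpoch (q powi (- int (\<theta> m n)) * t * s l / s m) q (\<theta> l n)
             / qpoch (q powi (- int (\<theta> m n)) * s l / s m) q (\<theta> l n))))"


section \<open>The series \<open>f\<close> and the operator \<open>D\<^sup>1\<close>\<close>

text \<open>
  Variable number \<open>r\<close> stands for \<open>x\<^bsub>r+1\<^esub> / x\<^bsub>r\<^esub>\<close>, so \<open>xratio i j\<close> is \<open>x\<^sub>j / x\<^sub>i\<close> for \<open>i < j\<close>.
  Only the variables with number in \<open>{1..<n}\<close> occur in the series below.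
\<close>
definition xratio :: "nat \<Rightarrow> nat \<Rightarrow> (nat, 'a::comm_ring_1) mfps" where
  "xratio i j = (\<Prod>r = i..<j. mfps_var r)"

definition fser :: "nat \<Rightarrow> (nat \<Rightarrow> 'a::field) \<Rightarrow> 'a \<Rightarrow> 'a \<Rightarrow> (nat, 'a) mfps" where
  "fser n s q t =
     (\<Prod>(k, l) \<in> pairs n. 1 - xratio k l)
     * mfps_sum (\<lambda>\<theta>. mfps_const (cc n \<theta> s q t) * (\<Prod>(i, j) \<in> pairs n. xratio i j ^ \<theta> i j)) (Mats n)"

text \<open>
  The exponent of \<open>x\<^sub>i\<close> (\<open>i \<ge> 1\<close>) in the monomial \<open>M\<close> is \<open>count M (i - 1) - count M i\<close>;
  \<open>Tshift p i\<close> replaces \<open>x\<^sub>i\<close> by \<open>p x\<^sub>i\<close>.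
\<close>
definition Tshift :: "'a::field \<Rightarrow> nat \<Rightarrow> (nat, 'a) mfps \<Rightarrow> (nat, 'a) mfps" where
  "Tshift p i F = Abs_mfps (\<lambda>M. p powi (int (count M (i - 1)) - int (count M i)) * mfps_nth F M)"

text \<open>The expansion of \<open>(1 - a b x) / (1 - b x)\<close>.\<close>
definition ratfac :: "'a::field \<Rightarrow> 'a \<Rightarrow> ('v, 'a) mfps \<Rightarrow> ('v, 'a) mfps" where
  "ratfac a b x = 1 + mfps_sum (\<lambda>m. mfps_const ((1 - a) * b ^ m) * x ^ m) {1..}"

definition D1 :: "nat \<Rightarrow> (nat \<Rightarrow> 'a::field) \<Rightarrow> 'a \<Rightarrow> 'a \<Rightarrow> (nat, 'a) mfps \<Rightarrow> (nat, 'a) mfps" where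
  "D1 n s q t F =
     (\<Sum>i = 1..n. mfps_const (s i)
        * (\<Prod>j = 1..<i. ratfac t (inverse q) (xratio j i))
        * (\<Prod>k = i+1..n. ratfac (inverse t) q (xratio i k))
        * Tshift (inverse q) i F)"


section \<open>The coefficient fields\<close>

text \<open>\<open>\<rat>(q,t)\<close>, realised as \<open>\<rat>(t)(q)\<close>.\<close>
type_synonym Qqt = "rat poly fract poly fract"

definition q0 :: Qqt where "q0 = Fract [:0, 1:] 1"
definition t0 :: Qqt where "t0 = Fract [:Fract [:0, 1:] 1:] 1"

text \<open>
  The fraction field of the polynomial ring over \<open>\<rat>(q,t)\<close> in the infinitely many
  indeterminates \<open>s\<^sub>0, s\<^sub>1, s\<^sub>2, \<dots>\<close>. It contains \<open>\<rat>(q,t,s\<^sub>1,\<dots>,s\<^sub>m)\<close> for every \<open>m\<close>.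
\<close>
type_synonym Qqts = "((nat \<Rightarrow>\<^sub>0 nat) \<Rightarrow>\<^sub>0 Qqt) fract"

definition to_Qqts :: "Qqt \<Rightarrow> Qqts" where
  "to_Qqts a = Fract (Poly_Mapping.single 0 a) 1"

definition sv :: "nat \<Rightarrow> Qqts" where
  "sv i = Fract (Poly_Mapping.single (Poly_Mapping.single i 1) 1) 1"


section \<open>Symmetric functions\<close>

text \<open>The infinitely many variables \<open>x\<^sub>1, x\<^sub>2, \<dots>\<close> are indexed here by all of \<open>nat\<close>.\<close>
type_synonym sfun = "(nat, Qqt) mfps"

definition Sym :: "sfun set" where
  "Sym = {f. (\<forall>\<pi> M. bij \<pi> \<longrightarrow> mfps_nth f (image_mset \<pi> M) = mfps_nth f M) \<and>
             (\<exists>d. \<forall>M. d < size M \<longrightarrow> mfps_nth f M = 0)}"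

text \<open>Partitions without zero parts, as weakly decreasing lists.\<close>
definition partitions :: "nat list set" where
  "partitions = {\<nu>. sorted_wrt (\<ge>) \<nu> \<and> 0 \<notin> set \<nu>}"

definition dominance_less :: "nat list \<Rightarrow> nat list \<Rightarrow> bool" where
  "dominance_less \<mu> \<nu> \<longleftrightarrow> \<mu> \<noteq> \<nu> \<and> sum_list \<mu> = sum_list \<nu> \<and>
     (\<forall>k. sum_list (take k \<mu>) \<le> sum_list (take k \<nu>))"

text \<open>The sum of all monomials whose nonzero exponents are the parts of \<open>\<nu>\<close> in some order.\<close>
definition mono_sym :: "nat list \<Rightarrow> sfun" where
  "mono_sym \<nu> = Abs_mfps (\<lambda>M. if image_mset (count M) (mset_set (set_mset M)) = mset \<nu> then 1 else 0)"

definition power_sum :: "nat \<Rightarrow> sfun" where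
  "power_sum r = mfps_sum (\<lambda>i. mfps_var i ^ r) UNIV"

definition power_sym :: "nat list \<Rightarrow> sfun" where
  "power_sym \<nu> = (\<Prod>r\<leftarrow>\<nu>. power_sum r)"

definition zqt :: "nat list \<Rightarrow> Qqt" where
  "zqt \<nu> = (\<Prod>i\<in>set \<nu>. of_nat (i ^ count_list \<nu> i * fact (count_list \<nu> i)))
          * (\<Prod>r\<leftarrow>\<nu>. (1 - q0 ^ r) / (1 - t0 ^ r))"

text \<open>The coordinates of a symmetric function in the basis of the \<open>p\<^sub>\<nu>\<close>.\<close>
definition power_coords :: "sfun \<Rightarrow> (nat list \<Rightarrow>\<^sub>0 Qqt)" where
  "power_coords f = (THE u. Poly_Mapping.keys u \<subseteq> partitions \<and>
     f = (\<Sum>\<nu>\<in>Poly_Mapping.keys u. mfps_const (Poly_Mapping.lookup u \<nu>) * power_sym \<nu>))"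

text \<open>The bilinear form on \<open>Sym\<close> with \<open>\<langle>p\<^sub>\<nu>, p\<^sub>\<mu>\<rangle> = \<delta>\<^sub>\<nu>\<^sub>\<mu> zqt \<nu>\<close>.\<close>
definition scalar_qt :: "sfun \<Rightarrow> sfun \<Rightarrow> Qqt" where
  "scalar_qt f g =
     (\<Sum>\<nu>\<in>Poly_Mapping.keys (power_coords f). \<Sum>\<mu>\<in>Poly_Mapping.keys (power_coords g).
        Poly_Mapping.lookup (power_coords f) \<nu> * Poly_Mapping.lookup (power_coords g) \<mu>
        * (if \<nu> = \<mu> then zqt \<nu> else 0))"

definition macdonald_family :: "(nat list \<Rightarrow> sfun) \<Rightarrow> bool" where
  "macdonald_family P \<longleftrightarrow>
     (\<forall>\<nu>\<in>partitions. P \<nu> \<in> Sym \<and>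
        (\<exists>u. P \<nu> = mono_sym \<nu> +
           (\<Sum>\<mu> | \<mu> \<in> partitions \<and> dominance_less \<mu> \<nu>. mfps_const (u \<mu>) * mono_sym \<mu>))) \<and>
     (\<forall>\<nu>\<in>partitions. \<forall>\<mu>\<in>partitions. \<nu> \<noteq> \<mu> \<longrightarrow> scalar_qt (P \<nu>) (P \<mu>) = 0)"

text \<open>The characterization determines \<open>P \<nu>\<close> for partitions \<open>\<nu>\<close> only, not for other lists.\<close>
definition macdonald_P :: "nat list \<Rightarrow> sfun" where
  "macdonald_P \<nu> = (THE p. \<exists>P. macdonald_family P \<and> p = P \<nu>)"

definition macdonald_Q :: "nat list \<Rightarrow> sfun" where
  "macdonald_Q \<nu> =
     mfps_const (inverse (scalar_qt (macdonald_P \<nu>) (macdonald_P \<nu>))) * macdonald_P \<nu>"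


section \<open>The functions \<open>g\<^sub>m\<close> and raising operators\<close>

text \<open>
  Infinite products \<open>(a;q)\<^sub>\<infinity>\<close> are limits in the \<open>q\<close>-adic topology of \<open>\<rat>(t)(q)\<close>:
  \<open>r\<close> has \<open>q\<close>-adic valuation at least \<open>k\<close> if it is \<open>q\<^sup>k\<close> times a rational function without
  a pole at \<open>q = 0\<close>.
\<close>
definition qadic_tendsto :: "(nat \<Rightarrow> Qqt) \<Rightarrow> Qqt \<Rightarrow> bool" where
  "qadic_tendsto X L \<longleftrightarrow>
     (\<forall>k. \<forall>\<^sub>F N in sequentially. \<exists>a b. coeff b 0 \<noteq> 0 \<and> X N - L = q0 ^ k * Fract a b)"

definition qpoch_inf :: "Qqt fps \<Rightarrow> Qqt fps" where
  "qpoch_inf a = Abs_fps (\<lambda>m. THE L.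
     qadic_tendsto (\<lambda>N. fps_nth (qpoch a (fps_const q0) N) m) L)"

text \<open>\<open>(t y; q)\<^sub>\<infinity> / (y; q)\<^sub>\<infinity>\<close> as a power series in \<open>y\<close>.\<close>
definition Hser :: "Qqt fps" where
  "Hser = qpoch_inf (fps_const t0 * fps_X) / qpoch_inf fps_X"

text \<open>The factor \<open>Hser (x\<^sub>i y)\<close>, as a power series in \<open>y\<close> with coefficients in the series in the \<open>x\<close>'s.\<close>
definition Hfactor :: "nat \<Rightarrow> sfun fps" where
  "Hfactor i = Abs_fps (\<lambda>m. mfps_const (fps_nth Hser m) * mfps_var i ^ m)"

definition gfun :: "int \<Rightarrow> sfun" where
  "gfun m = (if m < 0 then 0 else mfps_lim (\<lambda>N. fps_nth (\<Prod>i<N. Hfactor i) (nat m)))"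

definition gprod :: "nat \<Rightarrow> (nat \<Rightarrow> int) \<Rightarrow> sfun" where
  "gprod n a = (\<Prod>i = 1..n. gfun (a i))"

definition Raise :: "nat \<times> nat \<Rightarrow> (nat \<Rightarrow> int) \<Rightarrow> (nat \<Rightarrow> int)" where
  "Raise = (\<lambda>(i, j) a. (\<lambda>k. a k + (if k = i then 1 else 0) - (if k = j then 1 else 0)))"

text \<open>
  A formal power series \<open>\<Phi>\<close> in commuting variables indexed by pairs \<open>(i, j)\<close>, standing for
  \<open>R\<^sub>i\<^sub>j\<close>, acts on \<open>g\<^sub>a\<close> monomial by monomial. Only finitely many terms are nonzero if only
  variables from \<open>pairs n\<close> occur in \<open>\<Phi>\<close>.
\<close>
definition raise_apply :: "nat \<Rightarrow> (nat \<times> nat, Qqt) mfps \<Rightarrow> (nat \<Rightarrow> int) \<Rightarrow> sfun" where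
  "raise_apply n \<Phi> a =
     (\<Sum>M | mfps_nth \<Phi> M \<noteq> 0 \<and> gprod n (fold_mset Raise a M) \<noteq> 0.
        mfps_const (mfps_nth \<Phi> M) * gprod n (fold_mset Raise a M))"

definition raising_series :: "nat \<Rightarrow> (nat \<Rightarrow> Qqt) \<Rightarrow> (nat \<times> nat, Qqt) mfps" where
  "raising_series n s =
     (\<Prod>(k, l) \<in> pairs n. 1 - mfps_var (k, l))
     * mfps_sum (\<lambda>\<theta>. mfps_const (cc n \<theta> s q0 t0)
                      * (\<Prod>(i, j) \<in> pairs n. mfps_var (i, j) ^ \<theta> i j)) (Mats n)"

end

theory Submission
  imports Defs "HOL-Combinatorics.Permutations"
begin

text \<open>
  Write \<open>Q'\<^sub>\<lambda>\<close> for the right-hand side of the theorem. Under the substitution of \<open>x\<^sub>j / x\<^sub>i\<close> for \<open>R\<^sub>i\<^sub>j\<close>,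
  \<open>Q'\<^sub>\<lambda>\<close> is the coefficient of \<open>y\<^sup>\<lambda>\<close> in \<open>f(y) \<Prod>\<^sub>i G(y\<^sub>i)\<close>, where \<open>G(y) = \<Sum> g\<^sub>m y\<^sup>m\<close>. The \<open>g\<^sub>\<mu>\<close> are
  dual to the monomial symmetric functions, so \<open>\<langle>Q'\<^sub>\<lambda>, Q'\<^sub>\<mu>\<rangle>\<close> is the coefficient of \<open>y\<^sup>\<lambda> w\<^sup>\<mu>\<close> in
  \<open>f(y) f'(w) \<Pi>(y, w)\<close> with the Cauchy kernel \<open>\<Pi>\<close>. Moving the operator \<open>D\<^sup>1\<close> from \<open>f\<close> to \<open>\<Pi>\<close> by
  taking adjoints, and likewise for \<open>f'\<close>, gives the same result on both sides: by partial
  fractions \<open>\<Pi>\<close> is multiplied by a function that is symmetric in \<open>y\<close> and \<open>w\<close>. As the eigenvalues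
  are distinct, the \<open>Q'\<^sub>\<lambda>\<close> are pairwise orthogonal.

  Since raising operators only increase the dominance order, the matrix \<open>\<langle>Q'\<^sub>\<lambda>, m\<^sub>\<mu>\<rangle>\<close> is
  unitriangular. An orthogonal family with this property is, up to normalization, its own dual
  basis; therefore the functions \<open>Q'\<^sub>\<lambda> / \<langle>Q'\<^sub>\<lambda>, Q'\<^sub>\<lambda>\<rangle>\<close> satisfy the characterization of the \<open>P\<^sub>\<lambda>\<close>,
  and they are the only family that does.
\<close>

section \<open>Formal power series in many variables\<close>

lemma mfps_nth_simps [simp]:
  "mfps_nth (0 :: ('v, 'a::comm_ring_1) mfps) M = 0"
  "mfps_nth (1 :: ('v, 'a) mfps) M = (if M = {#} then 1 else 0)"
  "mfps_nth (f + g) M = mfps_nth f M + mfps_nth (g :: ('v, 'a) mfps) M"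
  "mfps_nth (f - g) M = mfps_nth f M - mfps_nth (g :: ('v, 'a) mfps) M"
  "mfps_nth (- f) M = - mfps_nth (f :: ('v, 'a) mfps) M"
  "mfps_nth (mfps_const c :: ('v, 'a) mfps) M = (if M = {#} then c else 0)"
  by (simp_all add: zero_mfps_def one_mfps_def plus_mfps_def minus_mfps_def uminus_mfps_def
      mfps_const_def)

lemma mfps_nth_mult:
  "mfps_nth (f * g) M = (\<Sum>A | A \<subseteq># M. mfps_nth f A * mfps_nth g (M - A))"
  by (simp add: times_mfps_def)

lemma mfps_nth_sum: "mfps_nth (\<Sum>i\<in>I. h i) M = (\<Sum>i\<in>I. mfps_nth (h i) M)"
  by (induction I rule: infinite_finite_induct) auto

definition mfps_mono :: "'v multiset \<Rightarrow> ('v, 'a::comm_ring_1) mfps" where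
  "mfps_mono A = Abs_mfps (\<lambda>M. if M = A then 1 else 0)"

lemma mfps_nth_mono [simp]: "mfps_nth (mfps_mono A) M = (if M = A then 1 else 0)"
  by (simp add: mfps_mono_def)

lemma mfps_nth_mono_mult:
  "mfps_nth (mfps_mono A * f) M = (if A \<subseteq># M then mfps_nth f (M - A) else 0)"
proof -
  have "mfps_nth (mfps_mono A * f) M
      = (\<Sum>B | B \<subseteq># M. if B = A then mfps_nth f (M - A) else 0)"
    unfolding mfps_nth_mult by (rule sum.cong) auto
  then show ?thesis by (simp add: sum.delta[OF finite_submultisets])
qed

lemma mfps_nth_const_mult [simp]: "mfps_nth (mfps_const c * f) M = c * mfps_nth f M"
proof -
  have "mfps_nth (mfps_const c * f) M
      = (\<Sum>B | B \<subseteq># M. if B = {#} then c * mfps_nth f M else 0)"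
    unfolding mfps_nth_mult by (rule sum.cong) auto
  then show ?thesis by (simp add: sum.delta[OF finite_submultisets])
qed

lemma mfps_mono_empty [simp]: "mfps_mono {#} = 1"
  by (rule mfps_eqI) simp

lemma mfps_mono_add: "mfps_mono (A + B) = mfps_mono A * mfps_mono B"
  by (rule mfps_eqI)
    (auto simp: mfps_nth_mono_mult subset_mset.le_iff_add)

lemma mfps_var_eq_mono: "mfps_var v = mfps_mono {#v#}"
  by (simp add: mfps_var_def mfps_mono_def)

lemma mfps_mono_sum: "mfps_mono (\<Sum>i\<in>I. A i) = (\<Prod>i\<in>I. mfps_mono (A i))"
  by (induction I rule: infinite_finite_induct) (auto simp: mfps_mono_add)

lemma mfps_mono_power: "mfps_mono A ^ k = mfps_mono (repeat_mset k A)"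
  by (induction k) (auto simp: mfps_mono_add)

lemma mfps_const_simps:
  "mfps_const 0 = (0 :: ('v, 'a::comm_ring_1) mfps)"
  "mfps_const 1 = (1 :: ('v, 'a) mfps)"
  "mfps_const (a + b) = (mfps_const a + mfps_const b :: ('v, 'a) mfps)"
  "mfps_const (a - b) = (mfps_const a - mfps_const b :: ('v, 'a) mfps)"
  "mfps_const (- a) = (- mfps_const a :: ('v, 'a) mfps)"
  "mfps_const (a * b) = (mfps_const a * mfps_const b :: ('v, 'a) mfps)"
  by (auto intro!: mfps_eqI)

lemma mfps_const_power: "mfps_const (a ^ k) = mfps_const a ^ k"
  by (induction k) (auto simp: mfps_const_simps)

lemma mfps_const_sum: "mfps_const (\<Sum>i\<in>I. h i) = (\<Sum>i\<in>I. mfps_const (h i))"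
  by (induction I rule: infinite_finite_induct) (auto simp: mfps_const_simps)

lemma mfps_nth_0_mult:
  "mfps_nth (f * g) {#} = mfps_nth f {#} * mfps_nth g {#}"
proof -
  have "{A. A \<subseteq># ({#} :: 'a multiset)} = {{#}}" by auto
  then show ?thesis by (simp add: mfps_nth_mult)
qed

lemma mfps_nth_0_prod:
  "mfps_nth (\<Prod>i\<in>I. h i) {#} = (\<Prod>i\<in>I. mfps_nth (h i) {#})"
  by (induction I rule: infinite_finite_induct) (auto simp: mfps_nth_0_mult)

lemma mfps_nth_power_eq_0:
  assumes "mfps_nth f {#} = 0" "size M < k"
  shows "mfps_nth (f ^ k) M = 0"
  using assms(2)
proof (induction k arbitrary: M)
  case (Suc k)
  have "mfps_nth f A * mfps_nth (f ^ k) (M - A) = 0" if "A \<subseteq># M" for A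
  proof (cases "A = {#}")
    case False
    then have "size A > 0" by (simp add: nonempty_has_size)
    then have "size (M - A) < k" using Suc.prems that
      by (metis (no_types, opaque_lifting) Suc_pred add_diff_cancel_left' diff_less_mono2
          less_Suc_eq_le not_less_eq size_Diff_submset size_mset_mono zero_less_iff_neq_zero
          diff_less le_less_trans order_less_le_trans not_less0 linorder_not_less)
    then show ?thesis using Suc.IH by simp
  qed (simp add: assms(1))
  then show ?case by (simp add: mfps_nth_mult)
qed simp

lemma mfps_nth_mfps_sum:
  assumes "finite J" "J \<subseteq> I" "\<And>b. b \<in> I - J \<Longrightarrow> mfps_nth (h b) M = 0"
  shows "mfps_nth (mfps_sum h I) M = (\<Sum>b\<in>J. mfps_nth (h b) M)"
  unfolding mfps_sum_def mfps_nth_Abs_mfps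
  using assms by (intro sum.mono_neutral_left) auto

definition mfps_geo :: "('v, 'a::comm_ring_1) mfps \<Rightarrow> ('v, 'a) mfps" where
  "mfps_geo x = mfps_sum (\<lambda>k. x ^ k) UNIV"

lemma mfps_nth_geo:
  assumes "mfps_nth x {#} = 0" "size M \<le> L"
  shows "mfps_nth (mfps_geo x) M = mfps_nth (\<Sum>k\<le>L. x ^ k) M"
  unfolding mfps_geo_def mfps_nth_sum
  by (rule mfps_nth_mfps_sum) (use assms in \<open>auto intro: mfps_nth_power_eq_0\<close>)

lemma mfps_geo_mult:
  fixes x :: "('v, 'a::comm_ring_1) mfps"
  assumes x: "mfps_nth x {#} = 0"
  shows "(1 - x) * mfps_geo x = 1"
proof (rule mfps_eqI)
  fix M :: "'v multiset"
  let ?L = "size M"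
  have "mfps_nth ((1 - x) * mfps_geo x) M = mfps_nth ((1 - x) * (\<Sum>k\<le>?L. x ^ k)) M"
    unfolding mfps_nth_mult
    by (intro sum.cong refl arg_cong2[where f="(*)"] mfps_nth_geo[OF x])
      (simp add: size_Diff_submset)
  also have "(1 - x) * (\<Sum>k\<le>?L. x ^ k) = 1 - x ^ Suc ?L"
    by (simp add: sum_gp_basic)
  finally show "mfps_nth ((1 - x) * mfps_geo x) M = mfps_nth 1 M"
    using mfps_nth_power_eq_0[OF x, of M "Suc ?L"] by simp
qed

lemma ratfac_eq_geo:
  assumes x: "mfps_nth x {#} = 0"
  shows "ratfac a b x = 1 + mfps_const (1 - a) * (mfps_geo (mfps_const b * x) - 1)"
proof (rule mfps_eqI)
  fix M
  let ?y = "mfps_const b * x"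
  have y: "mfps_nth ?y {#} = 0" using x by simp
  have pow: "mfps_const ((1 - a) * b ^ m) * x ^ m = mfps_const (1 - a) * ?y ^ m" for m
    by (simp add: mfps_const_simps mfps_const_power power_mult_distrib mult_ac)
  have "mfps_nth (mfps_sum (\<lambda>m. mfps_const ((1 - a) * b ^ m) * x ^ m) {1..}) M
      = (\<Sum>m\<in>{1..size M}. mfps_nth (mfps_const (1 - a) * ?y ^ m) M)"
    unfolding pow
    by (rule mfps_nth_mfps_sum) (auto simp: mfps_nth_power_eq_0[OF y])
  moreover have "{..size M} = insert 0 {1..size M}" by auto
  ultimately show "mfps_nth (ratfac a b x) M
      = mfps_nth (1 + mfps_const (1 - a) * (mfps_geo ?y - 1)) M"
    by (simp add: ratfac_def mfps_nth_geo[OF y order_refl] mfps_nth_sum sum_distrib_left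
        del: mult_eq_0_iff)
qed

lemma ratfac_mult:
  assumes x: "mfps_nth x {#} = 0"
  shows "(1 - mfps_const b * x) * ratfac a b x = 1 - mfps_const (a * b) * x"
proof -
  define u where "u = mfps_const b * x"
  have g: "(1 - u) * mfps_geo u = 1"
    by (rule mfps_geo_mult) (simp add: u_def x)
  have "(1 - u) * ratfac a b x
      = (1 - u) + mfps_const (1 - a) * ((1 - u) * mfps_geo u - (1 - u))"
    unfolding ratfac_eq_geo[OF x] u_def[symmetric] by (simp add: algebra_simps)
  also have "\<dots> = 1 - mfps_const a * u"
    unfolding g by (simp add: mfps_const_simps algebra_simps)
  finally show ?thesis by (simp add: u_def mfps_const_simps mult_ac)
qed

definition mfps_scale :: "('v multiset \<Rightarrow> 'a::comm_ring_1) \<Rightarrow> ('v, 'a) mfps \<Rightarrow> ('v, 'a) mfps" where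
  "mfps_scale \<chi> f = Abs_mfps (\<lambda>M. \<chi> M * mfps_nth f M)"

lemma mfps_nth_scale [simp]: "mfps_nth (mfps_scale \<chi> f) M = \<chi> M * mfps_nth f M"
  by (simp add: mfps_scale_def)

lemma mfps_scale_mult:
  assumes "\<And>A B. \<chi> (A + B) = \<chi> A * \<chi> B"
  shows "mfps_scale \<chi> (f * g) = mfps_scale \<chi> f * mfps_scale \<chi> g"
proof (rule mfps_eqI)
  fix M
  have "\<chi> M * (mfps_nth f A * mfps_nth g (M - A))
      = \<chi> A * mfps_nth f A * (\<chi> (M - A) * mfps_nth g (M - A))" if "A \<subseteq># M" for A
    using assms[of A "M - A"] that by (simp add: mult_ac)
  then show "mfps_nth (mfps_scale \<chi> (f * g)) M = mfps_nth (mfps_scale \<chi> f * mfps_scale \<chi> g) M"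
    by (auto simp: mfps_nth_mult sum_distrib_left intro!: sum.cong)
qed

lemma mfps_scale_add: "mfps_scale \<chi> (f + g) = mfps_scale \<chi> f + mfps_scale \<chi> g"
  by (rule mfps_eqI) (simp add: distrib_left)

lemma mfps_scale_diff: "mfps_scale \<chi> (f - g) = mfps_scale \<chi> f - mfps_scale \<chi> g"
  by (rule mfps_eqI) (simp add: right_diff_distrib)

lemma mfps_scale_mono: "mfps_scale \<chi> (mfps_mono A) = mfps_const (\<chi> A) * mfps_mono A"
  by (rule mfps_eqI) simp

lemma mfps_scale_const: "\<chi> {#} = 1 \<Longrightarrow> mfps_scale \<chi> (mfps_const c) = mfps_const c"
  by (rule mfps_eqI) simp

lemma mfps_scale_1: "\<chi> {#} = 1 \<Longrightarrow> mfps_scale \<chi> 1 = 1"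
  by (rule mfps_eqI) simp

lemma mfps_scale_prod:
  assumes "\<And>A B. \<chi> (A + B) = \<chi> A * \<chi> B" "\<chi> {#} = 1"
  shows "mfps_scale \<chi> (\<Prod>i\<in>I. h i) = (\<Prod>i\<in>I. mfps_scale \<chi> (h i))"
  by (induction I rule: infinite_finite_induct)
    (auto simp: mfps_scale_1 assms mfps_scale_mult[OF assms(1)])

lemma mfps_geo_unique:
  assumes "mfps_nth x {#} = 0" "(1 - x) * g = 1"
  shows "g = mfps_geo x"
proof -
  have "g = ((1 - x) * mfps_geo x) * g" by (simp add: mfps_geo_mult[OF assms(1)])
  also have "\<dots> = mfps_geo x * ((1 - x) * g)" by (simp only: mult_ac)
  finally show ?thesis by (simp add: assms(2))
qed

lemma mfps_scale_mfps_geo: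
  assumes "\<And>A B. \<chi> (A + B) = \<chi> A * \<chi> B" "\<chi> {#} = 1" "mfps_nth x {#} = 0"
  shows "mfps_scale \<chi> (mfps_geo x) = mfps_geo (mfps_scale \<chi> x)"
proof (rule mfps_geo_unique)
  have "(1 - mfps_scale \<chi> x) * mfps_scale \<chi> (mfps_geo x) = mfps_scale \<chi> ((1 - x) * mfps_geo x)"
    by (simp add: mfps_scale_mult[OF assms(1)] mfps_scale_diff mfps_scale_1[where \<chi>=\<chi>, OF assms(2)])
  also have "\<dots> = 1" by (simp add: mfps_geo_mult[OF assms(3)] mfps_scale_1[where \<chi>=\<chi>, OF assms(2)])
  finally show "(1 - mfps_scale \<chi> x) * mfps_scale \<chi> (mfps_geo x) = 1" .
qed (simp add: assms)

text \<open>
  Substitution of the monomial \<open>\<psi> {#v#}\<close> for each variable \<open>v\<close>, for an injective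
  homomorphism \<open>\<psi>\<close> of the monoids of monomials.
\<close>
definition mfps_push :: "('v multiset \<Rightarrow> 'w multiset) \<Rightarrow> ('v, 'a::comm_ring_1) mfps \<Rightarrow> ('w, 'a) mfps" where
  "mfps_push \<psi> f = Abs_mfps (\<lambda>N. if N \<in> range \<psi> then mfps_nth f (inv \<psi> N) else 0)"

locale mono_emb =
  fixes \<psi> :: "'v multiset \<Rightarrow> 'w multiset"
  assumes inj: "inj \<psi>" and add: "\<psi> (A + B) = \<psi> A + \<psi> B"
begin

lemma empty [simp]: "\<psi> {#} = {#}"
  using add[of "{#}" "{#}"] by simp

lemma nth_push [simp]: "mfps_nth (mfps_push \<psi> f) (\<psi> M) = mfps_nth f M"
  by (simp add: mfps_push_def inj)

lemma nth_push_out: "N \<notin> range \<psi> \<Longrightarrow> mfps_nth (mfps_push \<psi> f) N = 0"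
  by (simp add: mfps_push_def)

lemma push_eqI:
  assumes "\<And>M. mfps_nth g (\<psi> M) = mfps_nth f M" "\<And>N. N \<notin> range \<psi> \<Longrightarrow> mfps_nth g N = 0"
  shows "mfps_push \<psi> f = g"
proof (rule mfps_eqI)
  fix N
  show "mfps_nth (mfps_push \<psi> f) N = mfps_nth g N"
    by (cases "N \<in> range \<psi>") (auto simp: nth_push_out assms)
qed

lemma push_const [simp]: "mfps_push \<psi> (mfps_const c) = mfps_const c"
  by (rule push_eqI) (use inj in \<open>auto simp: inj_eq[OF inj, of _ "{#}", simplified]\<close>)

lemma push_mono [simp]: "mfps_push \<psi> (mfps_mono A) = mfps_mono (\<psi> A)"
  by (rule push_eqI) (auto simp: inj_eq[OF inj])

lemma push_1 [simp]: "mfps_push \<psi> 1 = 1"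
  using push_const[of 1] by (simp add: mfps_const_simps)

lemma push_add: "mfps_push \<psi> (f + g) = mfps_push \<psi> f + mfps_push \<psi> g"
  and push_diff: "mfps_push \<psi> (f - g) = mfps_push \<psi> f - mfps_push \<psi> g"
  by (auto intro!: push_eqI simp: nth_push_out)

lemma push_0 [simp]: "mfps_push \<psi> 0 = 0"
  by (auto intro!: push_eqI)

lemma push_sum: "mfps_push \<psi> (\<Sum>i\<in>I. h i) = (\<Sum>i\<in>I. mfps_push \<psi> (h i))"
  by (induction I rule: infinite_finite_induct) (auto simp: push_add)

lemma push_mult: "mfps_push \<psi> (f * g) = mfps_push \<psi> f * mfps_push \<psi> g"
proof (rule push_eqI)
  fix M
  have "(\<Sum>A | A \<subseteq># \<psi> M. mfps_nth (mfps_push \<psi> f) A * mfps_nth (mfps_push \<psi> g) (\<psi> M - A))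
      = (\<Sum>A \<in> \<psi> ` {A. A \<subseteq># M}. mfps_nth (mfps_push \<psi> f) A * mfps_nth (mfps_push \<psi> g) (\<psi> M - A))"
  proof (rule sum.mono_neutral_right)
    show "\<psi> ` {A. A \<subseteq># M} \<subseteq> {A. A \<subseteq># \<psi> M}"
      by (auto simp: subset_mset.le_iff_add add)
    show "\<forall>A\<in>{A. A \<subseteq># \<psi> M} - \<psi> ` {A. A \<subseteq># M}.
        mfps_nth (mfps_push \<psi> f) A * mfps_nth (mfps_push \<psi> g) (\<psi> M - A) = 0"
    proof
      fix A assume A: "A \<in> {A. A \<subseteq># \<psi> M} - \<psi> ` {A. A \<subseteq># M}"
      have "A \<notin> range \<psi> \<or> \<psi> M - A \<notin> range \<psi>"
      proof (rule ccontr)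
        assume "\<not> ?thesis"
        then obtain B C where "A = \<psi> B" "\<psi> M - A = \<psi> C" by auto
        then have "\<psi> M = \<psi> (B + C)" using A by (simp add: add) (metis subset_mset.add_diff_inverse)
        then have "M = B + C" using inj by (simp add: inj_eq)
        then show False using A \<open>A = \<psi> B\<close> by auto
      qed
      then show "mfps_nth (mfps_push \<psi> f) A * mfps_nth (mfps_push \<psi> g) (\<psi> M - A) = 0"
        by (auto simp: nth_push_out)
    qed
  qed (rule finite_submultisets)
  also have "\<dots> = (\<Sum>A | A \<subseteq># M. mfps_nth f A * mfps_nth g (M - A))"
  proof (subst sum.reindex)
    show "inj_on \<psi> {A. A \<subseteq># M}" using inj by (meson inj_on_subset subset_UNIV)
    have "\<psi> M - \<psi> A = \<psi> (M - A)" if "A \<subseteq># M" for A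
      using that by (auto simp: subset_mset.le_iff_add add)
    then show "sum ((\<lambda>A. mfps_nth (mfps_push \<psi> f) A * mfps_nth (mfps_push \<psi> g) (\<psi> M - A)) \<circ> \<psi>)
        {A. A \<subseteq># M} = (\<Sum>A | A \<subseteq># M. mfps_nth f A * mfps_nth g (M - A))"
      by (auto intro!: sum.cong)
  qed
  finally show "mfps_nth (mfps_push \<psi> f * mfps_push \<psi> g) (\<psi> M) = mfps_nth (f * g) M"
    by (simp add: mfps_nth_mult)
next
  fix N assume N: "N \<notin> range \<psi>"
  have "mfps_nth (mfps_push \<psi> f) A * mfps_nth (mfps_push \<psi> g) (N - A) = 0" if "A \<subseteq># N" for A
  proof (rule ccontr)
    assume "\<not> ?thesis"
    then obtain B C where "A = \<psi> B" "N - A = \<psi> C"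
      using nth_push_out by (metis mult_zero_left mult_zero_right rangeE)
    then have "N = \<psi> (B + C)" using that add by (metis subset_mset.add_diff_inverse)
    then show False using N by auto
  qed
  then show "mfps_nth (mfps_push \<psi> f * mfps_push \<psi> g) N = 0" by (simp add: mfps_nth_mult)
qed

lemma push_prod: "mfps_push \<psi> (\<Prod>i\<in>I. h i) = (\<Prod>i\<in>I. mfps_push \<psi> (h i))"
  by (induction I rule: infinite_finite_induct) (auto simp: push_mult)

lemma scale_push: "mfps_scale \<chi> (mfps_push \<psi> f) = mfps_push \<psi> (mfps_scale (\<lambda>M. \<chi> (\<psi> M)) f)"
  by (rule push_eqI[symmetric]) (auto simp: nth_push_out)

lemma nth_push_mult:
  assumes N: "\<And>A. \<psi> A \<subseteq># N \<longleftrightarrow> A \<subseteq># M"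
  shows "mfps_nth (mfps_push \<psi> f * g) N = (\<Sum>A | A \<subseteq># M. mfps_nth f A * mfps_nth g (N - \<psi> A))"
proof -
  have "mfps_nth (mfps_push \<psi> f * g) N
      = (\<Sum>A \<in> \<psi> ` {A. A \<subseteq># M}. mfps_nth (mfps_push \<psi> f) A * mfps_nth g (N - A))"
    unfolding mfps_nth_mult
  proof (rule sum.mono_neutral_right)
    show "\<psi> ` {A. A \<subseteq># M} \<subseteq> {A. A \<subseteq># N}" using N by auto
    show "\<forall>A\<in>{A. A \<subseteq># N} - \<psi> ` {A. A \<subseteq># M}.
        mfps_nth (mfps_push \<psi> f) A * mfps_nth g (N - A) = 0"
    proof
      fix A assume A: "A \<in> {A. A \<subseteq># N} - \<psi> ` {A. A \<subseteq># M}"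
      then have "A \<notin> range \<psi>" using N by auto
      then show "mfps_nth (mfps_push \<psi> f) A * mfps_nth g (N - A) = 0" by (simp add: nth_push_out)
    qed
  qed (rule finite_submultisets)
  also have "\<dots> = (\<Sum>A | A \<subseteq># M. mfps_nth f A * mfps_nth g (N - \<psi> A))"
  proof (subst sum.reindex)
    show "inj_on \<psi> {A. A \<subseteq># M}" using inj by (meson inj_on_subset subset_UNIV)
  qed (auto intro!: sum.cong)
  finally show ?thesis .
qed

lemma push_geo:
  assumes x: "mfps_nth x {#} = 0"
  shows "mfps_push \<psi> (mfps_geo x) = mfps_geo (mfps_push \<psi> x)"
proof (rule mfps_geo_unique)
  show "mfps_nth (mfps_push \<psi> x) {#} = 0" using nth_push[of x "{#}"] x by simp
  have "(1 - mfps_push \<psi> x) * mfps_push \<psi> (mfps_geo x) = mfps_push \<psi> ((1 - x) * mfps_geo x)"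
    by (simp add: push_mult push_diff)
  then show "(1 - mfps_push \<psi> x) * mfps_push \<psi> (mfps_geo x) = 1"
    by (simp add: mfps_geo_mult[OF x])
qed

end

section \<open>The series \<open>(ty; q)\<^sub>\<infinity> / (y; q)\<^sub>\<infinity>\<close>\<close>

lemma q0_power: "q0 ^ k = Fract (monom 1 k) 1"
proof (induction k)
  case 0
  show ?case unfolding power_0 monom_eq_1 by (rule One_fract_def)
next
  case (Suc k)
  show ?case unfolding power_Suc Suc unfolding q0_def mult_fract by (simp add: monom_Suc)
qed

lemma t0_power: "t0 ^ k = Fract [:Fract (monom 1 k) 1:] 1"
proof (induction k)
  case 0
  show ?case unfolding power_0 monom_eq_1 One_fract_def[symmetric] one_pCons[symmetric] ..
next
  case (Suc k)
  show ?case unfolding power_Suc Suc unfolding t0_def mult_fract by (simp add: monom_Suc)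
qed

lemma qt_power: "t0 ^ l * q0 ^ k = Fract (monom (Fract (monom 1 l) 1) k) 1"
  by (simp add: q0_power t0_power smult_monom)

lemma Fract_1_eq_iff: "Fract a 1 = Fract b (1 :: 'a::idom) \<longleftrightarrow> a = b"
  by (simp add: eq_fract)

lemma monom_fract_sum:
  "(\<Sum>i\<in>I. Fract (h i) (1 :: 'a::idom)) = Fract (\<Sum>i\<in>I. h i) 1"
  by (induction I rule: infinite_finite_induct) (auto simp: Zero_fract_def)

lemma qt_sum_eqD:
  assumes "(\<Sum>i\<in>I. t0 ^ e i * q0 ^ k i) = (\<Sum>i\<in>I. t0 ^ e i * q0 ^ l i)"
    and "finite I" "inj_on e I" "i \<in> I"
  shows "k i = l i"
proof -
  have coeffs: "coeff (\<Sum>i\<in>I. monom (Fract (monom (1 :: rat) (e i)) 1) (h i)) d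
      = Fract (\<Sum>j\<in>{j\<in>I. h j = d}. monom 1 (e j)) 1" for h :: "_ \<Rightarrow> nat" and d
  proof -
    have "coeff (\<Sum>i\<in>I. monom (Fract (monom (1 :: rat) (e i)) 1) (h i)) d
      = (\<Sum>i\<in>I. if h i = d then Fract (monom (1 :: rat) (e i)) 1 else 0)"
      by (simp add: coeff_sum eq_commute)
    also have "\<dots> = (\<Sum>i\<in>{j\<in>I. h j = d}. Fract (monom (1 :: rat) (e i)) 1)"
      using assms(2) by (simp add: sum.If_cases Int_def)
    finally show ?thesis by (simp add: monom_fract_sum)
  qed
  have coeffs2: "coeff (\<Sum>j\<in>{j\<in>I. h j = d}. monom (1 :: rat) (e j)) (e i)
      = (if h i = d then 1 else 0)" for h :: "_ \<Rightarrow> nat" and d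
  proof -
    have "coeff (\<Sum>j\<in>{j\<in>I. h j = d}. monom (1 :: rat) (e j)) (e i)
        = (\<Sum>j\<in>{j\<in>I. h j = d}. if j = i then 1 else 0)"
      unfolding coeff_sum using assms(3,4) by (intro sum.cong) (auto simp: inj_on_eq_iff)
    then show ?thesis using assms(2,4) by (auto simp: sum.delta)
  qed
  have "(\<Sum>i\<in>I. monom (Fract (monom (1 :: rat) (e i)) 1) (k i))
      = (\<Sum>i\<in>I. monom (Fract (monom (1 :: rat) (e i)) 1) (l i))"
    using assms(1) unfolding qt_power monom_fract_sum Fract_1_eq_iff .
  from arg_cong[OF this, of "\<lambda>p. coeff p (k i)"]
  have "Fract (\<Sum>j\<in>{j\<in>I. k j = k i}. monom (1 :: rat) (e j)) 1
      = Fract (\<Sum>j\<in>{j\<in>I. l j = k i}. monom (1 :: rat) (e j)) 1"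
    unfolding coeffs .
  then have "coeff (\<Sum>j\<in>{j\<in>I. k j = k i}. monom (1 :: rat) (e j)) (e i)
      = coeff (\<Sum>j\<in>{j\<in>I. l j = k i}. monom (1 :: rat) (e j)) (e i)"
    unfolding Fract_1_eq_iff by simp
  then show ?thesis unfolding coeffs2 by (simp split: if_splits)
qed

lemma Fract_1_eq_0_iff: "Fract a (1 :: 'a::idom) = 0 \<longleftrightarrow> a = 0"
  unfolding Zero_fract_def Fract_1_eq_iff ..

lemma q0_nonzero [simp]: "q0 \<noteq> 0" and t0_nonzero [simp]: "t0 \<noteq> 0"
  by (simp_all add: q0_def t0_def Fract_1_eq_0_iff)

lemma qt_power_eq_iff: "t0 ^ a * q0 ^ b = t0 ^ c * q0 ^ d \<longleftrightarrow> a = c \<and> b = d"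
proof
  assume "t0 ^ a * q0 ^ b = t0 ^ c * q0 ^ d"
  then have *: "monom (Fract (monom (1::rat) a) 1) b = monom (Fract (monom 1 c) 1) d"
    unfolding qt_power Fract_1_eq_iff .
  have nz: "Fract (monom (1::rat) c) 1 \<noteq> 0" by (simp add: Fract_1_eq_0_iff)
  from * have "coeff (monom (Fract (monom (1::rat) a) 1) b) d = Fract (monom 1 c) 1"
    by simp
  then have "b = d" using nz by (auto split: if_splits)
  with * have "Fract (monom (1::rat) a) 1 = Fract (monom 1 c) 1"
    by (metis coeff_monom)
  then have "monom (1::rat) a = monom 1 c" unfolding Fract_1_eq_iff .
  then have "a = c" by (metis coeff_monom zero_neq_one)
  with \<open>b = d\<close> show "a = c \<and> b = d" by simp
qed simp

lemma q0_power_eq_1_iff [simp]: "q0 ^ k = 1 \<longleftrightarrow> k = 0"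
  using qt_power_eq_iff[of 0 k 0 0] by simp

lemma t0_power_eq_1_iff [simp]: "t0 ^ k = 1 \<longleftrightarrow> k = 0"
  using qt_power_eq_iff[of k 0 0 0] by simp

lemma q0_power_neq_1: "k > 0 \<Longrightarrow> 1 - q0 ^ k \<noteq> 0"
  by (metis q0_power_eq_1_iff right_minus_eq less_irrefl)

lemma t0_power_neq_1: "k > 0 \<Longrightarrow> 1 - t0 ^ k \<noteq> 0"
  by (metis t0_power_eq_1_iff right_minus_eq less_irrefl)

definition qreg :: "Qqt \<Rightarrow> bool" where
  "qreg r \<longleftrightarrow> (\<exists>a b. coeff b 0 \<noteq> 0 \<and> r = Fract a b)"

lemma qreg_Fract_1: "qreg (Fract a 1)"
  unfolding qreg_def by (intro exI[of _ a] exI[of _ 1]) simp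

lemma qreg_q0 [simp]: "qreg q0" and qreg_t0 [simp]: "qreg t0"
  and qreg_0 [simp]: "qreg 0" and qreg_1 [simp]: "qreg 1"
  unfolding q0_def t0_def Zero_fract_def One_fract_def by (rule qreg_Fract_1)+

lemma qreg_mult: "qreg x \<Longrightarrow> qreg y \<Longrightarrow> qreg (x * y)"
proof -
  assume "qreg x" "qreg y"
  then obtain a b c d where "coeff b 0 \<noteq> 0" "x = Fract a b" "coeff d 0 \<noteq> 0" "y = Fract c d"
    unfolding qreg_def by auto
  then have "coeff (b * d) 0 \<noteq> 0 \<and> x * y = Fract (a * c) (b * d)"
    by (auto simp: coeff_mult)
  then show ?thesis unfolding qreg_def by blast
qed

lemma qreg_add: "qreg x \<Longrightarrow> qreg y \<Longrightarrow> qreg (x + y)"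
proof -
  assume "qreg x" "qreg y"
  then obtain a b c d where *: "coeff b 0 \<noteq> 0" "x = Fract a b" "coeff d 0 \<noteq> 0" "y = Fract c d"
    unfolding qreg_def by auto
  then have "b \<noteq> 0" "d \<noteq> 0" by auto
  with * have "coeff (b * d) 0 \<noteq> 0 \<and> x + y = Fract (a * d + c * b) (b * d)"
    by (auto simp: coeff_mult)
  then show ?thesis unfolding qreg_def by blast
qed

lemma qreg_uminus: "qreg x \<Longrightarrow> qreg (- x)"
  unfolding qreg_def by (metis minus_fract)

lemma qreg_diff: "qreg x \<Longrightarrow> qreg y \<Longrightarrow> qreg (x - y)"
  using qreg_add[of x "- y"] qreg_uminus by simp

lemma qreg_power: "qreg x \<Longrightarrow> qreg (x ^ k)"
  by (induction k) (auto intro: qreg_mult)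

lemma qreg_inverse_1_minus: "k > 0 \<Longrightarrow> qreg (inverse (1 - q0 ^ k))"
proof -
  assume "k > 0"
  have "1 - q0 ^ k = Fract (1 - monom 1 k) 1"
    by (simp add: q0_power One_fract_def)
  then have "inverse (1 - q0 ^ k) = Fract 1 (1 - monom 1 k)" by simp
  moreover have "coeff (1 - monom 1 k :: rat poly fract poly) 0 \<noteq> 0" using \<open>k > 0\<close> by simp
  ultimately show ?thesis unfolding qreg_def by blast
qed

lemma qreg_div_1_minus: "k > 0 \<Longrightarrow> qreg x \<Longrightarrow> qreg (x / (1 - q0 ^ k))"
  by (simp add: divide_inverse qreg_mult qreg_inverse_1_minus)

lemma qadic_tendsto_alt:
  "qadic_tendsto X L \<longleftrightarrow> (\<forall>k. \<forall>\<^sub>F N in sequentially. \<exists>r. qreg r \<and> X N - L = q0 ^ k * r)"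
proof -
  have "(\<exists>a b. coeff b 0 \<noteq> 0 \<and> x = q0 ^ k * Fract a b) \<longleftrightarrow> (\<exists>r. qreg r \<and> x = q0 ^ k * r)"
    for x k unfolding qreg_def by blast
  then show ?thesis by (simp only: qadic_tendsto_def)
qed

lemma qadic_zeroI:
  assumes "\<And>k. \<exists>r. qreg r \<and> x = q0 ^ k * r"
  shows "x = 0"
proof -
  obtain c d where cd: "x = Fract c d" "d \<noteq> 0" by (cases x) auto
  show ?thesis
  proof (rule ccontr)
    assume "x \<noteq> 0"
    then have c: "c \<noteq> 0" using cd by (auto simp: Zero_fract_def eq_fract)
    define k where "k = Suc (degree c)"
    obtain a b where ab: "coeff b 0 \<noteq> 0" "x = q0 ^ k * Fract a b"
      using assms[of k] unfolding qreg_def by blast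
    have b: "b \<noteq> 0" using ab by auto
    have "Fract c d = Fract (monom 1 k * a) b"
      using ab cd by (simp add: q0_power)
    then have eq: "c * b = monom 1 k * a * d" using cd b by (simp add: eq_fract)
    have "monom 1 k dvd c * b" unfolding eq by simp
    then have dvd: "(monom 1 1) ^ k dvd c * b" by (simp add: monom_power)
    have X: "monom 1 1 = [:- 0, 1 :: rat poly fract:]" by (simp add: monom_Suc monom_0)
    have "order 0 (c * b) \<ge> k"
      using dvd order_divides[of 0 k "c * b"] c b unfolding X by simp
    moreover have "poly b 0 \<noteq> 0" using ab(1) by (simp add: poly_0_coeff_0)
    then have "order 0 b = 0" by (rule order_0I)
    moreover have "order 0 (c * b) = order 0 c + order 0 b"
      by (rule order_mult) (use c b in simp)
    ultimately have "order 0 c \<ge> k" by linarith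
    then show False using order_degree[OF c, of 0] by (simp add: k_def)
  qed
qed

lemma qadic_tendsto_unique:
  assumes "qadic_tendsto X L" "qadic_tendsto X L'"
  shows "L = L'"
proof -
  have "L' - L = 0"
  proof (rule qadic_zeroI)
    fix k
    have "\<forall>\<^sub>F N in sequentially. (\<exists>r. qreg r \<and> X N - L = q0 ^ k * r) \<and> (\<exists>r. qreg r \<and> X N - L' = q0 ^ k * r)"
      using assms unfolding qadic_tendsto_alt by (auto intro: eventually_conj)
    then obtain N where "(\<exists>r. qreg r \<and> X N - L = q0 ^ k * r) \<and> (\<exists>r. qreg r \<and> X N - L' = q0 ^ k * r)"
      unfolding eventually_sequentially by blast
    then obtain r r' where "qreg r" "qreg r'" "X N - L = q0 ^ k * r" "X N - L' = q0 ^ k * r'"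
      by auto
    then have "qreg (r - r') \<and> L' - L = q0 ^ k * (r - r')"
      by (simp add: qreg_diff algebra_simps)
    then show "\<exists>r. qreg r \<and> L' - L = q0 ^ k * r" by blast
  qed
  then show ?thesis by simp
qed

lemma qpoch_fps_rec:
  assumes "m > 0"
  shows "fps_nth (qpoch (fps_const a * fps_X) (fps_const q0) N) m * (1 - q0 ^ m)
    = a * (q0 ^ N - q0 ^ (m - 1)) * fps_nth (qpoch (fps_const a * fps_X) (fps_const q0) N) (m - 1)"
proof -
  define e where "e N m = fps_nth (qpoch (fps_const a * fps_X) (fps_const q0) N) m" for N m
  have step: "e (Suc N) m = e N m - (if m = 0 then 0 else a * q0 ^ N * e N (m - 1))" for N m
  proof -
    have "qpoch (fps_const a * fps_X) (fps_const q0) (Suc N)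
       = qpoch (fps_const a * fps_X) (fps_const q0) N
         - fps_const (a * q0 ^ N) * (fps_X * qpoch (fps_const a * fps_X) (fps_const q0) N)"
      by (simp add: qpoch_def algebra_simps fps_const_power flip: fps_const_mult)
    then show ?thesis by (simp add: e_def del: fps_const_mult)
  qed
  have e0: "e N 0 = 1" for N
    by (induction N) (auto simp: step, simp add: e_def qpoch_def)
  have "e N m * (1 - q0 ^ m) = a * (q0 ^ N - q0 ^ (m - 1)) * e N (m - 1)" if "m > 0" for m
    using that
  proof (induction N arbitrary: m)
    case 0
    have "e 0 m = 0" if "m > 0" for m using that by (simp add: e_def qpoch_def)
    then show ?case using 0 by (cases "m = 1") (auto simp: e0)
  next
    case (Suc N)
    obtain j where j: "m = Suc j" using Suc.prems by (cases m) auto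
    have IH1: "e N (Suc j) * (1 - q0 ^ Suc j) = a * (q0 ^ N - q0 ^ j) * e N j"
      using Suc.IH[of m] j by simp
    have L: "e (Suc N) (Suc j) * (1 - q0 ^ Suc j)
        = e N (Suc j) * (1 - q0 ^ Suc j) - a * q0 ^ N * e N j * (1 - q0 ^ Suc j)"
      by (simp add: step left_diff_distrib)
    show ?case
    proof (cases j)
      case 0
      show ?thesis unfolding j L IH1 unfolding 0 by (simp add: e0 algebra_simps)
    next
      case (Suc i)
      have IH2: "e N j * (1 - q0 ^ j) = a * (q0 ^ N - q0 ^ i) * e N i"
        using Suc.IH[of j] \<open>j = Suc i\<close> by simp
      have "a * (q0 ^ Suc N - q0 ^ j) * e (Suc N) j
          = a * (q0 ^ Suc N - q0 ^ j) * e N j - a * q0 ^ Suc N * (a * (q0 ^ N - q0 ^ i) * e N i)"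
        by (simp add: step Suc algebra_simps)
      also have "\<dots> = a * (q0 ^ Suc N - q0 ^ j) * e N j - a * q0 ^ Suc N * (e N j * (1 - q0 ^ j))"
        unfolding IH2 ..
      also have "\<dots> = e (Suc N) (Suc j) * (1 - q0 ^ Suc j)"
        unfolding L IH1 by (simp add: algebra_simps)
      finally show ?thesis by (simp add: j)
    qed
  qed
  then show ?thesis using assms unfolding e_def by simp
qed

definition qexp_coeff :: "Qqt \<Rightarrow> nat \<Rightarrow> Qqt" where
  "qexp_coeff a m = (\<Prod>i<m. - (a * q0 ^ i) / (1 - q0 ^ Suc i))"

lemma qpoch_fps_tendsto:
  assumes a: "qreg a"
  shows "qadic_tendsto (\<lambda>N. fps_nth (qpoch (fps_const a * fps_X) (fps_const q0) N) m) (qexp_coeff a m)"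
proof -
  define e where "e N m = fps_nth (qpoch (fps_const a * fps_X) (fps_const q0) N) m" for N m
  have e0: "e N 0 = 1" for N by (induction N) (auto simp: e_def qpoch_def)
  have rec: "e N (Suc m) = a * (q0 ^ N - q0 ^ m) * e N m / (1 - q0 ^ Suc m)" for N m
    unfolding e_def using qpoch_fps_rec[of "Suc m" a N] q0_power_neq_1[of "Suc m"]
    by (intro eq_divide_imp) simp_all
  have reg: "qreg (e N m)" for N m
  proof (induction m)
    case (Suc m)
    show ?case unfolding rec
      by (intro qreg_div_1_minus qreg_mult qreg_diff qreg_power a Suc) auto
  qed (simp add: e0)
  have main: "\<exists>r. qreg r \<and> e N m - qexp_coeff a m = q0 ^ N * r" for N
  proof (induction m)
    case 0
    show ?case by (rule exI[of _ 0]) (simp add: e0 qexp_coeff_def)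
  next
    case (Suc m)
    then obtain r where r: "qreg r" "e N m - qexp_coeff a m = q0 ^ N * r" by blast
    let ?r = "(a * e N m - a * q0 ^ m * r) / (1 - q0 ^ Suc m)"
    have L: "qexp_coeff a (Suc m) = - (a * q0 ^ m) * qexp_coeff a m / (1 - q0 ^ Suc m)"
      by (simp add: qexp_coeff_def)
    have "e N (Suc m) - qexp_coeff a (Suc m)
        = (a * q0 ^ N * e N m - a * q0 ^ m * (e N m - qexp_coeff a m)) / (1 - q0 ^ Suc m)"
      unfolding rec L diff_divide_distrib[symmetric] by (simp add: algebra_simps)
    also have "\<dots> = q0 ^ N * ?r" unfolding r(2) by (simp add: algebra_simps)
    finally have "e N (Suc m) - qexp_coeff a (Suc m) = q0 ^ N * ?r" .
    moreover have "qreg ?r"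
      by (intro qreg_div_1_minus qreg_mult qreg_diff qreg_power a reg r) auto
    ultimately show ?case by blast
  qed
  have "\<exists>r. qreg r \<and>
      fps_nth (qpoch (fps_const a * fps_X) (fps_const q0) N) m - qexp_coeff a m = q0 ^ k * r"
    if "k \<le> N" for k N
  proof -
    obtain r where r: "qreg r" "e N m - qexp_coeff a m = q0 ^ N * r" using main by blast
    have "q0 ^ N = q0 ^ k * q0 ^ (N - k)" using that by (simp flip: power_add)
    with r have "qreg (q0 ^ (N - k) * r) \<and> e N m - qexp_coeff a m = q0 ^ k * (q0 ^ (N - k) * r)"
      by (simp add: qreg_mult qreg_power mult.assoc)
    then show ?thesis unfolding e_def by blast
  qed
  then show ?thesis unfolding qadic_tendsto_alt eventually_sequentially by blast
qed

lemma qpoch_inf_eq: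
  assumes "qreg a"
  shows "qpoch_inf (fps_const a * fps_X) = Abs_fps (qexp_coeff a)"
proof (rule fps_ext)
  fix m
  have "(THE L. qadic_tendsto (\<lambda>N. fps_nth (qpoch (fps_const a * fps_X) (fps_const q0) N) m) L)
      = qexp_coeff a m"
    using qpoch_fps_tendsto[OF assms] by (rule the_equality) (rule qadic_tendsto_unique[OF _ qpoch_fps_tendsto[OF assms]])
  then show "fps_nth (qpoch_inf (fps_const a * fps_X)) m = fps_nth (Abs_fps (qexp_coeff a)) m"
    by (simp add: qpoch_inf_def)
qed

definition qdil :: "Qqt fps \<Rightarrow> Qqt fps" where
  "qdil f = Abs_fps (\<lambda>k. q0 ^ k * fps_nth f k)"

lemma qdil_nth [simp]: "fps_nth (qdil f) k = q0 ^ k * fps_nth f k"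
  by (simp add: qdil_def)

lemma qdil_mult: "qdil (f * g) = qdil f * qdil g"
proof (rule fps_ext)
  fix k
  have "q0 ^ k * (fps_nth f i * fps_nth g (k - i))
      = (q0 ^ i * fps_nth f i) * (q0 ^ (k - i) * fps_nth g (k - i))" if "i \<le> k" for i
  proof -
    have "q0 ^ k = q0 ^ i * q0 ^ (k - i)" using that by (simp flip: power_add)
    then show ?thesis by (simp add: mult_ac)
  qed
  then show "fps_nth (qdil (f * g)) k = fps_nth (qdil f * qdil g) k"
    by (auto simp: fps_mult_nth sum_distrib_left intro!: sum.cong)
qed

lemma qexp_functional:
  "(1 - fps_const a * fps_X) * qdil (Abs_fps (qexp_coeff a)) = Abs_fps (qexp_coeff a)"
proof (rule fps_ext)
  fix m
  show "fps_nth ((1 - fps_const a * fps_X) * qdil (Abs_fps (qexp_coeff a))) m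
      = fps_nth (Abs_fps (qexp_coeff a)) m"
  proof (cases m)
    case 0
    then show ?thesis by (simp add: left_diff_distrib mult.assoc qexp_coeff_def)
  next
    case (Suc j)
    have "qexp_coeff a (Suc j) * (1 - q0 ^ Suc j) = - (a * q0 ^ j) * qexp_coeff a j"
      using q0_power_neq_1[of "Suc j"] by (simp add: qexp_coeff_def)
    then show ?thesis by (simp add: Suc left_diff_distrib mult.assoc algebra_simps)
  qed
qed

abbreviation hq :: "nat \<Rightarrow> Qqt" where "hq \<equiv> fps_nth Hser"

lemma Hser_mult: "Hser * Abs_fps (qexp_coeff 1) = Abs_fps (qexp_coeff t0)"
proof -
  have H: "Hser = Abs_fps (qexp_coeff t0) / Abs_fps (qexp_coeff 1)"
    using qpoch_inf_eq[of 1] qpoch_inf_eq[of t0] by (simp add: Hser_def)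
  have nz: "fps_nth (Abs_fps (qexp_coeff 1)) 0 \<noteq> 0" by (simp add: qexp_coeff_def)
  show ?thesis
    unfolding H fps_divide_unit[OF nz] mult.assoc inverse_mult_eq_1[OF nz] mult_1_right ..
qed

lemma Hser_functional: "(1 - fps_const t0 * fps_X) * qdil Hser = (1 - fps_X) * Hser"
proof -
  let ?E = "\<lambda>a. Abs_fps (qexp_coeff a)"
  have "((1 - fps_const t0 * fps_X) * qdil Hser) * qdil (?E 1)
      = (1 - fps_const t0 * fps_X) * qdil (?E t0)"
    by (simp add: Hser_mult mult.assoc flip: qdil_mult)
  also have "\<dots> = ?E t0" by (rule qexp_functional)
  also have "\<dots> = Hser * ((1 - fps_X) * qdil (?E 1))"
    using qexp_functional[of 1] by (simp add: Hser_mult)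
  finally have "((1 - fps_const t0 * fps_X) * qdil Hser) * qdil (?E 1)
      = ((1 - fps_X) * Hser) * qdil (?E 1)" by (simp add: mult_ac)
  moreover have "qdil (?E 1) \<noteq> 0"
  proof
    assume "qdil (?E 1) = 0"
    then have "fps_nth (qdil (?E 1)) 0 = 0" by simp
    then show False by (simp add: qexp_coeff_def)
  qed
  ultimately show ?thesis by simp
qed

lemma hq_0 [simp]: "hq 0 = 1"
  using arg_cong[OF Hser_mult, of "\<lambda>f. fps_nth f 0"] by (simp add: qexp_coeff_def)

lemma hq_functional: "q0 ^ Suc k * hq (Suc k) - t0 * q0 ^ k * hq k = hq (Suc k) - hq k"
  using arg_cong[OF Hser_functional, of "\<lambda>f. fps_nth f (Suc k)"]
  by (simp add: left_diff_distrib mult.assoc)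

definition piqt :: "nat \<Rightarrow> Qqt" where
  "piqt r = (1 - t0 ^ r) / (1 - q0 ^ r)"

lemma hq_newton: "of_nat k * hq k = (\<Sum>r=1..k. piqt r * hq (k - r))"
proof -
  define L where "L = Abs_fps (\<lambda>r. if r = 0 then 0 else piqt r)"
  define J where "J a = Abs_fps (\<lambda>r. if r = 0 then 0 else a ^ r)" for a :: Qqt
  let ?X = "fps_X :: Qqt fps" and ?t = "fps_const t0"
  have J: "(1 - fps_const a * ?X) * J a = fps_const a * ?X" for a
  proof (rule fps_ext)
    fix m
    show "fps_nth ((1 - fps_const a * ?X) * J a) m = fps_nth (fps_const a * ?X) m"
      by (cases m) (auto simp: left_diff_distrib mult.assoc J_def)
  qed
  have qL: "qdil L = L - J 1 + J t0"
  proof (rule fps_ext)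
    fix m
    have "q0 ^ m * piqt m = piqt m - 1 + t0 ^ m" if "m > 0"
    proof -
      have "piqt m * (1 - q0 ^ m) = 1 - t0 ^ m"
        unfolding piqt_def using q0_power_neq_1[OF that] by simp
      then show ?thesis by (simp add: algebra_simps)
    qed
    then show "fps_nth (qdil L) m = fps_nth (L - J 1 + J t0) m"
      by (cases "m = 0") (auto simp: L_def J_def)
  qed
  define E where "E = ?X * fps_deriv Hser"
  have E_nth: "fps_nth E m = of_nat m * hq m" for m
    by (cases m) (auto simp: E_def)
  define D where "D = E - L * Hser"
  have qE: "qdil E = ?X * fps_deriv (qdil Hser)"
  proof (rule fps_ext)
    fix m show "fps_nth (qdil E) m = fps_nth (?X * fps_deriv (qdil Hser)) m"
      by (cases m) (auto simp: E_nth algebra_simps)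
  qed
  have "?X * fps_deriv ((1 - ?t * ?X) * qdil Hser) = ?X * fps_deriv ((1 - ?X) * Hser)"
    by (simp add: Hser_functional)
  then have 1: "(1 - ?t * ?X) * qdil E - ?t * ?X * qdil Hser = (1 - ?X) * E - ?X * Hser"
    unfolding qE unfolding E_def by (simp add: algebra_simps)
  have "(1 - ?t * ?X) * qdil (L * Hser) = (L - J 1 + J t0) * ((1 - ?t * ?X) * qdil Hser)"
    by (simp add: qdil_mult qL mult_ac)
  also have "\<dots> = (1 - ?X) * (L * Hser) - ((1 - ?X) * J 1) * Hser + J t0 * ((1 - ?X) * Hser)"
    unfolding Hser_functional by (simp add: algebra_simps)
  also have "J t0 * ((1 - ?X) * Hser) = ((1 - ?t * ?X) * J t0) * qdil Hser"
    unfolding Hser_functional[symmetric] by (simp add: mult_ac)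
  also have "(1 - ?X) * J 1 = ?X" using J[of 1] by simp
  finally have 2: "(1 - ?t * ?X) * qdil (L * Hser)
      = (1 - ?X) * (L * Hser) - ?X * Hser + ?t * ?X * qdil Hser"
    unfolding J by simp
  have qdil_diff: "qdil D = qdil E - qdil (L * Hser)"
    by (rule fps_ext) (simp add: D_def right_diff_distrib)
  have 3: "(1 - ?t * ?X) * qdil D = (1 - ?X) * D"
  proof -
    have "(1 - ?t * ?X) * qdil D = ((1 - ?t * ?X) * qdil E - ?t * ?X * qdil Hser)
        - ((1 - ?t * ?X) * qdil (L * Hser) - ?t * ?X * qdil Hser)"
      unfolding qdil_diff by (simp add: algebra_simps)
    also have "\<dots> = (1 - ?X) * D" unfolding 1 2 by (simp add: D_def algebra_simps)
    finally show ?thesis .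
  qed
  have "fps_nth D m = 0" for m
  proof (induction m)
    case 0
    show ?case by (simp add: D_def E_nth L_def)
  next
    case (Suc m)
    have "q0 ^ Suc m * fps_nth D (Suc m) = fps_nth D (Suc m)"
      using arg_cong[OF 3, of "\<lambda>f. fps_nth f (Suc m)"] Suc
      by (simp add: left_diff_distrib mult.assoc)
    then have "(1 - q0 ^ Suc m) * fps_nth D (Suc m) = 0" by (simp add: algebra_simps)
    then show ?case using q0_power_neq_1[of "Suc m"] by simp
  qed
  then have "of_nat k * hq k = fps_nth (L * Hser) k"
    using E_nth[of k] by (metis D_def eq_iff_diff_eq_0 fps_sub_nth)
  also have "\<dots> = (\<Sum>r=0..k. (if r = 0 then 0 else piqt r) * hq (k - r))"
    by (simp add: fps_mult_nth L_def)
  also have "\<dots> = (\<Sum>r=1..k. piqt r * hq (k - r))"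
    by (rule sum.mono_neutral_cong_right) auto
  finally show ?thesis .
qed

section \<open>The functions \<open>g\<^sub>m\<close>\<close>

definition hmon :: "nat multiset \<Rightarrow> Qqt" where
  "hmon M = (\<Prod>i\<in>set_mset M. hq (count M i))"

lemma hmon_superset: "finite I \<Longrightarrow> set_mset M \<subseteq> I \<Longrightarrow> hmon M = (\<Prod>i\<in>I. hq (count M i))"
  unfolding hmon_def by (rule prod.mono_neutral_left) (auto simp: not_in_iff)

lemma hmon_add:
  assumes "i \<notin># M"
  shows "hmon (replicate_mset c i + M) = hq c * hmon M"
proof -
  have "hmon (replicate_mset c i + M)
      = (\<Prod>j\<in>insert i (set_mset M). hq (count (replicate_mset c i + M) j))"
    by (rule hmon_superset) (auto simp: in_replicate_mset)
  also have "\<dots> = hq c * (\<Prod>j\<in>set_mset M. hq (count (replicate_mset c i + M) j))"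
    using assms by (simp add: not_in_iff)
  also have "(\<Prod>j\<in>set_mset M. hq (count (replicate_mset c i + M) j)) = hmon M"
    unfolding hmon_def using assms by (intro prod.cong refl) auto
  finally show ?thesis .
qed

lemma replicate_mset_subseteq_iff: "replicate_mset r i \<subseteq># M \<longleftrightarrow> r \<le> count M i"
  by (auto simp: subseteq_mset_def)

lemma mfps_var_power: "mfps_var v ^ k = mfps_mono (replicate_mset k v)"
  by (induction k) (auto simp: mfps_var_eq_mono simp flip: mfps_mono_add)

lemma Hfactor_prod_nth:
  "mfps_nth (fps_nth (\<Prod>i<N. Hfactor i) k) M
    = (if size M = k \<and> set_mset M \<subseteq> {..<N} then hmon M else 0)"
proof (induction N arbitrary: k M)
  case 0
  then show ?case by (auto simp: hmon_def)
next
  case (Suc N)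
  define c where "c = count M N"
  define M' where "M' = M - replicate_mset c N"
  have M: "M = replicate_mset c N + M'" and N: "N \<notin># M'"
    by (simp_all add: M'_def c_def replicate_mset_subseteq_iff not_in_iff)
  have summand: "mfps_nth (fps_nth (\<Prod>i<N. Hfactor i) l * fps_nth (Hfactor N) (k - l)) M
      = (if k - l \<le> c then
           hq (k - l) * mfps_nth (fps_nth (\<Prod>i<N. Hfactor i) l) (M - replicate_mset (k - l) N)
         else 0)" for l
  proof -
    have "fps_nth (\<Prod>i<N. Hfactor i) l * fps_nth (Hfactor N) (k - l)
        = mfps_const (hq (k - l)) * (mfps_mono (replicate_mset (k - l) N) * fps_nth (\<Prod>i<N. Hfactor i) l)"
      by (simp add: Hfactor_def mfps_var_power mult_ac)
    then show ?thesis
      by (simp add: mfps_nth_mono_mult replicate_mset_subseteq_iff c_def)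
  qed
  have nz: "k - l = c" if "set_mset (M - replicate_mset (k - l) N) \<subseteq> {..<N}" "k - l \<le> c" for l
  proof -
    have "N \<notin># M - replicate_mset (k - l) N" using that by auto
    then have "count M N - (k - l) = 0" by (simp add: not_in_iff)
    with that show ?thesis by (simp add: c_def)
  qed
  have "mfps_nth (fps_nth (\<Prod>i<Suc N. Hfactor i) k) M
      = (\<Sum>l=0..k. mfps_nth (fps_nth (\<Prod>i<N. Hfactor i) l * fps_nth (Hfactor N) (k - l)) M)"
    by (simp add: fps_mult_nth mfps_nth_sum)
  also have "\<dots> = (\<Sum>l=0..k. if l = k - c \<and> c \<le> k then
      (if size M = k \<and> set_mset M \<subseteq> {..<Suc N} then hmon M else 0) else 0)"
  proof (rule sum.cong[OF refl])
    fix l assume "l \<in> {0..k}"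
    then have l: "l \<le> k" by simp
    show "mfps_nth (fps_nth (\<Prod>i<N. Hfactor i) l * fps_nth (Hfactor N) (k - l)) M
        = (if l = k - c \<and> c \<le> k then (if size M = k \<and> set_mset M \<subseteq> {..<Suc N} then hmon M else 0) else 0)"
    proof (cases "k - l = c")
      case True
      have "set_mset M \<subseteq> {..<Suc N} \<longleftrightarrow> set_mset M' \<subseteq> {..<N}"
        using N M by (auto simp: less_Suc_eq in_replicate_mset dest: arg_cong[of _ _ set_mset])
      moreover have "size M = k \<longleftrightarrow> size M' = l"
        using arg_cong[OF M, of size] True l by auto
      moreover have "hmon M = hq c * hmon M'"
        using hmon_add[OF N, of c] M by simp
      ultimately show ?thesis
        unfolding summand using True l by (auto simp: Suc.IH M'_def)
    next
      case False
      then have "\<not> (l = k - c \<and> c \<le> k)" using l by auto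
      moreover have "k - l \<le> c \<Longrightarrow> \<not> set_mset (M - replicate_mset (k - l) N) \<subseteq> {..<N}"
        using nz[of l] False by auto
      ultimately show ?thesis unfolding summand Suc.IH by auto
    qed
  qed
  also have "\<dots> = (if size M = k \<and> set_mset M \<subseteq> {..<Suc N} then hmon M else 0)"
  proof -
    have "c \<le> size M" by (simp add: c_def count_le_size)
    then show ?thesis by (auto simp: sum.delta)
  qed
  finally show ?case .
qed

lemma gfun_nth: "mfps_nth (gfun m) M = (if m = int (size M) then hmon M else 0)"
proof (cases "m < 0")
  case False
  obtain B where B: "set_mset M \<subseteq> {..<B}"
    by (metis finite_set_mset finite_nat_set_iff_bounded subsetI lessThan_iff)
  let ?v = "if size M = nat m then hmon M else 0"
  have ev: "\<forall>\<^sub>F N in sequentially. mfps_nth (fps_nth (\<Prod>i<N. Hfactor i) (nat m)) M = ?v"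
    unfolding eventually_sequentially
  proof (rule exI[of _ B], intro allI impI)
    fix N assume "B \<le> N"
    then have "set_mset M \<subseteq> {..<N}" using B by auto
    then show "mfps_nth (fps_nth (\<Prod>i<N. Hfactor i) (nat m)) M = ?v"
      by (simp add: Hfactor_prod_nth)
  qed
  have "(THE c. \<forall>\<^sub>F N in sequentially. mfps_nth (fps_nth (\<Prod>i<N. Hfactor i) (nat m)) M = c) = ?v"
  proof (rule the_equality)
    show "\<forall>\<^sub>F N in sequentially. mfps_nth (fps_nth (\<Prod>i<N. Hfactor i) (nat m)) M = ?v" by (rule ev)
    fix c assume "\<forall>\<^sub>F N in sequentially. mfps_nth (fps_nth (\<Prod>i<N. Hfactor i) (nat m)) M = c"
    with ev have "\<forall>\<^sub>F N in sequentially. c = ?v" by eventually_elim simp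
    then show "c = ?v" by simp
  qed
  then show ?thesis using False by (auto simp: gfun_def mfps_lim_def)
qed (auto simp: gfun_def)

lemma gfun_0 [simp]: "gfun 0 = 1"
  by (rule mfps_eqI) (auto simp: gfun_nth hmon_def)

lemma gfun_neg [simp]: "m < 0 \<Longrightarrow> gfun m = 0"
  by (simp add: gfun_def)

lemma power_sum_nth:
  assumes "r > 0"
  shows "mfps_nth (power_sum r) M = (if \<exists>i. M = replicate_mset r i then 1 else 0)"
proof (cases "\<exists>i. M = replicate_mset r i")
  case True
  then obtain i where i: "M = replicate_mset r i" by auto
  have "mfps_nth (power_sum r) M = (\<Sum>j\<in>{i}. mfps_nth (mfps_var j ^ r) M)"
    unfolding power_sum_def
  proof (rule mfps_nth_mfps_sum)
    fix b assume "b \<in> UNIV - {i}"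
    then have "replicate_mset r i \<noteq> replicate_mset r b"
      using assms by (auto dest!: arg_cong[of _ _ set_mset] simp: set_mset_replicate_mset_subset)
    then show "mfps_nth (mfps_var b ^ r) M = 0" by (simp add: mfps_var_power i)
  qed auto
  then show ?thesis using True by (simp add: mfps_var_power i)
next
  case False
  have "mfps_nth (power_sum r) M = (\<Sum>j\<in>{}. mfps_nth (mfps_var j ^ r) M)"
    unfolding power_sum_def
    by (rule mfps_nth_mfps_sum) (use False in \<open>auto simp: mfps_var_power\<close>)
  then show ?thesis using False by simp
qed

lemma power_sum_mult_nth:
  assumes r: "r > 0"
  shows "mfps_nth (power_sum r * f) M
    = (\<Sum>i | i \<in># M \<and> r \<le> count M i. mfps_nth f (M - replicate_mset r i))"
proof -
  let ?I = "{i. i \<in># M \<and> r \<le> count M i}"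
  have fin: "finite ?I" by simp
  have inj: "inj_on (replicate_mset r) ?I"
    using r by (auto intro!: inj_onI dest!: arg_cong[of _ _ set_mset] simp: set_mset_replicate_mset_subset)
  have "mfps_nth (power_sum r * f) M
      = (\<Sum>A\<in>replicate_mset r ` ?I. mfps_nth (power_sum r) A * mfps_nth f (M - A))"
    unfolding mfps_nth_mult
  proof (rule sum.mono_neutral_right)
    show "\<forall>A\<in>{A. A \<subseteq># M} - replicate_mset r ` ?I. mfps_nth (power_sum r) A * mfps_nth f (M - A) = 0"
    proof
      fix A assume A: "A \<in> {A. A \<subseteq># M} - replicate_mset r ` ?I"
      have "\<not> (\<exists>i. A = replicate_mset r i)"
      proof
        assume "\<exists>i. A = replicate_mset r i"
        then obtain i where i: "A = replicate_mset r i" by auto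
        then have "r \<le> count M i" using A by (simp add: replicate_mset_subseteq_iff)
        then have "i \<in> ?I" using r by (auto simp flip: count_greater_zero_iff)
        then show False using A i by auto
      qed
      then show "mfps_nth (power_sum r) A * mfps_nth f (M - A) = 0" by (simp add: power_sum_nth[OF r])
    qed
  qed (auto simp: finite_submultisets replicate_mset_subseteq_iff)
  also have "\<dots> = (\<Sum>i\<in>?I. mfps_nth f (M - replicate_mset r i))"
    by (subst sum.reindex[OF inj]) (auto simp: power_sum_nth[OF r] intro!: sum.cong)
  finally show ?thesis .
qed

lemma gfun_newton:
  "of_nat m * gfun (int m) = (\<Sum>r=1..m. mfps_const (piqt r) * (power_sum r * gfun (int (m - r))))"
proof (rule mfps_eqI)
  fix M :: "nat multiset"
  have of_nat: "(of_nat m :: sfun) = mfps_const (of_nat m)" for m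
    by (induction m) (auto simp: mfps_const_simps)
  have summand: "mfps_nth (mfps_const (piqt r) * (power_sum r * gfun (int (m - r)))) M
     = (\<Sum>i\<in>set_mset M. if r \<le> count M i \<and> size M = m then piqt r * hmon (M - replicate_mset r i) else 0)"
    if r: "r \<in> {1..m}" for r
  proof -
    have "mfps_nth (mfps_const (piqt r) * (power_sum r * gfun (int (m - r)))) M
      = (\<Sum>i | i \<in># M \<and> r \<le> count M i. if size M = m then piqt r * hmon (M - replicate_mset r i) else 0)"
      unfolding mfps_nth_const_mult power_sum_mult_nth[OF r[simplified, THEN conjunct1, unfolded One_nat_def Suc_le_eq]] sum_distrib_left gfun_nth
    proof (rule sum.cong[OF refl])
      fix i assume "i \<in> {i. i \<in># M \<and> r \<le> count M i}"
      then have i: "r \<le> count M i" by simp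
      then have "size (M - replicate_mset r i) = size M - r"
        by (simp add: size_Diff_submset replicate_mset_subseteq_iff)
      moreover have "r \<le> size M" using i by (meson count_le_size le_trans)
      ultimately have "int (m - r) = int (size (M - replicate_mset r i)) \<longleftrightarrow> size M = m"
        using r by auto
      then show "piqt r * (if int (m - r) = int (size (M - replicate_mset r i))
            then hmon (M - replicate_mset r i) else 0)
          = (if size M = m then piqt r * hmon (M - replicate_mset r i) else 0)" by simp
    qed
    also have "\<dots> = (\<Sum>i\<in>set_mset M. if r \<le> count M i \<and> size M = m
        then piqt r * hmon (M - replicate_mset r i) else 0)"
      by (rule sum.mono_neutral_cong_left) auto
    finally show ?thesis .
  qed
  have inner: "(\<Sum>r=1..m. if r \<le> count M i then piqt r * hmon (M - replicate_mset r i) else 0)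
      = of_nat (count M i) * hmon M" if i: "i \<in># M" and m: "size M = m" for i
  proof -
    define c where "c = count M i"
    define M' where "M' = M - replicate_mset c i"
    have M: "M = replicate_mset c i + M'" and N: "i \<notin># M'"
      by (simp_all add: M'_def c_def replicate_mset_subseteq_iff not_in_iff)
    have "hmon (M - replicate_mset r i) = hq (c - r) * hmon M'" if "r \<le> c" for r
    proof -
      have "M - replicate_mset r i = replicate_mset (c - r) i + M'"
        using that by (subst M) (auto intro!: multiset_eqI)
      then show ?thesis using hmon_add[OF N] by simp
    qed
    then have "(\<Sum>r=1..m. if r \<le> c then piqt r * hmon (M - replicate_mset r i) else 0)
        = (\<Sum>r=1..c. piqt r * (hq (c - r) * hmon M'))"
      using count_le_size[of M i] m
      by (intro sum.mono_neutral_cong_right) (auto simp: c_def)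
    also have "\<dots> = of_nat c * (hq c * hmon M')"
      unfolding mult.assoc[symmetric] hq_newton by (simp add: sum_distrib_right)
    also have "hq c * hmon M' = hmon M" using hmon_add[OF N, of c] M by simp
    finally show ?thesis by (simp add: c_def)
  qed
  have "mfps_nth (\<Sum>r=1..m. mfps_const (piqt r) * (power_sum r * gfun (int (m - r)))) M
     = (\<Sum>r=1..m. \<Sum>i\<in>set_mset M. if r \<le> count M i \<and> size M = m then piqt r * hmon (M - replicate_mset r i) else 0)"
    unfolding mfps_nth_sum by (rule sum.cong[OF refl]) (rule summand)
  also have "\<dots> = (\<Sum>i\<in>set_mset M. \<Sum>r=1..m. if r \<le> count M i \<and> size M = m then piqt r * hmon (M - replicate_mset r i) else 0)"
    by (rule sum.swap)
  also have "\<dots> = (if size M = m then of_nat m * hmon M else 0)"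
  proof (cases "size M = m")
    case True
    have "(\<Sum>i\<in>set_mset M. \<Sum>r=1..m. if r \<le> count M i \<and> size M = m then piqt r * hmon (M - replicate_mset r i) else 0)
       = (\<Sum>i\<in>set_mset M. of_nat (count M i) * hmon M)"
      using inner True by (intro sum.cong) auto
    also have "\<dots> = of_nat (size M) * hmon M"
      by (simp add: size_multiset_overloaded_eq sum_distrib_right)
    finally show ?thesis using True by simp
  qed simp
  finally show "mfps_nth (of_nat m * gfun (int m)) M
      = mfps_nth (\<Sum>r=1..m. mfps_const (piqt r) * (power_sum r * gfun (int (m - r)))) M"
    by (simp add: of_nat gfun_nth)
qed

section \<open>Power sums and the Cauchy kernel\<close>

definition psym :: "nat multiset \<Rightarrow> sfun" where
  "psym \<kappa> = prod_mset (image_mset power_sum \<kappa>)"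

definition shape :: "'v multiset \<Rightarrow> nat multiset" where
  "shape M = image_mset (count M) (mset_set (set_mset M))"

definition Par :: "nat \<Rightarrow> nat multiset set" where
  "Par d = {\<kappa>. 0 \<notin># \<kappa> \<and> sum_mset \<kappa> = d}"

lemma finite_Par: "finite (Par d)"
proof (rule finite_subset)
  show "Par d \<subseteq> {A. A \<subseteq># repeat_mset d (mset_set {..d})}"
  proof
    fix \<kappa> assume "\<kappa> \<in> Par d"
    then have k: "0 \<notin># \<kappa>" "sum_mset \<kappa> = d" by (auto simp: Par_def)
    have "count \<kappa> i \<le> count (repeat_mset d (mset_set {..d})) i" for i
    proof (cases "i \<in># \<kappa>")
      case True
      have "i \<le> d" using True k(2) by (metis sum_mset.remove le_add1)
      have "size \<kappa> \<le> sum_mset \<kappa>"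
        using k(1) by (induction \<kappa>) auto
      then have "count \<kappa> i \<le> d" using count_le_size[of \<kappa> i] k by linarith
      then show ?thesis using \<open>i \<le> d\<close> by simp
    qed (simp add: not_in_iff)
    then show "\<kappa> \<in> {A. A \<subseteq># repeat_mset d (mset_set {..d})}"
      by (simp add: subseteq_mset_def)
  qed
qed (rule finite_submultisets)

lemma psym_empty [simp]: "psym {#} = 1"
  and psym_add: "psym (add_mset r \<kappa>) = power_sum r * psym \<kappa>"
  by (simp_all add: psym_def)

lemma psym_add_nth:
  "r > 0 \<Longrightarrow> mfps_nth (psym (add_mset r \<kappa>)) M
    = (\<Sum>i | i \<in># M \<and> r \<le> count M i. mfps_nth (psym \<kappa>) (M - replicate_mset r i))"
  by (simp add: psym_add power_sum_mult_nth)

lemma size_minus_replicate: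
  "r \<le> count M i \<Longrightarrow> size (M - replicate_mset r i) = size M - r \<and> r \<le> size M"
  using count_le_size[of M i] size_Diff_submset[of "replicate_mset r i" M]
  by (simp add: replicate_mset_subseteq_iff)

lemma shape_empty [simp]: "shape {#} = {#}"
  by (simp add: shape_def)

lemma shape_add:
  assumes "i \<notin># M" "r > 0"
  shows "shape (replicate_mset r i + M) = add_mset r (shape M)"
proof -
  have "set_mset (replicate_mset r i + M) = insert i (set_mset M)"
    using assms by (auto simp: in_replicate_mset)
  moreover have "image_mset (count (replicate_mset r i + M)) (mset_set (set_mset M))
      = image_mset (count M) (mset_set (set_mset M))"
    using assms by (intro image_mset_cong) auto
  ultimately show ?thesis using assms by (simp add: shape_def not_in_iff)
qed

lemma zero_notin_shape: "0 \<notin># shape M"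
  by (auto simp: shape_def simp flip: not_in_iff)

lemma size_shape: "size (shape M) = card (set_mset M)"
  by (simp add: shape_def)

lemma sum_shape: "sum_mset (shape M) = size M"
  by (simp add: shape_def size_multiset_overloaded_eq sum_unfold_sum_mset)

lemma shape_surj:
  assumes "0 \<notin># \<kappa>"
  shows "\<exists>M :: nat multiset. shape M = \<kappa>"
  using assms
proof (induction \<kappa>)
  case (add r \<kappa>)
  then obtain M :: "nat multiset" where M: "shape M = \<kappa>" by auto
  obtain i where "i \<notin># M" by (metis finite_set_mset ex_new_if_finite infinite_UNIV_nat)
  then have "shape (replicate_mset r i + M) = add_mset r \<kappa>"
    using add.prems M by (simp add: shape_add)
  then show ?case by blast
qed (auto intro: exI[of _ "{#}"])

lemma replicate_split:
  assumes "r \<le> count M i"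
  obtains M' where "M = replicate_mset r i + M'" "M - replicate_mset r i = M'"
  using that[of "M - replicate_mset r i"] assms by (simp add: replicate_mset_subseteq_iff)

lemma psym_nth_tri:
  assumes "0 \<notin># \<kappa>" "mfps_nth (psym \<kappa>) M \<noteq> 0"
  shows "sum_mset \<kappa> = size M \<and> card (set_mset M) \<le> size \<kappa> \<and> (card (set_mset M) = size \<kappa> \<longrightarrow> shape M = \<kappa>)"
  using assms
proof (induction \<kappa> arbitrary: M)
  case empty
  then show ?case by (auto split: if_splits)
next
  case (add r \<kappa>)
  then have r: "r > 0" by auto
  with add.prems obtain i where i: "i \<in># M" "r \<le> count M i"
    and nz: "mfps_nth (psym \<kappa>) (M - replicate_mset r i) \<noteq> 0"
    unfolding psym_add_nth[OF r] by (metis (mono_tags, lifting) sum.neutral mem_Collect_eq)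
  obtain M' where M': "M = replicate_mset r i + M'" "M - replicate_mset r i = M'"
    using i(2) by (rule replicate_split)
  have IH: "sum_mset \<kappa> = size M'" "card (set_mset M') \<le> size \<kappa>"
    "card (set_mset M') = size \<kappa> \<Longrightarrow> shape M' = \<kappa>"
    using add.IH[of M'] add.prems nz M' by auto
  have set: "set_mset M = insert i (set_mset M')"
    using r M'(1) by (auto simp: in_replicate_mset)
  have 1: "sum_mset (add_mset r \<kappa>) = size M" using IH M'(1) by simp
  have 2: "card (set_mset M) \<le> size (add_mset r \<kappa>)"
    unfolding set using IH(2) by (simp add: card_insert_if)
  have 3: "shape M = add_mset r \<kappa>" if "card (set_mset M) = size (add_mset r \<kappa>)"
  proof -
    have "i \<notin># M'" using that IH(2) unfolding set by (auto simp: card_insert_if split: if_splits)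
    moreover from this have "card (set_mset M') = size \<kappa>" using that unfolding set by simp
    ultimately show ?thesis using IH(3) r M'(1) by (simp add: shape_add)
  qed
  from 1 2 3 show ?case by blast
qed

lemma psym_nth_of_nat:
  assumes "0 \<notin># \<kappa>"
  shows "\<exists>k. mfps_nth (psym \<kappa>) M = of_nat k \<and> (shape M = \<kappa> \<longrightarrow> k > 0)"
  using assms
proof (induction \<kappa> arbitrary: M)
  case empty
  have "M = {#}" if "shape M = {#}" using that sum_shape[of M] by simp
  then show ?case by (intro exI[of _ "if M = {#} then 1 else 0"]) auto
next
  case (add r \<kappa>)
  then have r: "r > 0" by auto
  have "\<forall>M. \<exists>k. mfps_nth (psym \<kappa>) M = of_nat k \<and> (shape M = \<kappa> \<longrightarrow> k > 0)"
    using add by auto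
  then obtain K where K: "\<And>M. mfps_nth (psym \<kappa>) M = of_nat (K M)" "\<And>M. shape M = \<kappa> \<Longrightarrow> K M > 0"
    by metis
  let ?I = "{i. i \<in># M \<and> r \<le> count M i}"
  have eq: "mfps_nth (psym (add_mset r \<kappa>)) M = of_nat (\<Sum>i\<in>?I. K (M - replicate_mset r i))"
    unfolding psym_add_nth[OF r] K by simp
  have pos: "(\<Sum>i\<in>?I. K (M - replicate_mset r i)) > 0" if sh: "shape M = add_mset r \<kappa>"
  proof -
    have "r \<in># shape M" using sh by simp
    then obtain i where i: "i \<in># M" "count M i = r" by (auto simp: shape_def)
    obtain M' where M': "M = replicate_mset r i + M'" "M - replicate_mset r i = M'"
      using i(2) by (metis order_refl replicate_split)
    have "i \<notin># M'" using M' i(2) by (metis add_left_cancel count_replicate_mset count_union not_in_iff add.right_neutral)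
    then have "shape M' = \<kappa>" using sh r M' by (simp add: shape_add)
    then have "K (M - replicate_mset r i) > 0" using K M' by simp
    moreover have "i \<in> ?I" using i by simp
    ultimately show ?thesis
      using sum_pos2[of ?I i "\<lambda>i. K (M - replicate_mset r i)"] by simp
  qed
  show ?case using eq pos by blast
qed

lemma psym_nth_diag:
  assumes "0 \<notin># \<kappa>" "shape M = \<kappa>"
  shows "mfps_nth (psym \<kappa>) M \<noteq> 0"
  using psym_nth_of_nat[OF assms(1), of M] assms(2) by auto

lemma sum_mset_count: "sum_mset \<kappa> = (\<Sum>r\<in>set_mset \<kappa>. r * count \<kappa> r)" for \<kappa> :: "nat multiset"
proof (induction \<kappa>)
  case (add x \<kappa>)
  have "(\<Sum>r\<in>set_mset \<kappa>. r * count \<kappa> r) = x * count \<kappa> x + (\<Sum>r\<in>set_mset \<kappa> - {x}. r * count \<kappa> r)"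
    by (cases "x \<in># \<kappa>") (auto simp: sum.remove not_in_iff)
  then show ?case using add by (simp add: sum.insert_remove)
qed simp

lemma piqt_nonzero: "r > 0 \<Longrightarrow> piqt r \<noteq> 0"
  using q0_power_neq_1[of r] t0_power_neq_1[of r] by (simp add: piqt_def)

definition zmset :: "nat multiset \<Rightarrow> Qqt" where
  "zmset \<kappa> = (\<Prod>i\<in>set_mset \<kappa>. of_nat (i ^ count \<kappa> i * fact (count \<kappa> i))) * (\<Prod>r\<in>#\<kappa>. inverse (piqt r))"

lemma zmset_empty [simp]: "zmset {#} = 1"
  by (simp add: zmset_def)

lemma zmset_add:
  "zmset (add_mset r \<kappa>) = zmset \<kappa> * of_nat (r * Suc (count \<kappa> r)) * inverse (piqt r)"
proof -
  let ?f = "\<lambda>\<kappa> i. of_nat (i ^ count \<kappa> i * fact (count \<kappa> i)) :: Qqt"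
  have 1: "(\<Prod>i\<in>set_mset (add_mset r \<kappa>). ?f (add_mset r \<kappa>) i)
      = ?f (add_mset r \<kappa>) r * (\<Prod>i\<in>set_mset \<kappa> - {r}. ?f \<kappa> i)"
    by (simp add: prod.insert_remove del: of_nat_mult fact_Suc)
  have 2: "(\<Prod>i\<in>set_mset \<kappa>. ?f \<kappa> i) = ?f \<kappa> r * (\<Prod>i\<in>set_mset \<kappa> - {r}. ?f \<kappa> i)"
    by (cases "r \<in># \<kappa>") (auto simp: prod.remove not_in_iff)
  show ?thesis unfolding zmset_def 1 2 by (simp add: algebra_simps)
qed

lemma zmset_nonzero: "0 \<notin># \<kappa> \<Longrightarrow> zmset \<kappa> \<noteq> 0"
  by (induction \<kappa>) (auto simp: zmset_add piqt_nonzero simp del: of_nat_Suc of_nat_add)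

definition gmono :: "nat multiset \<Rightarrow> sfun" where
  "gmono M = (\<Prod>i\<in>set_mset M. gfun (int (count M i)))"

lemma gmono_superset: "finite I \<Longrightarrow> set_mset M \<subseteq> I \<Longrightarrow> gmono M = (\<Prod>i\<in>I. gfun (int (count M i)))"
  unfolding gmono_def by (rule prod.mono_neutral_left) (auto simp: not_in_iff)

lemma gmono_add:
  assumes "i \<notin># M"
  shows "gmono (replicate_mset c i + M) = gfun (int c) * gmono M"
proof -
  have "gmono (replicate_mset c i + M)
      = (\<Prod>j\<in>insert i (set_mset M). gfun (int (count (replicate_mset c i + M) j)))"
    by (rule gmono_superset) (auto simp: in_replicate_mset)
  also have "\<dots> = gfun (int c) * (\<Prod>j\<in>set_mset M. gfun (int (count (replicate_mset c i + M) j)))"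
    using assms by (simp add: not_in_iff)
  also have "(\<Prod>j\<in>set_mset M. gfun (int (count (replicate_mset c i + M) j))) = gmono M"
    unfolding gmono_def using assms by (intro prod.cong refl) auto
  finally show ?thesis .
qed

lemma gmono_newton:
  "of_nat (size M) * gmono M = (\<Sum>i\<in>set_mset M. \<Sum>r=1..count M i.
      mfps_const (piqt r) * (power_sum r * gmono (M - replicate_mset r i)))"
proof -
  have "of_nat (count M i) * gmono M = (\<Sum>r=1..count M i.
      mfps_const (piqt r) * (power_sum r * gmono (M - replicate_mset r i)))" for i
  proof -
    define c where "c = count M i"
    define M' where "M' = M - replicate_mset c i"
    have M: "M = replicate_mset c i + M'" and N: "i \<notin># M'"
      by (simp_all add: M'_def c_def replicate_mset_subseteq_iff not_in_iff)
    have G: "gmono (M - replicate_mset r i) = gfun (int (c - r)) * gmono M'" if "r \<le> c" for r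
    proof -
      have "M - replicate_mset r i = replicate_mset (c - r) i + M'"
        using that by (subst M) (auto intro!: multiset_eqI)
      then show ?thesis using gmono_add[OF N] by simp
    qed
    have "of_nat c * gmono M = (of_nat c * gfun (int c)) * gmono M'"
      using gmono_add[OF N, of c] M by (simp add: mult_ac)
    also have "\<dots> = (\<Sum>r=1..c. mfps_const (piqt r) * (power_sum r * gmono (M - replicate_mset r i)))"
      unfolding gfun_newton sum_distrib_right by (intro sum.cong refl) (simp add: G mult_ac)
    finally show ?thesis by (simp add: c_def)
  qed
  then show ?thesis
    by (simp add: size_multiset_overloaded_eq sum_distrib_right)
qed

lemma of_nat_mfps: "(of_nat m :: ('v, 'a::comm_ring_1) mfps) = mfps_const (of_nat m)"
  by (induction m) (auto simp: mfps_const_simps)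

text \<open>
  The expansion of the Cauchy kernel in power sums; both sides satisfy the recurrence obtained by
  applying the Euler operator in the second set of variables.
\<close>
lemma gmono_expand:
  "gmono M = (\<Sum>\<kappa>\<in>Par (size M). mfps_const (inverse (zmset \<kappa>) * mfps_nth (psym \<kappa>) M) * psym \<kappa>)"
proof (induction M rule: measure_induct_rule[of size])
  case (less M)
  define S where "S M = (\<Sum>\<kappa>\<in>Par (size M). mfps_const (inverse (zmset \<kappa>) * mfps_nth (psym \<kappa>) M) * psym \<kappa>)"
    for M
  show ?case
  proof (cases "M = {#}")
    case True
    have "Par 0 = {{#}}"
      by (auto simp: Par_def) (metis multiset_nonemptyE not_gr_zero)
    then show ?thesis using True by (simp add: gmono_def mfps_const_simps)
  next
    case False
    define d where "d = size M"
    have d: "d > 0" using False by (simp add: d_def nonempty_has_size)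
    define T where "T i r \<kappa> = mfps_const (piqt r * inverse (zmset \<kappa>) * mfps_nth (psym \<kappa>) (M - replicate_mset r i))
        * psym (add_mset r \<kappa>)" for i r \<kappa>
    have rhs: "(\<Sum>i\<in>set_mset M. \<Sum>r=1..count M i.
        mfps_const (piqt r) * (power_sum r * gmono (M - replicate_mset r i)))
      = (\<Sum>i\<in>set_mset M. \<Sum>r=1..count M i. \<Sum>\<kappa>\<in>Par (d - r). T i r \<kappa>)"
    proof (intro sum.cong refl)
      fix i r assume "i \<in> set_mset M" and r: "r \<in> {1..count M i}"
      have sz: "size (M - replicate_mset r i) = d - r" "r \<le> d"
        using r size_minus_replicate[of r M i] by (auto simp: d_def)
      have "gmono (M - replicate_mset r i) = S (M - replicate_mset r i)"
        unfolding S_def by (rule less.IH) (use sz r d in \<open>auto simp: d_def\<close>)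
      then show "mfps_const (piqt r) * (power_sum r * gmono (M - replicate_mset r i)) = (\<Sum>\<kappa>\<in>Par (d - r). T i r \<kappa>)"
        unfolding S_def sz T_def by (simp add: sum_distrib_left psym_add mfps_const_simps mult_ac)
    qed
    have "of_nat d * S M = (\<Sum>\<kappa>\<in>Par d. \<Sum>r\<in>set_mset \<kappa>. \<Sum>i\<in>set_mset M. if r \<le> count M i then T i r (\<kappa> - {#r#}) else 0)"
      unfolding S_def d_def[symmetric] sum_distrib_left
    proof (intro sum.cong refl)
      fix \<kappa> assume "\<kappa> \<in> Par d"
      then have k: "0 \<notin># \<kappa>" "sum_mset \<kappa> = d" by (auto simp: Par_def)
      have "of_nat d = (\<Sum>r\<in>set_mset \<kappa>. of_nat (r * count \<kappa> r) :: Qqt)"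
        unfolding k(2)[symmetric] of_nat_sum[symmetric] sum_mset_count ..
      then have "of_nat d * (mfps_const (inverse (zmset \<kappa>) * mfps_nth (psym \<kappa>) M) * psym \<kappa>)
          = (\<Sum>r\<in>set_mset \<kappa>. mfps_const (of_nat (r * count \<kappa> r) * (inverse (zmset \<kappa>) * mfps_nth (psym \<kappa>) M)) * psym \<kappa>)"
        by (simp add: of_nat_mfps mfps_const_simps sum_distrib_left sum_distrib_right mfps_const_sum mult_ac del: of_nat_mult)
      also have "\<dots> = (\<Sum>r\<in>set_mset \<kappa>. \<Sum>i\<in>set_mset M. if r \<le> count M i then T i r (\<kappa> - {#r#}) else 0)"
      proof (intro sum.cong refl)
        fix r assume r: "r \<in># \<kappa>"
        then obtain \<mu> where \<mu>: "\<kappa> = add_mset r \<mu>" by (metis mset_add)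
        have r0: "r > 0" using r k by (metis gr0I)
        have z: "of_nat (r * count \<kappa> r) * inverse (zmset \<kappa>) = piqt r * inverse (zmset \<mu>)"
        proof -
          define c :: Qqt where "c = of_nat (r * Suc (count \<mu> r))"
          have "c \<noteq> 0" unfolding c_def of_nat_eq_0_iff using r0 by simp
          moreover have "of_nat (r * count \<kappa> r) = c" by (simp add: \<mu> c_def)
          ultimately show ?thesis unfolding \<mu> zmset_add c_def[symmetric]
            by (simp add: \<mu> mult_ac)
        qed
        have "of_nat (r * count \<kappa> r) * (inverse (zmset \<kappa>) * mfps_nth (psym \<kappa>) M)
            = (\<Sum>i | i \<in># M \<and> r \<le> count M i. piqt r * inverse (zmset \<mu>) * mfps_nth (psym \<mu>) (M - replicate_mset r i))"
          unfolding mult.assoc[symmetric] z unfolding \<mu> psym_add_nth[OF r0] sum_distrib_left by simp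
        then have "mfps_const (of_nat (r * count \<kappa> r) * (inverse (zmset \<kappa>) * mfps_nth (psym \<kappa>) M)) * psym \<kappa>
            = (\<Sum>i | i \<in># M \<and> r \<le> count M i. T i r \<mu>)"
          unfolding T_def by (simp add: mfps_const_sum sum_distrib_right \<mu>)
        also have "\<dots> = (\<Sum>i\<in>set_mset M. if r \<le> count M i then T i r \<mu> else 0)"
          by (rule sum.mono_neutral_cong_left) auto
        finally show "mfps_const (of_nat (r * count \<kappa> r) * (inverse (zmset \<kappa>) * mfps_nth (psym \<kappa>) M)) * psym \<kappa>
            = (\<Sum>i\<in>set_mset M. if r \<le> count M i then T i r (\<kappa> - {#r#}) else 0)"
          unfolding \<mu> add_mset_remove_trivial .
      qed
      finally show "of_nat d * (mfps_const (inverse (zmset \<kappa>) * mfps_nth (psym \<kappa>) M) * psym \<kappa>)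
          = (\<Sum>r\<in>set_mset \<kappa>. \<Sum>i\<in>set_mset M. if r \<le> count M i then T i r (\<kappa> - {#r#}) else 0)" .
    qed
    also have "\<dots> = (\<Sum>\<kappa>\<in>Par d. \<Sum>i\<in>set_mset M. \<Sum>r\<in>set_mset \<kappa>. if r \<le> count M i then T i r (\<kappa> - {#r#}) else 0)"
      by (intro sum.cong refl sum.swap)
    also have "\<dots> = (\<Sum>i\<in>set_mset M. \<Sum>\<kappa>\<in>Par d. \<Sum>r\<in>set_mset \<kappa>. if r \<le> count M i then T i r (\<kappa> - {#r#}) else 0)"
      by (rule sum.swap)
    also have "\<dots> = (\<Sum>i\<in>set_mset M. \<Sum>r=1..count M i. \<Sum>\<kappa>\<in>Par (d - r). T i r \<kappa>)"
    proof (intro sum.cong refl)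
      fix i assume "i \<in># M"
      have "(\<Sum>\<kappa>\<in>Par d. \<Sum>r\<in>set_mset \<kappa>. if r \<le> count M i then T i r (\<kappa> - {#r#}) else 0)
          = (\<Sum>\<kappa>\<in>Par d. \<Sum>r\<in>{r\<in>set_mset \<kappa>. r \<le> count M i}. T i r (\<kappa> - {#r#}))"
        by (intro sum.cong refl sum.inter_filter[symmetric]) simp
      also have "\<dots> = (\<Sum>(\<kappa>,r)\<in>(SIGMA \<kappa>:Par d. {r\<in>set_mset \<kappa>. r \<le> count M i}). T i r (\<kappa> - {#r#}))"
        by (rule sum.Sigma) (auto simp: finite_Par)
      also have "\<dots> = (\<Sum>(r,\<kappa>)\<in>(SIGMA r:{1..count M i}. Par (d - r)). T i r \<kappa>)"
      proof (rule sum.reindex_bij_witness[of _ "\<lambda>(r,\<kappa>). (add_mset r \<kappa>, r)" "\<lambda>(\<kappa>,r). (r, \<kappa> - {#r#})"], goal_cases)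
        case (2 a)
        then obtain \<kappa> r where a: "a = (\<kappa>, r)" "\<kappa> \<in> Par d" "r \<in># \<kappa>" "r \<le> count M i" by auto
        then obtain \<mu> where "\<kappa> = add_mset r \<mu>" by (metis mset_add)
        with a show ?case by (auto simp: Par_def Suc_le_eq intro: gr0I)
      next
        case (4 b)
        then obtain \<kappa> r where b: "b = (r, \<kappa>)" "\<kappa> \<in> Par (d - r)" "1 \<le> r" "r \<le> count M i" by auto
        have "r \<le> d" using size_minus_replicate[OF b(4)] by (simp add: d_def)
        with b show ?case by (auto simp: Par_def)
      qed auto
      also have "\<dots> = (\<Sum>r=1..count M i. \<Sum>\<kappa>\<in>Par (d - r). T i r \<kappa>)"
        by (rule sum.Sigma[symmetric]) (auto simp: finite_Par)
      finally show "(\<Sum>\<kappa>\<in>Par d. \<Sum>r\<in>set_mset \<kappa>. if r \<le> count M i then T i r (\<kappa> - {#r#}) else 0)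
          = (\<Sum>r=1..count M i. \<Sum>\<kappa>\<in>Par (d - r). T i r \<kappa>)" .
    qed
    also have "\<dots> = of_nat d * gmono M"
      unfolding rhs[symmetric] gmono_newton[symmetric] by (simp only: d_def)
    finally have "of_nat d * S M = of_nat d * gmono M" .
    then have "mfps_const (inverse (of_nat d)) * (of_nat d * S M) = mfps_const (inverse (of_nat d)) * (of_nat d * gmono M)"
      by simp
    then have "S M = gmono M"
      using d by (simp add: of_nat_mfps mult.assoc[symmetric] mfps_const_simps(2) flip: mfps_const_simps(6))
    then show ?thesis by (simp add: S_def)
  qed
qed

section \<open>The scalar product\<close>

lemma sorted_wrt_ge_mset_inj:
  assumes "sorted_wrt (\<ge>) xs" "sorted_wrt (\<ge>) (ys :: nat list)" "mset xs = mset ys"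
  shows "xs = ys"
proof -
  have "sorted (rev xs)" "sorted (rev ys)" using assms by (simp_all add: sorted_wrt_rev)
  then have "rev xs = rev ys"     using assms(3) properties_for_sort[of "rev ys" "rev xs"] properties_for_sort[of "rev xs" "rev xs"]
    by simp
  then show ?thesis by simp
qed

lemma mset_partitions_inj: "inj_on mset partitions"
  by (auto intro!: inj_onI sorted_wrt_ge_mset_inj simp: partitions_def)

lemma ex_partition:
  assumes "0 \<notin># \<kappa>"
  shows "\<exists>\<nu>\<in>partitions. mset \<nu> = \<kappa>"
proof
  show "rev (sorted_list_of_multiset \<kappa>) \<in> partitions"
    using assms by (simp add: partitions_def sorted_wrt_rev)
qed simp

lemma bij_betw_partitions_Par: "bij_betw mset {\<nu>\<in>partitions. sum_list \<nu> = d} (Par d)"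
  unfolding bij_betw_def
proof
  show "inj_on mset {\<nu>\<in>partitions. sum_list \<nu> = d}"
    using mset_partitions_inj by (rule inj_on_subset) auto
  show "mset ` {\<nu>\<in>partitions. sum_list \<nu> = d} = Par d"
  proof (intro equalityI subsetI)
    fix \<kappa> assume "\<kappa> \<in> Par d"
    then have "0 \<notin># \<kappa>" "sum_mset \<kappa> = d" by (auto simp: Par_def)
    with ex_partition[OF this(1)] show "\<kappa> \<in> mset ` {\<nu>\<in>partitions. sum_list \<nu> = d}"
      by (metis (mono_tags, lifting) image_eqI mem_Collect_eq sum_mset_sum_list)
  qed (auto simp: Par_def partitions_def sum_mset_sum_list)
qed

lemma finite_partitions: "finite {\<nu>\<in>partitions. sum_list \<nu> = d}"
  using bij_betw_finite[OF bij_betw_partitions_Par] finite_Par by blast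

lemma zero_notin_mset_partition: "\<nu> \<in> partitions \<Longrightarrow> 0 \<notin># mset \<nu>"
  by (simp add: partitions_def)

lemma power_sym_psym: "power_sym \<nu> = psym (mset \<nu>)"
  unfolding power_sym_def psym_def mset_map[symmetric] prod_mset_prod_list ..

lemma zqt_zmset: "zqt \<nu> = zmset (mset \<nu>)"
  unfolding zqt_def zmset_def piqt_def mset_map[symmetric] prod_mset_prod_list
  by (simp add: count_mset)

definition power_comb :: "(nat list \<Rightarrow>\<^sub>0 Qqt) \<Rightarrow> sfun" where
  "power_comb u = (\<Sum>\<nu>\<in>Poly_Mapping.keys u. mfps_const (Poly_Mapping.lookup u \<nu>) * power_sym \<nu>)"

lemma power_comb_superset:
  "finite A \<Longrightarrow> Poly_Mapping.keys u \<subseteq> A \<Longrightarrow> power_comb u = (\<Sum>\<nu>\<in>A. mfps_const (Poly_Mapping.lookup u \<nu>) * power_sym \<nu>)"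
  unfolding power_comb_def by (rule sum.mono_neutral_left) (auto simp: in_keys_iff mfps_const_simps)

lemma power_comb_add: "power_comb (u + v) = power_comb u + power_comb v"
proof -
  let ?A = "Poly_Mapping.keys u \<union> Poly_Mapping.keys v"
  have "power_comb (u + v) = (\<Sum>\<nu>\<in>?A. mfps_const (Poly_Mapping.lookup (u + v) \<nu>) * power_sym \<nu>)"
    by (rule power_comb_superset) (use Poly_Mapping.keys_add[of u v] in auto)
  then show ?thesis
    by (simp add: power_comb_superset[of ?A u] power_comb_superset[of ?A v] lookup_add mfps_const_simps
        distrib_right sum.distrib)
qed

lemma power_comb_uminus: "power_comb (- u) = - power_comb u"
  by (simp add: power_comb_def mfps_const_simps sum_negf)

lemma power_comb_single: "power_comb (Poly_Mapping.single \<nu> c) = mfps_const c * power_sym \<nu>"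
  by (cases "c = 0") (auto simp: power_comb_def mfps_const_simps)

lemma power_comb_eq_0D:
  assumes "Poly_Mapping.keys u \<subseteq> partitions" "power_comb u = 0"
  shows "u = 0"
proof (rule ccontr)
  assume "u \<noteq> 0"
  then have ne: "Poly_Mapping.keys u \<noteq> {}" by simp
  define L where "L = Max (length ` Poly_Mapping.keys u)"
  obtain \<nu> where \<nu>: "\<nu> \<in> Poly_Mapping.keys u" "length \<nu> = L"
    using Max_in[of "length ` Poly_Mapping.keys u"] ne unfolding L_def
    by (metis (no_types, lifting) finite_imageI finite_keys image_iff image_is_empty)
  have max: "length \<mu> \<le> L" if "\<mu> \<in> Poly_Mapping.keys u" for \<mu>
    using that by (simp add: L_def)
  have \<nu>p: "\<nu> \<in> partitions" using \<nu> assms by auto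
  obtain M :: "nat multiset" where M: "shape M = mset \<nu>"
    using shape_surj[OF zero_notin_mset_partition[OF \<nu>p]] by auto
  then have cM: "card (set_mset M) = L" using size_shape[of M] \<nu>(2) by simp
  have "mfps_nth (power_comb u) M = (\<Sum>\<mu>\<in>Poly_Mapping.keys u. Poly_Mapping.lookup u \<mu> * mfps_nth (psym (mset \<mu>)) M)"
    by (simp add: power_comb_def mfps_nth_sum power_sym_psym)
  also have "\<dots> = (\<Sum>\<mu>\<in>{\<nu>}. Poly_Mapping.lookup u \<mu> * mfps_nth (psym (mset \<mu>)) M)"
  proof (rule sum.mono_neutral_right)
    show "\<forall>\<mu>\<in>Poly_Mapping.keys u - {\<nu>}. Poly_Mapping.lookup u \<mu> * mfps_nth (psym (mset \<mu>)) M = 0"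
    proof
      fix \<mu> assume \<mu>: "\<mu> \<in> Poly_Mapping.keys u - {\<nu>}"
      then have \<mu>p: "\<mu> \<in> partitions" using assms by auto
      have "mfps_nth (psym (mset \<mu>)) M = 0"
      proof (rule ccontr)
        assume "mfps_nth (psym (mset \<mu>)) M \<noteq> 0"
        from psym_nth_tri[OF zero_notin_mset_partition[OF \<mu>p] this]
        have "card (set_mset M) \<le> length \<mu>" "card (set_mset M) = length \<mu> \<Longrightarrow> shape M = mset \<mu>"
          by auto
        then have "mset \<mu> = mset \<nu>" using max[of \<mu>] \<mu> cM M by auto
        then have "\<mu> = \<nu>" using mset_partitions_inj \<mu>p \<nu>p by (auto dest: inj_onD)
        with \<mu> show False by simp
      qed
      then show "Poly_Mapping.lookup u \<mu> * mfps_nth (psym (mset \<mu>)) M = 0" by simp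
    qed
  qed (use \<nu> in auto)
  finally have "Poly_Mapping.lookup u \<nu> * mfps_nth (psym (mset \<nu>)) M = 0" using assms(2) by simp
  moreover have "mfps_nth (psym (mset \<nu>)) M \<noteq> 0"
    by (rule psym_nth_diag[OF zero_notin_mset_partition[OF \<nu>p] M])
  ultimately show False using \<nu>(1) by (simp add: in_keys_iff)
qed

lemma power_comb_inj:
  assumes "Poly_Mapping.keys u \<subseteq> partitions" "Poly_Mapping.keys v \<subseteq> partitions" "power_comb u = power_comb v"
  shows "u = v"
proof -
  have "Poly_Mapping.keys (u - v) \<subseteq> partitions"
    using Poly_Mapping.keys_diff[of u v] assms by blast
  moreover have "power_comb (u - v) = 0"
    using assms(3) power_comb_add[of u "- v"] by (simp add: power_comb_uminus)
  ultimately have "u - v = 0" by (rule power_comb_eq_0D)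
  then show ?thesis by simp
qed

lemma power_coords_power_comb:
  assumes "Poly_Mapping.keys u \<subseteq> partitions"
  shows "power_coords (power_comb u) = u"
  unfolding power_coords_def power_comb_def[symmetric]
  by (rule the_equality) (use assms power_comb_inj in auto)

definition pspan :: "sfun set" where
  "pspan = power_comb ` {u. Poly_Mapping.keys u \<subseteq> partitions}"

lemma pspanE:
  assumes "F \<in> pspan"
  obtains u where "Poly_Mapping.keys u \<subseteq> partitions" "F = power_comb u"
  using assms by (auto simp: pspan_def)

lemma pspan_add: "F \<in> pspan \<Longrightarrow> G \<in> pspan \<Longrightarrow> F + G \<in> pspan"
proof -
  assume "F \<in> pspan" "G \<in> pspan"
  then obtain u v where "Poly_Mapping.keys u \<subseteq> partitions" "F = power_comb u"
    "Poly_Mapping.keys v \<subseteq> partitions" "G = power_comb v" by (auto elim!: pspanE)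
  then have "F + G = power_comb (u + v)" "Poly_Mapping.keys (u + v) \<subseteq> partitions"
    using Poly_Mapping.keys_add[of u v] by (auto simp: power_comb_add)
  then show ?thesis by (auto simp: pspan_def)
qed

lemma scalar_power_comb:
  assumes "Poly_Mapping.keys u \<subseteq> partitions" "Poly_Mapping.keys v \<subseteq> partitions" "finite A"
    "Poly_Mapping.keys u \<subseteq> A \<or> Poly_Mapping.keys v \<subseteq> A"
  shows "scalar_qt (power_comb u) (power_comb v) = (\<Sum>\<nu>\<in>A. Poly_Mapping.lookup u \<nu> * Poly_Mapping.lookup v \<nu> * zqt \<nu>)"
proof -
  let ?K = "Poly_Mapping.keys u \<inter> Poly_Mapping.keys v"
  have "scalar_qt (power_comb u) (power_comb v)
      = (\<Sum>\<nu>\<in>Poly_Mapping.keys u. \<Sum>\<mu>\<in>Poly_Mapping.keys v. if \<nu> = \<mu>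
          then Poly_Mapping.lookup u \<nu> * Poly_Mapping.lookup v \<nu> * zqt \<nu> else 0)"
    unfolding scalar_qt_def power_coords_power_comb[OF assms(1)] power_coords_power_comb[OF assms(2)]
    by (intro sum.cong refl) auto
  also have "\<dots> = (\<Sum>\<nu>\<in>Poly_Mapping.keys u. if \<nu> \<in> Poly_Mapping.keys v
          then Poly_Mapping.lookup u \<nu> * Poly_Mapping.lookup v \<nu> * zqt \<nu> else 0)"
    by (simp add: sum.delta)
  also have "\<dots> = (\<Sum>\<nu>\<in>?K. Poly_Mapping.lookup u \<nu> * Poly_Mapping.lookup v \<nu> * zqt \<nu>)"
    by (rule sum.mono_neutral_cong_right) auto
  also have "\<dots> = (\<Sum>\<nu>\<in>A. Poly_Mapping.lookup u \<nu> * Poly_Mapping.lookup v \<nu> * zqt \<nu>)"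
    by (rule sum.mono_neutral_left) (use assms in \<open>auto simp: in_keys_iff\<close>)
  finally show ?thesis .
qed

lemma scalar_commute:
  assumes "F \<in> pspan" "G \<in> pspan"
  shows "scalar_qt F G = scalar_qt G F"
proof -
  obtain u v where *: "Poly_Mapping.keys u \<subseteq> partitions" "F = power_comb u"
    "Poly_Mapping.keys v \<subseteq> partitions" "G = power_comb v" using assms by (auto elim!: pspanE)
  then show ?thesis
    by (simp add: scalar_power_comb[of u v "Poly_Mapping.keys u"] scalar_power_comb[of v u "Poly_Mapping.keys u"] mult_ac)
qed

lemma scalar_add_right:
  assumes "F \<in> pspan" "G \<in> pspan" "H \<in> pspan"
  shows "scalar_qt F (G + H) = scalar_qt F G + scalar_qt F H"
proof -
  obtain u v w where *: "Poly_Mapping.keys u \<subseteq> partitions" "F = power_comb u"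
    "Poly_Mapping.keys v \<subseteq> partitions" "G = power_comb v" "Poly_Mapping.keys w \<subseteq> partitions" "H = power_comb w"
    using assms by (auto elim!: pspanE)
  have "Poly_Mapping.keys (v + w) \<subseteq> partitions" using * Poly_Mapping.keys_add[of v w] by auto
  then have "scalar_qt F (power_comb (v + w)) = scalar_qt F G + scalar_qt F H"
    using * by (simp add: scalar_power_comb[of _ _ "Poly_Mapping.keys u"] lookup_add algebra_simps sum.distrib)
  then show ?thesis using * by (simp add: power_comb_add)
qed

lemma power_comb_const: "mfps_const c * power_comb u = power_comb (Poly_Mapping.map (\<lambda>x. c * x) u)"
proof -
  have "power_comb (Poly_Mapping.map (\<lambda>x. c * x) u)
      = (\<Sum>\<nu>\<in>Poly_Mapping.keys u. mfps_const (Poly_Mapping.lookup (Poly_Mapping.map (\<lambda>x. c * x) u) \<nu>) * power_sym \<nu>)"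
    by (rule power_comb_superset) (auto simp: in_keys_iff Poly_Mapping.map.rep_eq when_def)
  also have "\<dots> = (\<Sum>\<nu>\<in>Poly_Mapping.keys u. mfps_const c * (mfps_const (Poly_Mapping.lookup u \<nu>) * power_sym \<nu>))"
    by (rule sum.cong) (auto simp: Poly_Mapping.map.rep_eq when_def mfps_const_simps mult_ac in_keys_iff)
  finally show ?thesis by (simp add: power_comb_def sum_distrib_left)
qed

lemma keys_map_const: "Poly_Mapping.keys (Poly_Mapping.map (\<lambda>x. c * x) (u :: 'b \<Rightarrow>\<^sub>0 Qqt)) \<subseteq> Poly_Mapping.keys u"
  by (auto simp: in_keys_iff Poly_Mapping.map.rep_eq when_def)

lemma pspan_const: "F \<in> pspan \<Longrightarrow> mfps_const c * F \<in> pspan"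
  unfolding pspan_def using keys_map_const[of c] subset_trans by (fastforce simp: power_comb_const)

lemma scalar_const_right:
  assumes "F \<in> pspan" "G \<in> pspan"
  shows "scalar_qt F (mfps_const c * G) = c * scalar_qt F G"
proof -
  obtain u v where *: "Poly_Mapping.keys u \<subseteq> partitions" "F = power_comb u"
    "Poly_Mapping.keys v \<subseteq> partitions" "G = power_comb v" using assms by (auto elim!: pspanE)
  have "Poly_Mapping.keys (Poly_Mapping.map (\<lambda>x. c * x) v) \<subseteq> partitions" using * keys_map_const[of c v] by auto
  then have "scalar_qt F (power_comb (Poly_Mapping.map (\<lambda>x. c * x) v)) = c * scalar_qt F G"
    using * by (simp add: scalar_power_comb[of _ _ "Poly_Mapping.keys u"] Poly_Mapping.map.rep_eq when_def sum_distrib_left)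
      (intro sum.cong, auto)
  then show ?thesis using * by (simp add: power_comb_const)
qed

lemma pspan_0 [simp]: "0 \<in> pspan"
  unfolding pspan_def by (rule image_eqI[of _ _ 0]) (auto simp: power_comb_def)

lemma pspan_sum: "(\<And>i. i \<in> I \<Longrightarrow> h i \<in> pspan) \<Longrightarrow> sum h I \<in> pspan"
  by (induction I rule: infinite_finite_induct) (auto intro: pspan_add)

lemma pspan_diff: "F \<in> pspan \<Longrightarrow> G \<in> pspan \<Longrightarrow> F - G \<in> pspan"
  using pspan_add[of F "mfps_const (-1) * G"] pspan_const[of G "-1"] by (simp add: mfps_const_simps)

lemma scalar_0_right: "F \<in> pspan \<Longrightarrow> scalar_qt F 0 = 0"
  using scalar_const_right[of F 0 0] by simp

lemma scalar_sum_right: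
  "F \<in> pspan \<Longrightarrow> (\<And>i. i \<in> I \<Longrightarrow> h i \<in> pspan) \<Longrightarrow> scalar_qt F (sum h I) = (\<Sum>i\<in>I. scalar_qt F (h i))"
  by (induction I rule: infinite_finite_induct)
    (auto simp: scalar_0_right scalar_add_right pspan_sum)

lemma scalar_const_left:
  "F \<in> pspan \<Longrightarrow> G \<in> pspan \<Longrightarrow> scalar_qt (mfps_const c * G) F = c * scalar_qt G F"
  by (simp add: scalar_commute[of _ F] scalar_const_right pspan_const)

lemma scalar_sum_left:
  "F \<in> pspan \<Longrightarrow> (\<And>i. i \<in> I \<Longrightarrow> h i \<in> pspan) \<Longrightarrow> scalar_qt (sum h I) F = (\<Sum>i\<in>I. scalar_qt (h i) F)"
  by (simp add: scalar_commute[of _ F] scalar_sum_right pspan_sum)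

lemma scalar_diff_right:
  "F \<in> pspan \<Longrightarrow> G \<in> pspan \<Longrightarrow> H \<in> pspan \<Longrightarrow> scalar_qt F (G - H) = scalar_qt F G - scalar_qt F H"
  using scalar_add_right[of F G "mfps_const (-1) * H"] pspan_const[of H "-1"] scalar_const_right[of F H "-1"]
  by (simp add: mfps_const_simps)

lemma psym_pspan:
  assumes "0 \<notin># \<kappa>"
  shows "psym \<kappa> \<in> pspan"
proof -
  obtain \<nu> where \<nu>: "\<nu> \<in> partitions" "mset \<nu> = \<kappa>" using ex_partition[OF assms] by auto
  then have "psym \<kappa> = power_comb (Poly_Mapping.single \<nu> 1)" by (simp add: power_comb_single power_sym_psym mfps_const_simps)
  then show ?thesis using \<nu> by (auto simp: pspan_def)
qed

lemma scalar_psym: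
  assumes "0 \<notin># \<kappa>" "0 \<notin># \<mu>"
  shows "scalar_qt (psym \<kappa>) (psym \<mu>) = (if \<kappa> = \<mu> then zmset \<kappa> else 0)"
proof -
  obtain \<nu> \<eta> where *: "\<nu> \<in> partitions" "mset \<nu> = \<kappa>" "\<eta> \<in> partitions" "mset \<eta> = \<mu>"
    using ex_partition[OF assms(1)] ex_partition[OF assms(2)] by auto
  have "psym \<kappa> = power_comb (Poly_Mapping.single \<nu> 1)" "psym \<mu> = power_comb (Poly_Mapping.single \<eta> 1)"
    using * by (simp_all add: power_comb_single power_sym_psym mfps_const_simps)
  then have "scalar_qt (psym \<kappa>) (psym \<mu>) = (\<Sum>\<rho>\<in>{\<nu>}. Poly_Mapping.lookup (Poly_Mapping.single \<nu> 1) \<rho>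
      * Poly_Mapping.lookup (Poly_Mapping.single \<eta> 1) \<rho> * zqt \<rho>)"
    using * by (simp only:) (rule scalar_power_comb, auto)
  moreover have "\<nu> = \<eta> \<longleftrightarrow> \<kappa> = \<mu>" using * mset_partitions_inj by (auto dest: inj_onD)
  ultimately show ?thesis using * by (auto simp: zqt_zmset lookup_single when_def)
qed

lemma gmono_pspan: "gmono M \<in> pspan"
  by (subst gmono_expand) (auto intro!: pspan_sum pspan_const psym_pspan simp: Par_def)

text \<open>
  The duality of the \<open>g\<^sub>\<mu>\<close> and the monomial symmetric functions, in a form that needs no
  sorting of exponents.
\<close>
lemma scalar_gmono:
  assumes "F \<in> pspan"
  shows "scalar_qt (gmono M) F = mfps_nth F M"
proof -
  have psym: "scalar_qt (gmono M) (psym \<mu>) = mfps_nth (psym \<mu>) M" if \<mu>: "0 \<notin># \<mu>" for \<mu>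
  proof -
    have "scalar_qt (gmono M) (psym \<mu>)
        = (\<Sum>\<kappa>\<in>Par (size M). inverse (zmset \<kappa>) * mfps_nth (psym \<kappa>) M * (if \<kappa> = \<mu> then zmset \<kappa> else 0))"
      by (subst gmono_expand, subst scalar_sum_left)
        (auto intro!: pspan_const sum.cong simp: Par_def \<mu> scalar_const_left scalar_psym psym_pspan)
    also have "\<dots> = (\<Sum>\<kappa>\<in>Par (size M). if \<kappa> = \<mu> then mfps_nth (psym \<mu>) M else 0)"
      by (intro sum.cong) (auto simp: zmset_nonzero[OF \<mu>])
    also have "\<dots> = mfps_nth (psym \<mu>) M"
      using psym_nth_tri[OF \<mu>, of M] \<mu> unfolding sum.delta[OF finite_Par] by (auto simp: Par_def)
    finally show ?thesis .
  qed
  obtain u where u: "Poly_Mapping.keys u \<subseteq> partitions" "F = power_comb u" using assms by (rule pspanE)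
  have z: "0 \<notin># mset \<nu>" if "\<nu> \<in> Poly_Mapping.keys u" for \<nu>
    using that u(1) zero_notin_mset_partition by blast
  have "scalar_qt (gmono M) F
      = (\<Sum>\<nu>\<in>Poly_Mapping.keys u. scalar_qt (gmono M) (mfps_const (Poly_Mapping.lookup u \<nu>) * psym (mset \<nu>)))"
    unfolding u(2) power_comb_def power_sym_psym
    by (rule scalar_sum_right[OF gmono_pspan pspan_const[OF psym_pspan[OF z]]])
  also have "\<dots> = (\<Sum>\<nu>\<in>Poly_Mapping.keys u. Poly_Mapping.lookup u \<nu> * mfps_nth (psym (mset \<nu>)) M)"
    by (intro sum.cong refl) (simp add: scalar_const_right[OF gmono_pspan psym_pspan[OF z]] psym[OF z])
  finally show ?thesis by (simp add: u(2) power_comb_def power_sym_psym mfps_nth_sum)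
qed

section \<open>Macdonald functions from a dual orthogonal family\<close>

definition symm :: "('v, 'a::comm_ring_1) mfps \<Rightarrow> bool" where
  "symm F \<longleftrightarrow> (\<forall>\<pi> M. bij \<pi> \<longrightarrow> mfps_nth F (image_mset \<pi> M) = mfps_nth F M)"

lemma mono_emb_image: "inj \<pi> \<Longrightarrow> mono_emb (image_mset \<pi>)"
proof
  assume "inj \<pi>"
  show "inj (image_mset \<pi>)"
  proof (rule injI)
    fix A B assume "image_mset \<pi> A = image_mset \<pi> B"
    then have "image_mset (inv \<pi>) (image_mset \<pi> A) = image_mset (inv \<pi>) (image_mset \<pi> B)" by simp
    then show "A = B" using \<open>inj \<pi>\<close> by (simp add: multiset.map_comp)
  qed
qed simp

lemma symm_push: "symm F \<Longrightarrow> bij \<pi> \<Longrightarrow> mfps_push (image_mset \<pi>) F = F"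
proof -
  assume s: "symm F" and b: "bij \<pi>"
  then interpret mono_emb "image_mset \<pi>" using mono_emb_image bij_is_inj by blast
  have "N \<in> range (image_mset \<pi>)" for N
  proof (rule range_eqI)
    show "N = image_mset \<pi> (image_mset (inv \<pi>) N)"
      using b by (simp add: multiset.map_comp o_def bij_is_surj surj_f_inv_f)
  qed
  then show ?thesis using s b by (intro push_eqI) (auto simp: symm_def)
qed

lemma symm_mult:
  assumes "symm F" "symm G"
  shows "symm (F * G)"
  unfolding symm_def
proof (intro allI impI)
  fix \<pi> :: "'a \<Rightarrow> 'a" and M assume b: "bij \<pi>"
  then interpret mono_emb "image_mset \<pi>" using mono_emb_image bij_is_inj by blast
  show "mfps_nth (F * G) (image_mset \<pi> M) = mfps_nth (F * G) M"
    using nth_push[of "F * G" M] unfolding push_mult symm_push[OF assms(1) b] symm_push[OF assms(2) b] .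
qed

lemma symm_1 [simp]: "symm 1" and symm_0 [simp]: "symm 0"
  and symm_add: "symm F \<Longrightarrow> symm G \<Longrightarrow> symm (F + G)"
  and symm_const: "symm F \<Longrightarrow> symm (mfps_const c * F)"
  by (auto simp: symm_def)

lemma symm_sum: "(\<And>i. i \<in> I \<Longrightarrow> symm (h i)) \<Longrightarrow> symm (sum h I)"
  by (induction I rule: infinite_finite_induct) (auto intro: symm_add)

lemma symm_power_sum: "r > 0 \<Longrightarrow> symm (power_sum r)"
  unfolding symm_def
proof (intro allI impI)
  fix \<pi> :: "nat \<Rightarrow> nat" and M assume r: "r > 0" and b: "bij \<pi>"
  have "(\<exists>i. image_mset \<pi> M = replicate_mset r i) \<longleftrightarrow> (\<exists>i. M = replicate_mset r i)"
  proof
    assume "\<exists>i. image_mset \<pi> M = replicate_mset r i"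
    then obtain i where "image_mset \<pi> M = replicate_mset r i" by auto
    then have "image_mset (inv \<pi>) (image_mset \<pi> M) = replicate_mset r (inv \<pi> i)" by simp
    then show "\<exists>i. M = replicate_mset r i" using b by (auto simp: multiset.map_comp bij_is_inj)
  qed auto
  then show "mfps_nth (power_sum r) (image_mset \<pi> M) = mfps_nth (power_sum r) M"
    by (simp add: power_sum_nth[OF r])
qed

lemma symm_psym: "0 \<notin># \<kappa> \<Longrightarrow> symm (psym \<kappa>)"
  by (induction \<kappa>) (auto simp: psym_add intro!: symm_mult symm_power_sum)

lemma symm_pspan: "F \<in> pspan \<Longrightarrow> symm F"
  by (fastforce elim!: pspanE simp: power_comb_def power_sym_psym partitions_def intro!: symm_sum symm_const symm_psym)

lemma shape_eq_bij:
  fixes M M' :: "'v multiset"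
  assumes "shape M = shape M'"
  shows "\<exists>\<pi>. bij \<pi> \<and> image_mset \<pi> M = M'"
proof -
  let ?A = "set_mset M" and ?B = "set_mset M'"
  let ?C = "?A \<union> ?B"
  have sh: "image_mset (count N) (mset_set ?C) = shape N + replicate_mset (card ?C - card (set_mset N)) 0"
    if "set_mset N \<subseteq> ?C" for N
  proof -
    have "mset_set ?C = mset_set (set_mset N) + mset_set (?C - set_mset N)"
      using that by (subst mset_set_Union[symmetric]) (auto simp: Un_absorb1)
    moreover have "image_mset (count N) (mset_set (?C - set_mset N))
        = image_mset (\<lambda>_. 0) (mset_set (?C - set_mset N))"
      by (intro image_mset_cong) (auto simp: not_in_iff)
    ultimately show ?thesis
      using that by (simp add: shape_def image_mset_const_eq card_Diff_subset)
  qed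
  have "card ?A = card ?B" using assms size_shape by metis
  then have "image_mset (count M) (mset_set ?C) = image_mset (count M') (mset_set ?C)"
    using assms by (simp add: sh)
  then obtain p where p: "p permutes ?C" "\<forall>x\<in>?C. count M x = count M' (p x)"
    using image_mset_eq_implies_permutes[of ?C "count M" "count M'"] by auto
  have "count (image_mset p M) y = count M' y" for y
  proof -
    obtain x where x: "y = p x" using permutes_surj[OF p(1)] by auto
    have "count (image_mset p M) (p x) = count M x"
      using permutes_inj[OF p(1)] by (induction M) (auto simp: inj_eq)
    also have "count M x = count M' (p x)"
    proof (cases "x \<in> ?C")
      case False
      then show ?thesis using p(1) by (simp add: permutes_not_in not_in_iff)
    qed (use p in auto)
    finally show ?thesis by (simp add: x)
  qed
  then show ?thesis using permutes_bij[OF p(1)] by (intro exI[of _ p]) (auto intro: multiset_eqI)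
qed

lemma symm_shape: "symm F \<Longrightarrow> shape M = shape M' \<Longrightarrow> mfps_nth F M = mfps_nth F M'"
  using shape_eq_bij unfolding symm_def by metis

definition msym :: "nat multiset \<Rightarrow> sfun" where
  "msym \<kappa> = Abs_mfps (\<lambda>M. if shape M = \<kappa> then 1 else 0)"

lemma msym_nth [simp]: "mfps_nth (msym \<kappa>) M = (if shape M = \<kappa> then 1 else 0)"
  by (simp add: msym_def)

lemma mono_sym_msym: "mono_sym \<nu> = msym (mset \<nu>)"
  by (simp add: mono_sym_def msym_def shape_def)

definition hom_deg :: "nat \<Rightarrow> ('v, 'a::comm_ring_1) mfps \<Rightarrow> bool" where
  "hom_deg d F \<longleftrightarrow> (\<forall>M. mfps_nth F M \<noteq> 0 \<longrightarrow> size M = d)"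

definition rep :: "nat multiset \<Rightarrow> nat multiset" where
  "rep \<kappa> = (SOME M. shape M = \<kappa>)"

lemma shape_rep: "0 \<notin># \<kappa> \<Longrightarrow> shape (rep \<kappa>) = \<kappa>"
  unfolding rep_def using shape_surj by (rule someI_ex)

lemma msym_expand:
  assumes "symm F" "hom_deg d F"
  shows "F = (\<Sum>\<kappa>\<in>Par d. mfps_const (mfps_nth F (rep \<kappa>)) * msym \<kappa>)"
proof (rule mfps_eqI)
  fix M :: "nat multiset"
  have "mfps_nth (\<Sum>\<kappa>\<in>Par d. mfps_const (mfps_nth F (rep \<kappa>)) * msym \<kappa>) M
      = (\<Sum>\<kappa>\<in>Par d. if \<kappa> = shape M then mfps_nth F (rep (shape M)) else 0)"
    by (simp add: mfps_nth_sum) (intro sum.cong, auto)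
  also have "\<dots> = (if shape M \<in> Par d then mfps_nth F M else 0)"
    unfolding sum.delta[OF finite_Par]
    using symm_shape[OF assms(1) shape_rep[OF zero_notin_shape], of M] by simp
  also have "\<dots> = mfps_nth F M"
    using assms(2) by (auto simp: hom_deg_def Par_def sum_shape zero_notin_shape)
  finally show "mfps_nth F M = mfps_nth (\<Sum>\<kappa>\<in>Par d. mfps_const (mfps_nth F (rep \<kappa>)) * msym \<kappa>) M" ..
qed

lemma msym_pspan: "0 \<notin># \<kappa> \<Longrightarrow> msym \<kappa> \<in> pspan"
proof (induction \<kappa> rule: measure_induct_rule[of size])
  case (less \<kappa>)
  define d where "d = sum_mset \<kappa>"
  define c where "c \<mu> = mfps_nth (psym \<kappa>) (rep \<mu>)" for \<mu>
  have \<kappa>: "\<kappa> \<in> Par d" using less.prems by (simp add: Par_def d_def)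
  have "hom_deg d (psym \<kappa>)"
    using psym_nth_tri[OF less.prems] by (auto simp: hom_deg_def d_def)
  from msym_expand[OF symm_psym[OF less.prems] this]
  have "psym \<kappa> = mfps_const (c \<kappa>) * msym \<kappa> + (\<Sum>\<mu>\<in>Par d - {\<kappa>}. mfps_const (c \<mu>) * msym \<mu>)"
    using \<kappa> by (simp add: sum.remove[OF finite_Par \<kappa>] c_def)
  then have "mfps_const (c \<kappa>) * msym \<kappa> = psym \<kappa> - (\<Sum>\<mu>\<in>Par d - {\<kappa>}. mfps_const (c \<mu>) * msym \<mu>)"
    by simp
  moreover have "\<dots> \<in> pspan"
  proof (intro pspan_diff pspan_sum psym_pspan less.prems)
    fix \<mu> assume \<mu>: "\<mu> \<in> Par d - {\<kappa>}"
    then have m0: "0 \<notin># \<mu>" by (simp add: Par_def)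
    show "mfps_const (c \<mu>) * msym \<mu> \<in> pspan"
    proof (cases "c \<mu> = 0")
      case False
      from psym_nth_tri[OF less.prems False[unfolded c_def]]
      have "size \<mu> < size \<kappa>" using \<mu> size_shape[of "rep \<mu>"] shape_rep[OF m0] by force
      then show ?thesis using less.IH m0 by (intro pspan_const) auto
    qed (simp add: mfps_const_simps)
  qed
  ultimately have "mfps_const (inverse (c \<kappa>)) * (mfps_const (c \<kappa>) * msym \<kappa>) \<in> pspan"
    using pspan_const by metis
  moreover have "c \<kappa> \<noteq> 0"
    unfolding c_def by (rule psym_nth_diag[OF less.prems shape_rep[OF less.prems]])
  ultimately show ?case
    by (simp add: mult.assoc[symmetric] mfps_const_simps(2) flip: mfps_const_simps(6))
qed

lemma mono_sym_pspan: "\<nu> \<in> partitions \<Longrightarrow> mono_sym \<nu> \<in> pspan"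
  using msym_pspan[OF zero_notin_mset_partition] by (simp add: mono_sym_msym)

lemma mono_sym_expand:
  assumes "symm F" "hom_deg d F"
  shows "F = (\<Sum>\<nu> | \<nu> \<in> partitions \<and> sum_list \<nu> = d. mfps_const (mfps_nth F (rep (mset \<nu>))) * mono_sym \<nu>)"
proof -
  have "(\<Sum>\<nu> | \<nu> \<in> partitions \<and> sum_list \<nu> = d. mfps_const (mfps_nth F (rep (mset \<nu>))) * msym (mset \<nu>))
      = (\<Sum>\<kappa>\<in>Par d. mfps_const (mfps_nth F (rep \<kappa>)) * msym \<kappa>)"
    by (rule sum.reindex_bij_betw[OF bij_betw_partitions_Par])
  then show ?thesis using msym_expand[OF assms] by (simp add: mono_sym_msym)
qed

definition prefix_weight :: "nat list \<Rightarrow> nat" where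
  "prefix_weight \<nu> = (\<Sum>k\<le>sum_list \<nu>. sum_list (take k \<nu>))"

lemma length_le_sum_list: "0 \<notin> set xs \<Longrightarrow> length xs \<le> sum_list (xs :: nat list)"
  by (induction xs) auto

lemma prefix_sums_eqD:
  assumes "0 \<notin> set xs" "0 \<notin> set (ys :: nat list)" "\<And>k. sum_list (take k xs) = sum_list (take k ys)"
  shows "xs = ys"
  using assms
proof (induction xs arbitrary: ys)
  case Nil
  then show ?case by (cases ys) (auto dest: spec[of _ 1] meta_spec[of _ 1])
next
  case (Cons x xs)
  show ?case
  proof (cases ys)
    case Nil
    then show ?thesis using Cons.prems(1) Cons.prems(3)[of 1] by auto
  next
    case (Cons y ys')
    have "x = y" using Cons.prems(3)[of 1] Cons by simp
    moreover have "sum_list (take k xs) = sum_list (take k ys')" for k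
      using Cons.prems(3)[of "Suc k"] Cons \<open>x = y\<close> by simp
    then have "xs = ys'" using Cons.prems Cons by (intro Cons.IH) auto
    ultimately show ?thesis using Cons by simp
  qed
qed

lemma prefix_weight_less:
  assumes "\<mu> \<in> partitions" "\<nu> \<in> partitions" "dominance_less \<mu> \<nu>"
  shows "prefix_weight \<mu> < prefix_weight \<nu>"
proof -
  have d: "\<mu> \<noteq> \<nu>" "sum_list \<mu> = sum_list \<nu>" "\<And>k. sum_list (take k \<mu>) \<le> sum_list (take k \<nu>)"
    using assms(3) by (auto simp: dominance_less_def)
  have z: "0 \<notin> set \<mu>" "0 \<notin> set \<nu>" using assms by (auto simp: partitions_def)
  obtain k where k: "sum_list (take k \<mu>) \<noteq> sum_list (take k \<nu>)"
    using prefix_sums_eqD[OF z] d(1) by blast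
  have "k \<le> sum_list \<nu>"
  proof (rule ccontr)
    assume "\<not> ?thesis"
    then have "take k \<mu> = \<mu>" "take k \<nu> = \<nu>"
      using length_le_sum_list[OF z(1)] length_le_sum_list[OF z(2)] d(2) by auto
    then show False using k d(2) by simp
  qed
  then show ?thesis unfolding prefix_weight_def d(2)
    using k d(3) by (intro sum_strict_mono_ex1) (auto intro!: bexI[of _ k] simp: le_neq_implies_less)
qed

lemma dominance_trans:
  assumes "\<mu> \<in> partitions" "\<nu> \<in> partitions" "\<rho> \<in> partitions" "dominance_less \<mu> \<nu>" "dominance_less \<nu> \<rho>"
  shows "dominance_less \<mu> \<rho>"
proof -
  have "prefix_weight \<mu> < prefix_weight \<rho>" using assms prefix_weight_less less_trans by metis
  then show ?thesis using assms(4,5) unfolding dominance_less_def by (auto intro: order_trans)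
qed

lemma finite_dominance_less: "finite {\<mu>. \<mu> \<in> partitions \<and> dominance_less \<mu> \<nu>}"
  by (rule finite_subset[OF _ finite_partitions[of "sum_list \<nu>"]]) (auto simp: dominance_less_def)

lemma ex_max_weight:
  assumes "finite B" "B \<noteq> {}"
  obtains \<kappa> where "\<kappa> \<in> B" "\<And>\<mu>. \<mu> \<in> B \<Longrightarrow> prefix_weight \<mu> \<le> prefix_weight \<kappa>"
proof -
  have "Max (prefix_weight ` B) \<in> prefix_weight ` B" using assms by simp
  then obtain \<kappa> where "\<kappa> \<in> B" "prefix_weight \<kappa> = Max (prefix_weight ` B)" by auto
  then show thesis using assms by (intro that[of \<kappa>]) auto
qed

locale dual_orthogonal =
  fixes Q :: "nat list \<Rightarrow> sfun"
  assumes pspan: "\<nu> \<in> partitions \<Longrightarrow> Q \<nu> \<in> pspan"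
    and hom: "\<nu> \<in> partitions \<Longrightarrow> hom_deg (sum_list \<nu>) (Q \<nu>)"
    and tri: "\<nu> \<in> partitions \<Longrightarrow> \<mu> \<in> partitions \<Longrightarrow> scalar_qt (Q \<nu>) (mono_sym \<mu>) \<noteq> 0
      \<Longrightarrow> \<mu> = \<nu> \<or> dominance_less \<nu> \<mu>"
    and diag: "\<nu> \<in> partitions \<Longrightarrow> scalar_qt (Q \<nu>) (mono_sym \<nu>) = 1"
    and orth: "\<nu> \<in> partitions \<Longrightarrow> \<mu> \<in> partitions \<Longrightarrow> \<nu> \<noteq> \<mu> \<Longrightarrow> scalar_qt (Q \<nu>) (Q \<mu>) = 0"
begin

lemma scalar_top:
  assumes "finite S" "S \<subseteq> partitions" "\<kappa> \<in> S" "\<And>\<mu>. \<mu> \<in> S \<Longrightarrow> b \<mu> \<noteq> 0 \<Longrightarrow> \<not> dominance_less \<kappa> \<mu>"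
  shows "scalar_qt (Q \<kappa>) (\<Sum>\<mu>\<in>S. mfps_const (b \<mu>) * mono_sym \<mu>) = b \<kappa>"
proof -
  have \<kappa>: "\<kappa> \<in> partitions" using assms by auto
  have "scalar_qt (Q \<kappa>) (\<Sum>\<mu>\<in>S. mfps_const (b \<mu>) * mono_sym \<mu>)
      = (\<Sum>\<mu>\<in>S. scalar_qt (Q \<kappa>) (mfps_const (b \<mu>) * mono_sym \<mu>))"
    using assms by (intro scalar_sum_right pspan \<kappa> pspan_const mono_sym_pspan) auto
  also have "\<dots> = (\<Sum>\<mu>\<in>S. b \<mu> * scalar_qt (Q \<kappa>) (mono_sym \<mu>))"
    using assms by (intro sum.cong refl scalar_const_right pspan \<kappa> mono_sym_pspan) auto
  also have "\<dots> = (\<Sum>\<mu>\<in>{\<kappa>}. b \<mu> * scalar_qt (Q \<kappa>) (mono_sym \<mu>))"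
    using assms tri[OF \<kappa>] by (intro sum.mono_neutral_right) auto
  finally show ?thesis by (simp add: diag[OF \<kappa>])
qed

definition a :: "nat list \<Rightarrow> nat list \<Rightarrow> Qqt" where
  "a \<nu> \<mu> = mfps_nth (Q \<nu>) (rep (mset \<mu>))"

abbreviation "parts d \<equiv> {\<nu>. \<nu> \<in> partitions \<and> sum_list \<nu> = d}"

lemma Q_expand: "\<nu> \<in> partitions \<Longrightarrow> Q \<nu> = (\<Sum>\<mu>\<in>parts (sum_list \<nu>). mfps_const (a \<nu> \<mu>) * mono_sym \<mu>)"
  unfolding a_def by (rule mono_sym_expand) (auto intro: symm_pspan pspan hom)

lemma a_eq_scalar:
  assumes "\<nu> \<in> partitions" "\<kappa> \<in> parts (sum_list \<nu>)"
    "\<And>\<mu>. \<mu> \<in> parts (sum_list \<nu>) \<Longrightarrow> a \<nu> \<mu> \<noteq> 0 \<Longrightarrow> \<not> dominance_less \<kappa> \<mu>"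
  shows "scalar_qt (Q \<kappa>) (Q \<nu>) = a \<nu> \<kappa>"
  by (subst Q_expand[OF assms(1)], rule scalar_top) (use assms finite_partitions in auto)

lemma a_tri:
  assumes \<nu>: "\<nu> \<in> partitions" and "\<mu> \<in> parts (sum_list \<nu>)" "a \<nu> \<mu> \<noteq> 0"
  shows "\<mu> = \<nu> \<or> dominance_less \<mu> \<nu>"
proof (rule ccontr)
  assume neg: "\<not> ?thesis"
  define B where "B = {\<mu> \<in> parts (sum_list \<nu>). a \<nu> \<mu> \<noteq> 0 \<and> \<mu> \<noteq> \<nu> \<and> \<not> dominance_less \<mu> \<nu>}"
  have "finite B" using finite_partitions[of "sum_list \<nu>"] unfolding B_def by (rule rev_finite_subset) auto
  moreover have "B \<noteq> {}" using neg assms by (auto simp: B_def)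
  ultimately obtain \<kappa> where \<kappa>: "\<kappa> \<in> B" "\<And>\<mu>. \<mu> \<in> B \<Longrightarrow> prefix_weight \<mu> \<le> prefix_weight \<kappa>"
    using ex_max_weight[of B] by metis
  have kp: "\<kappa> \<in> partitions" using \<kappa> by (auto simp: B_def)
  have "scalar_qt (Q \<kappa>) (Q \<nu>) = a \<nu> \<kappa>"
  proof (rule a_eq_scalar[OF \<nu>])
    fix \<mu> assume \<mu>: "\<mu> \<in> parts (sum_list \<nu>)" "a \<nu> \<mu> \<noteq> 0"
    show "\<not> dominance_less \<kappa> \<mu>"
    proof
      assume d: "dominance_less \<kappa> \<mu>"
      then have "prefix_weight \<kappa> < prefix_weight \<mu>" using prefix_weight_less kp \<mu> by auto
      then have "\<mu> \<notin> B" using \<kappa>(2)[of \<mu>] by linarith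
      then have "\<mu> = \<nu> \<or> dominance_less \<mu> \<nu>" using \<mu> by (auto simp: B_def)
      then have "dominance_less \<kappa> \<nu>" using d dominance_trans[of \<kappa> \<mu> \<nu>] kp \<mu> \<nu> by blast
      then show False using \<kappa>(1) by (simp add: B_def)
    qed
  qed (use \<kappa> in \<open>auto simp: B_def\<close>)
  then show False using orth[OF kp \<nu>] \<kappa>(1) by (simp add: B_def)
qed

abbreviation "D \<nu> \<equiv> scalar_qt (Q \<nu>) (Q \<nu>)"

lemma D_eq: "\<nu> \<in> partitions \<Longrightarrow> D \<nu> = a \<nu> \<nu>"
proof (rule a_eq_scalar)
  fix \<mu> assume *: "\<nu> \<in> partitions" "\<mu> \<in> parts (sum_list \<nu>)" "a \<nu> \<mu> \<noteq> 0"
  then have "\<mu> = \<nu> \<or> prefix_weight \<mu> < prefix_weight \<nu>" using a_tri prefix_weight_less by auto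
  then show "\<not> dominance_less \<nu> \<mu>" using prefix_weight_less[of \<nu> \<mu>] * by auto
qed auto

lemma D_nonzero:
  assumes \<nu>: "\<nu> \<in> partitions"
  shows "D \<nu> \<noteq> 0"
proof
  assume D: "D \<nu> = 0"
  define B where "B = {\<mu> \<in> parts (sum_list \<nu>). a \<nu> \<mu> \<noteq> 0}"
  have "B \<noteq> {}"
  proof
    assume "B = {}"
    then have "Q \<nu> = 0" by (subst Q_expand[OF \<nu>]) (auto simp: B_def mfps_const_simps intro!: sum.neutral)
    then show False using diag[OF \<nu>] scalar_0_right[OF mono_sym_pspan[OF \<nu>]]
        scalar_commute[OF pspan_0 mono_sym_pspan[OF \<nu>]] by simp
  qed
  moreover have "finite B" using finite_partitions[of "sum_list \<nu>"] unfolding B_def by (rule rev_finite_subset) auto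
  ultimately obtain \<kappa> where \<kappa>: "\<kappa> \<in> B" "\<And>\<mu>. \<mu> \<in> B \<Longrightarrow> prefix_weight \<mu> \<le> prefix_weight \<kappa>"
    using ex_max_weight[of B] by metis
  have kp: "\<kappa> \<in> partitions" using \<kappa> by (auto simp: B_def)
  have "scalar_qt (Q \<kappa>) (Q \<nu>) = a \<nu> \<kappa>"
  proof (rule a_eq_scalar[OF \<nu>])
    fix \<mu> assume \<mu>: "\<mu> \<in> parts (sum_list \<nu>)" "a \<nu> \<mu> \<noteq> 0"
    then have "prefix_weight \<mu> \<le> prefix_weight \<kappa>" using \<kappa> by (auto simp: B_def)
    then show "\<not> dominance_less \<kappa> \<mu>" using prefix_weight_less[OF kp, of \<mu>] \<mu> by auto
  qed (use \<kappa> in \<open>auto simp: B_def\<close>)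
  moreover have "a \<nu> \<kappa> \<noteq> 0" using \<kappa> by (simp add: B_def)
  ultimately show False using D orth[OF kp \<nu>] by (cases "\<kappa> = \<nu>") auto
qed

definition P :: "nat list \<Rightarrow> sfun" where
  "P \<nu> = mfps_const (inverse (D \<nu>)) * Q \<nu>"

lemma P_pspan: "\<nu> \<in> partitions \<Longrightarrow> P \<nu> \<in> pspan"
  unfolding P_def by (intro pspan_const pspan)

lemma scalar_P: "\<nu> \<in> partitions \<Longrightarrow> \<mu> \<in> partitions \<Longrightarrow>
    scalar_qt (P \<nu>) (P \<mu>) = inverse (D \<nu>) * inverse (D \<mu>) * scalar_qt (Q \<nu>) (Q \<mu>)"
  unfolding P_def by (simp add: scalar_const_left scalar_const_right pspan pspan_const)

lemma P_expand:
  assumes \<nu>: "\<nu> \<in> partitions"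
  shows "P \<nu> = mono_sym \<nu> + (\<Sum>\<mu> | \<mu> \<in> partitions \<and> dominance_less \<mu> \<nu>.
    mfps_const (inverse (D \<nu>) * a \<nu> \<mu>) * mono_sym \<mu>)"
proof -
  let ?L = "{\<mu>. \<mu> \<in> partitions \<and> dominance_less \<mu> \<nu>}"
  have "Q \<nu> = (\<Sum>\<mu>\<in>insert \<nu> ?L. mfps_const (a \<nu> \<mu>) * mono_sym \<mu>)"
    unfolding Q_expand[OF \<nu>]
  proof (rule sum.mono_neutral_right[OF finite_partitions])
    show "insert \<nu> ?L \<subseteq> parts (sum_list \<nu>)" using \<nu> by (auto simp: dominance_less_def)
    have "a \<nu> \<mu> = 0" if "\<mu> \<in> parts (sum_list \<nu>) - insert \<nu> ?L" for \<mu>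
      using a_tri[OF \<nu>, of \<mu>] that by auto
    then show "\<forall>\<mu>\<in>parts (sum_list \<nu>) - insert \<nu> ?L. mfps_const (a \<nu> \<mu>) * mono_sym \<mu> = 0"
      by (simp add: mfps_const_simps)
  qed
  also have "\<dots> = mfps_const (a \<nu> \<nu>) * mono_sym \<nu> + (\<Sum>\<mu>\<in>?L. mfps_const (a \<nu> \<mu>) * mono_sym \<mu>)"
    by (rule sum.insert[OF finite_dominance_less]) (simp add: dominance_less_def)
  finally show ?thesis
    unfolding P_def using D_nonzero[OF \<nu>] D_eq[OF \<nu>]
    by (simp add: distrib_left sum_distrib_left mult.assoc[symmetric] mfps_const_simps(2)
        flip: mfps_const_simps(6))
qed

lemma family_P: "macdonald_family P"
  unfolding macdonald_family_def
proof (intro conjI ballI impI)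
  fix \<nu> assume \<nu>: "\<nu> \<in> partitions"
  have "symm (P \<nu>)" by (intro symm_pspan P_pspan \<nu>)
  moreover have "\<forall>M. sum_list \<nu> < size M \<longrightarrow> mfps_nth (P \<nu>) M = 0"
    using hom[OF \<nu>] by (auto simp: P_def hom_deg_def)
  ultimately show "P \<nu> \<in> Sym" by (auto simp: Sym_def symm_def)
  show "\<exists>u. P \<nu> = mono_sym \<nu> + (\<Sum>\<mu> | \<mu> \<in> partitions \<and> dominance_less \<mu> \<nu>. mfps_const (u \<mu>) * mono_sym \<mu>)"
    by (rule exI, rule P_expand[OF \<nu>])
qed (simp add: scalar_P orth)

lemma family_unique:
  assumes fam: "macdonald_family P'" and \<nu>: "\<nu> \<in> partitions"
  shows "P' \<nu> = P \<nu>"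
  using \<nu>
proof (induction \<nu> rule: measure_induct_rule[of prefix_weight])
  case (less \<nu>)
  let ?L = "{\<mu>. \<mu> \<in> partitions \<and> dominance_less \<mu> \<nu>}"
  obtain u' where u': "P' \<nu> = mono_sym \<nu> + (\<Sum>\<mu>\<in>?L. mfps_const (u' \<mu>) * mono_sym \<mu>)"
    using fam less.prems unfolding macdonald_family_def by blast
  define b where "b \<mu> = u' \<mu> - inverse (D \<nu>) * a \<nu> \<mu>" for \<mu>
  have diff: "P' \<nu> - P \<nu> = (\<Sum>\<mu>\<in>?L. mfps_const (b \<mu>) * mono_sym \<mu>)"
    unfolding u' P_expand[OF less.prems] b_def
    by (simp add: mfps_const_simps(4) left_diff_distrib sum_subtractf)
  have P'p: "P' \<nu> \<in> pspan" unfolding u'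
    by (intro pspan_add pspan_sum pspan_const mono_sym_pspan less.prems) auto
  have "b \<mu> = 0" if "\<mu> \<in> ?L" for \<mu>
  proof (rule ccontr)
    assume "b \<mu> \<noteq> 0"
    define B where "B = {\<mu>\<in>?L. b \<mu> \<noteq> 0}"
    have "finite B" using finite_dominance_less[of \<nu>] unfolding B_def by (rule rev_finite_subset) auto
    moreover have "B \<noteq> {}" using that \<open>b \<mu> \<noteq> 0\<close> by (auto simp: B_def)
    ultimately obtain \<kappa> where \<kappa>: "\<kappa> \<in> B" "\<And>\<mu>. \<mu> \<in> B \<Longrightarrow> prefix_weight \<mu> \<le> prefix_weight \<kappa>"
      using ex_max_weight[of B] by metis
    have kp: "\<kappa> \<in> partitions" "dominance_less \<kappa> \<nu>" "b \<kappa> \<noteq> 0" using \<kappa> by (auto simp: B_def)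
    have ne: "\<kappa> \<noteq> \<nu>" using kp by (auto simp: dominance_less_def)
    have "scalar_qt (Q \<kappa>) (P' \<nu> - P \<nu>) = b \<kappa>"
      unfolding diff
    proof (rule scalar_top)
      fix \<mu> assume "\<mu> \<in> ?L" "b \<mu> \<noteq> 0"
      then have "\<mu> \<in> partitions" "prefix_weight \<mu> \<le> prefix_weight \<kappa>" using \<kappa> by (auto simp: B_def)
      then show "\<not> dominance_less \<kappa> \<mu>" using prefix_weight_less[OF kp(1), of \<mu>] by auto
    qed (use kp finite_dominance_less in auto)
    also have "scalar_qt (Q \<kappa>) (P' \<nu> - P \<nu>) = scalar_qt (Q \<kappa>) (P' \<nu>) - scalar_qt (Q \<kappa>) (P \<nu>)"
      by (intro scalar_diff_right pspan kp P'p P_pspan less.prems)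
    also have "scalar_qt (Q \<kappa>) (P \<nu>) = 0"
      unfolding P_def by (simp add: scalar_const_right pspan kp less.prems orth ne)
    also have "P' \<kappa> = P \<kappa>"
      using prefix_weight_less[OF kp(1) less.prems kp(2)] kp(1) by (rule less.IH)
    then have "scalar_qt (P \<kappa>) (P' \<nu>) = 0"
      using fam kp(1) less.prems ne unfolding macdonald_family_def by metis
    then have "scalar_qt (Q \<kappa>) (P' \<nu>) = 0"
      unfolding P_def using D_nonzero[OF kp(1)] by (simp add: scalar_const_left pspan kp P'p)
    finally show False using kp by simp
  qed
  then have "P' \<nu> - P \<nu> = 0" unfolding diff by (simp add: mfps_const_simps)
  then show ?case by simp
qed

theorem macdonald_Q_eq:
  assumes \<nu>: "\<nu> \<in> partitions"
  shows "macdonald_Q \<nu> = Q \<nu>"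
proof -
  have "macdonald_P \<nu> = P \<nu>"
    unfolding macdonald_P_def
  proof (rule the_equality)
    show "\<exists>P'. macdonald_family P' \<and> P \<nu> = P' \<nu>" using family_P by blast
    fix p assume "\<exists>P'. macdonald_family P' \<and> p = P' \<nu>"
    then show "p = P \<nu>" using family_unique[OF _ \<nu>] by blast
  qed
  moreover have "scalar_qt (P \<nu>) (P \<nu>) = inverse (D \<nu>)"
    using D_nonzero[OF \<nu>] by (simp add: scalar_P \<nu>)
  moreover have "mfps_const (D \<nu>) * P \<nu> = Q \<nu>"
    unfolding P_def mult.assoc[symmetric] mfps_const_simps(6)[symmetric]
    using D_nonzero[OF \<nu>] by (simp add: mfps_const_simps(2))
  ultimately show ?thesis by (simp add: macdonald_Q_def)
qed

end

section \<open>Raising operators\<close>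

definition root_vec :: "nat \<times> nat \<Rightarrow> nat \<Rightarrow> int" where
  "root_vec p k = (if k = fst p then 1 else 0) - (if k = snd p then 1 else 0)"

definition move :: "('v \<Rightarrow> nat \<times> nat) \<Rightarrow> (nat \<Rightarrow> int) \<Rightarrow> 'v multiset \<Rightarrow> nat \<Rightarrow> int" where
  "move \<rho> a M = (\<lambda>k. a k + (\<Sum>v\<in>#M. root_vec (\<rho> v) k))"

lemma move_empty [simp]: "move \<rho> a {#} = a"
  and move_union: "move \<rho> a (A + B) = move \<rho> (move \<rho> a A) B"
  by (auto simp: move_def add.assoc)

lemma Raise_eq: "Raise p a = (\<lambda>k. a k + root_vec p k)"
  by (auto simp: Raise_def root_vec_def fun_eq_iff split: prod.splits)

lemma fold_Raise: "fold_mset Raise a M = move id a M"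
proof -
  interpret comp_fun_commute Raise
    by standard (simp add: Raise_eq fun_eq_iff)
  show ?thesis
  proof (induction M)
    case (add p M)
    then show ?case unfolding fold_mset_add_mset add Raise_eq[of p] by (simp add: move_def add_ac)
  qed simp
qed

lemma gprod_nonneg: "gprod n a \<noteq> 0 \<Longrightarrow> 1 \<le> k \<Longrightarrow> k \<le> n \<Longrightarrow> a k \<ge> 0"
  unfolding gprod_def by (metis atLeastAtMost_iff finite_atLeastAtMost gfun_neg not_le prod_zero)

lemma finite_pairs: "finite (pairs n)"
  by (rule finite_subset[of _ "{0..n} \<times> {0..n}"]) (auto simp: pairs_def)

lemma weighted_sum_root_vec:
  assumes "p \<in> pairs n"
  shows "(\<Sum>k=1..n. int k * root_vec p k) \<le> - 1"
proof -
  obtain i j where p: "p = (i, j)" "1 \<le> i" "i < j" "j \<le> n" using assms by (auto simp: pairs_def)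
  have "(\<Sum>k=1..n. int k * root_vec p k)
      = (\<Sum>k=1..n. if k = i then int k else 0) - (\<Sum>k=1..n. if k = j then int k else 0)"
    unfolding p root_vec_def sum_subtractf[symmetric] by (intro sum.cong) auto
  also have "\<dots> = int i - int j" using p by (simp add: sum.delta)
  finally show ?thesis using p by simp
qed

lemma weighted_sum_move:
  assumes "\<rho> ` set_mset M \<subseteq> pairs n"
  shows "(\<Sum>k=1..n. int k * move \<rho> a M k) \<le> (\<Sum>k=1..n. int k * a k) - int (size M)"
  using assms
proof (induction M arbitrary: a)
  case (add v M)
  have "(\<Sum>k=1..n. int k * move \<rho> a (add_mset v M) k)
      = (\<Sum>k=1..n. int k * move \<rho> a M k) + (\<Sum>k=1..n. int k * root_vec (\<rho> v) k)"
    by (simp add: move_def algebra_simps sum.distrib)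
  then show ?case using add.IH[of a] add.prems weighted_sum_root_vec[of "\<rho> v" n] by simp
qed simp

lemma finite_bounded_multisets:
  assumes "finite V"
  shows "finite {M. set_mset M \<subseteq> V \<and> size M \<le> d}"
proof (rule finite_subset[OF _ finite_submultisets[of "repeat_mset d (mset_set V)"]], rule subsetI)
  fix M assume "M \<in> {M. set_mset M \<subseteq> V \<and> size M \<le> d}"
  then have M: "set_mset M \<subseteq> V" "size M \<le> d" by auto
  have "count M v \<le> count (repeat_mset d (mset_set V)) v" for v
    using M count_le_size[of M v] assms
    by (cases "v \<in># M") (auto simp: not_in_iff intro: order_trans)
  then show "M \<in> {A. A \<subseteq># repeat_mset d (mset_set V)}" by (simp add: subseteq_mset_def)
qed

locale raising =
  fixes n :: nat and V :: "'v set" and \<rho> :: "'v \<Rightarrow> nat \<times> nat"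
  assumes V: "finite V" "\<rho> ` V \<subseteq> pairs n"
begin

definition G :: "(nat \<Rightarrow> int) \<Rightarrow> 'v multiset \<Rightarrow> sfun" where
  "G a M = gprod n (move \<rho> a M)"

definition J :: "(nat \<Rightarrow> int) \<Rightarrow> 'v multiset set" where
  "J a = {M. set_mset M \<subseteq> V \<and> G a M \<noteq> 0}"

lemma finite_J: "finite (J a)"
proof (rule finite_subset[OF _ finite_bounded_multisets[OF V(1)]])
  show "J a \<subseteq> {M. set_mset M \<subseteq> V \<and> size M \<le> nat (\<Sum>k=1..n. int k * a k)}"
  proof
    fix M assume "M \<in> J a"
    then have M: "set_mset M \<subseteq> V" "gprod n (move \<rho> a M) \<noteq> 0" by (auto simp: J_def G_def)
    have "0 \<le> (\<Sum>k=1..n. int k * move \<rho> a M k)"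
      using gprod_nonneg[OF M(2)] by (intro sum_nonneg) auto
    also have "\<dots> \<le> (\<Sum>k=1..n. int k * a k) - int (size M)"
      by (rule weighted_sum_move) (use M V in auto)
    finally show "M \<in> {M. set_mset M \<subseteq> V \<and> size M \<le> nat (\<Sum>k=1..n. int k * a k)}"
      using M by simp
  qed
qed

definition supp :: "('v, Qqt) mfps \<Rightarrow> bool" where
  "supp \<Phi> \<longleftrightarrow> (\<forall>M. mfps_nth \<Phi> M \<noteq> 0 \<longrightarrow> set_mset M \<subseteq> V)"

definition app :: "('v, Qqt) mfps \<Rightarrow> (nat \<Rightarrow> int) \<Rightarrow> sfun" where
  "app \<Phi> a = (\<Sum>M\<in>J a. mfps_const (mfps_nth \<Phi> M) * G a M)"

lemma app_eq:
  assumes "supp \<Phi>"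
  shows "app \<Phi> a = (\<Sum>M | mfps_nth \<Phi> M \<noteq> 0 \<and> gprod n (move \<rho> a M) \<noteq> 0.
    mfps_const (mfps_nth \<Phi> M) * gprod n (move \<rho> a M))"
  unfolding app_def G_def
  by (rule sum.mono_neutral_right[OF finite_J])
    (use assms in \<open>auto simp: supp_def J_def G_def mfps_const_simps\<close>)

lemma app_superset:
  assumes "supp \<Phi>" "finite K" "\<And>M. M \<in> J a \<Longrightarrow> mfps_nth \<Phi> M \<noteq> 0 \<Longrightarrow> M \<in> K"
  shows "app \<Phi> a = (\<Sum>M\<in>K. mfps_const (mfps_nth \<Phi> M) * G a M)"
proof -
  have z: "mfps_const (mfps_nth \<Phi> M) * G a M = 0" if "M \<in> J a - J a \<inter> K" for M
    using that assms(3) by (cases "mfps_nth \<Phi> M = 0") (auto simp: mfps_const_simps)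
  have z': "mfps_const (mfps_nth \<Phi> M) * G a M = 0" if "M \<in> K - J a \<inter> K" for M
    using that assms(1) by (cases "mfps_nth \<Phi> M = 0") (auto simp: mfps_const_simps supp_def J_def)
  have "app \<Phi> a = (\<Sum>M\<in>J a \<inter> K. mfps_const (mfps_nth \<Phi> M) * G a M)"
    unfolding app_def by (rule sum.mono_neutral_right[OF finite_J]) (use z in auto)
  also have "\<dots> = (\<Sum>M\<in>K. mfps_const (mfps_nth \<Phi> M) * G a M)"
    by (rule sum.mono_neutral_left[OF assms(2)]) (use z' in auto)
  finally show ?thesis .
qed

lemma app_diff: "app (\<Phi> - \<Psi>) a = app \<Phi> a - app \<Psi> a"
  by (simp add: app_def mfps_const_simps left_diff_distrib sum_subtractf)

lemma supp_diff: "supp \<Phi> \<Longrightarrow> supp \<Psi> \<Longrightarrow> supp (\<Phi> - \<Psi>)"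
  unfolding supp_def by (metis diff_zero mfps_nth_simps(4))

lemma supp_mono_mult:
  assumes "supp \<Phi>" "set_mset A \<subseteq> V"
  shows "supp (mfps_mono A * \<Phi>)"
  unfolding supp_def mfps_nth_mono_mult
proof (intro allI impI)
  fix M assume "(if A \<subseteq># M then mfps_nth \<Phi> (M - A) else 0) \<noteq> 0"
  then have "A \<subseteq># M" "mfps_nth \<Phi> (M - A) \<noteq> 0" by (auto split: if_splits)
  then have "set_mset (A + (M - A)) \<subseteq> V" using assms unfolding supp_def set_mset_union by blast
  then show "set_mset M \<subseteq> V" using \<open>A \<subseteq># M\<close> by simp
qed

lemma app_mono_mult:
  assumes "supp \<Phi>" "set_mset A \<subseteq> V"
  shows "app (mfps_mono A * \<Phi>) a = app \<Phi> (move \<rho> a A)"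
proof -
  let ?K = "(\<lambda>M. A + M) ` J (move \<rho> a A)"
  have "app (mfps_mono A * \<Phi>) a
      = (\<Sum>M\<in>?K. mfps_const (mfps_nth (mfps_mono A * \<Phi>) M) * G a M)"
  proof (rule app_superset[OF supp_mono_mult[OF assms]])
    fix M assume M: "M \<in> J a" "mfps_nth (mfps_mono A * \<Phi>) M \<noteq> 0"
    then have "A \<subseteq># M" by (auto simp: mfps_nth_mono_mult split: if_splits)
    then obtain B where B: "M = A + B" by (metis subset_mset.le_iff_add)
    then have "B \<in> J (move \<rho> a A)" using M by (auto simp: J_def G_def move_union)
    then show "M \<in> ?K" using B by blast
  qed (simp add: finite_J)
  also have "\<dots> = (\<Sum>M\<in>J (move \<rho> a A). mfps_const (mfps_nth \<Phi> M) * G (move \<rho> a A) M)"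
    by (subst sum.reindex) (auto simp: mfps_nth_mono_mult G_def move_union)
  finally show ?thesis by (simp add: app_def)
qed

lemma app_one_minus_mult:
  assumes "supp \<Phi>" "set_mset A \<subseteq> V"
  shows "supp ((1 - mfps_mono A) * \<Phi>)"
    and "app ((1 - mfps_mono A) * \<Phi>) a = app \<Phi> a - app \<Phi> (move \<rho> a A)"
  using assms by (auto simp: left_diff_distrib app_diff app_mono_mult supp_diff supp_mono_mult)

context
  fixes c :: "'b \<Rightarrow> Qqt" and mon :: "'b \<Rightarrow> 'v multiset" and I :: "'b set"
  assumes fib: "\<And>M. finite {b\<in>I. mon b = M}" and monV: "\<And>b. b \<in> I \<Longrightarrow> set_mset (mon b) \<subseteq> V"
begin

lemma nth_mono_family:
  "mfps_nth (mfps_sum (\<lambda>b. mfps_const (c b) * mfps_mono (mon b)) I) M = (\<Sum>b | b \<in> I \<and> mon b = M. c b)"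
  by (subst mfps_nth_mfps_sum[where J="{b\<in>I. mon b = M}"]) (auto simp: fib)

lemma supp_mono_family: "supp (mfps_sum (\<lambda>b. mfps_const (c b) * mfps_mono (mon b)) I)"
  unfolding supp_def
proof (intro allI impI)
  fix M assume "mfps_nth (mfps_sum (\<lambda>b. mfps_const (c b) * mfps_mono (mon b)) I) M \<noteq> 0"
  then have "{b. b \<in> I \<and> mon b = M} \<noteq> {}" unfolding nth_mono_family by (metis sum.empty)
  then show "set_mset M \<subseteq> V" using monV by auto
qed

lemma app_mono_family:
  "app (mfps_sum (\<lambda>b. mfps_const (c b) * mfps_mono (mon b)) I) a
    = (\<Sum>b | b \<in> I \<and> gprod n (move \<rho> a (mon b)) \<noteq> 0. mfps_const (c b) * gprod n (move \<rho> a (mon b)))"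
proof -
  let ?S = "{b. b \<in> I \<and> gprod n (move \<rho> a (mon b)) \<noteq> 0}"
  have "?S \<subseteq> (\<Union>M\<in>J a. {b\<in>I. mon b = M})" using monV by (auto simp: J_def G_def)
  then have S: "finite ?S" using finite_J fib by (meson finite_UN_I finite_subset)
  have "app (mfps_sum (\<lambda>b. mfps_const (c b) * mfps_mono (mon b)) I) a
      = (\<Sum>M\<in>J a. \<Sum>b | b \<in> ?S \<and> mon b = M. mfps_const (c b) * gprod n (move \<rho> a (mon b)))"
    unfolding app_def nth_mono_family mfps_const_sum sum_distrib_right
    by (intro sum.cong) (auto simp: J_def G_def)
  also have "\<dots> = (\<Sum>b\<in>?S. mfps_const (c b) * gprod n (move \<rho> a (mon b)))"
    by (rule sum.group[OF S finite_J]) (use monV in \<open>auto simp: J_def G_def\<close>)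
  finally show ?thesis .
qed

end

end

lemma sum_mset_mset_set_interval:
  "k \<le> l \<Longrightarrow> (\<Sum>r\<in>#mset_set {k..<l}. root_vec (r, Suc r) i) = root_vec (k, l) i"
proof (induction l rule: dec_induct)
  case (step l)
  have "{k..<Suc l} = insert l {k..<l}" using step by auto
  then show ?case using step by (simp add: root_vec_def)
qed (simp add: root_vec_def)

lemma xratio_mono: "xratio k l = mfps_mono (mset_set {k..<l})"
proof -
  have "(\<Sum>r\<in>{k..<l}. {#r#}) = mset_set {k..<l}" by simp
  then show ?thesis unfolding xratio_def mfps_var_eq_mono mfps_mono_sum[symmetric] by simp
qed

definition pair_mon :: "nat \<Rightarrow> (nat \<Rightarrow> nat \<Rightarrow> nat) \<Rightarrow> (nat \<times> nat) multiset" where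
  "pair_mon n \<theta> = (\<Sum>(i,j)\<in>pairs n. replicate_mset (\<theta> i j) (i, j))"

definition root_mon :: "nat \<Rightarrow> (nat \<Rightarrow> nat \<Rightarrow> nat) \<Rightarrow> nat multiset" where
  "root_mon n \<theta> = (\<Sum>(i,j)\<in>pairs n. repeat_mset (\<theta> i j) (mset_set {i..<j}))"

lemma pair_mon: "(\<Prod>(i, j)\<in>pairs n. mfps_var (i, j) ^ \<theta> i j) = mfps_mono (pair_mon n \<theta>)"
  unfolding pair_mon_def mfps_mono_sum by (intro prod.cong) (auto simp: mfps_var_power)

lemma root_mon: "(\<Prod>(i, j)\<in>pairs n. xratio i j ^ \<theta> i j) = mfps_mono (root_mon n \<theta>)"
  unfolding root_mon_def mfps_mono_sum
  by (intro prod.cong) (auto simp: xratio_mono mfps_mono_power)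

lemma set_mset_sum: "finite I \<Longrightarrow> set_mset (\<Sum>i\<in>I. h i) = (\<Union>i\<in>I. set_mset (h i))"
  by (induction I rule: finite_induct) auto

lemma set_pair_mon: "set_mset (pair_mon n \<theta>) \<subseteq> pairs n"
  unfolding pair_mon_def set_mset_sum[OF finite_pairs] by (auto simp: in_replicate_mset split: if_splits)

lemma set_root_mon: "set_mset (root_mon n \<theta>) \<subseteq> {1..<n}"
proof -
  have "set_mset (repeat_mset k A) \<subseteq> set_mset A" for k and A :: "nat multiset" by (induction k) auto
  then show ?thesis
    unfolding root_mon_def set_mset_sum[OF finite_pairs] by (fastforce simp: pairs_def)
qed

lemma size_sum_multiset:
  fixes h :: "'b \<Rightarrow> 'v multiset"
  shows "finite I \<Longrightarrow> size (\<Sum>i\<in>I. h i) = (\<Sum>i\<in>I. size (h i))"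
  by (induction I rule: finite_induct) auto

lemma theta_le_size:
  assumes "(i, j) \<in> pairs n"
  shows "\<theta> i j \<le> size (pair_mon n \<theta>)" "\<theta> i j \<le> size (root_mon n \<theta>)"
proof -
  have "\<theta> i j = size (case (i,j) of (i,j) \<Rightarrow> replicate_mset (\<theta> i j) (i, j))" by simp
  also have "\<dots> \<le> size (pair_mon n \<theta>)"
    unfolding pair_mon_def size_sum_multiset[OF finite_pairs]
    by (rule member_le_sum[OF assms]) (auto simp: finite_pairs)
  finally show "\<theta> i j \<le> size (pair_mon n \<theta>)" .
  have sz: "size (repeat_mset k A) = k * size A" for k and A :: "nat multiset" by (induction k) auto
  have "\<theta> i j \<le> size (case (i,j) of (i,j) \<Rightarrow> repeat_mset (\<theta> i j) (mset_set {i..<j}))"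
    using assms by (auto simp: sz pairs_def)
  also have "\<dots> \<le> size (root_mon n \<theta>)"
    unfolding root_mon_def size_sum_multiset[OF finite_pairs]
    by (rule member_le_sum[OF assms]) (auto simp: finite_pairs)
  finally show "\<theta> i j \<le> size (root_mon n \<theta>)" .
qed

lemma finite_Mats_bounded: "finite {\<theta>\<in>Mats n. \<forall>(i,j)\<in>pairs n. \<theta> i j \<le> d}"
proof -
  have "finite {f :: nat \<times> nat \<Rightarrow> nat. \<forall>x. (x \<in> pairs n \<longrightarrow> f x \<in> {..d}) \<and> (x \<notin> pairs n \<longrightarrow> f x = 0)}"
    by (rule finite_set_of_finite_funs) (auto simp: finite_pairs)
  then have "finite (curry ` {f :: nat \<times> nat \<Rightarrow> nat. \<forall>x. (x \<in> pairs n \<longrightarrow> f x \<in> {..d}) \<and> (x \<notin> pairs n \<longrightarrow> f x = 0)})"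
    by (rule finite_imageI)
  then show ?thesis
  proof (rule rev_finite_subset)
    show "{\<theta>\<in>Mats n. \<forall>(i,j)\<in>pairs n. \<theta> i j \<le> d}
        \<subseteq> curry ` {f :: nat \<times> nat \<Rightarrow> nat. \<forall>x. (x \<in> pairs n \<longrightarrow> f x \<in> {..d}) \<and> (x \<notin> pairs n \<longrightarrow> f x = 0)}"
    proof
      fix \<theta> assume "\<theta> \<in> {\<theta>\<in>Mats n. \<forall>(i,j)\<in>pairs n. \<theta> i j \<le> d}"
      then have "case_prod \<theta> \<in> {f. \<forall>x. (x \<in> pairs n \<longrightarrow> f x \<in> {..d}) \<and> (x \<notin> pairs n \<longrightarrow> f x = 0)}"
        by (auto simp: Mats_def)
      moreover have "\<theta> = curry (case_prod \<theta>)" by simp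
      ultimately show "\<theta> \<in> curry ` {f. \<forall>x. (x \<in> pairs n \<longrightarrow> f x \<in> {..d}) \<and> (x \<notin> pairs n \<longrightarrow> f x = 0)}"
        by blast
    qed
  qed
qed

lemma finite_fibre_pair: "finite {\<theta>\<in>Mats n. pair_mon n \<theta> = M}"
  by (rule finite_subset[OF _ finite_Mats_bounded[of n "size M"]]) (auto simp: theta_le_size)

lemma finite_fibre_root: "finite {\<theta>\<in>Mats n. root_mon n \<theta> = M}"
  by (rule finite_subset[OF _ finite_Mats_bounded[of n "size M"]]) (auto simp: theta_le_size)

abbreviation simple_root :: "nat \<Rightarrow> nat \<times> nat" where
  "simple_root r \<equiv> (r, Suc r)"

lemma move_interval: "k \<le> l \<Longrightarrow> move simple_root a (mset_set {k..<l}) = move id a {#(k, l)#}"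
  by (rule ext) (simp add: move_def sum_mset_mset_set_interval)

lemma move_sum: "finite I \<Longrightarrow> move \<rho> a (\<Sum>i\<in>I. h i) = (\<lambda>k. a k + (\<Sum>i\<in>I. \<Sum>v\<in>#h i. root_vec (\<rho> v) k))"
  unfolding move_def by (induction I rule: finite_induct) (auto simp: fun_eq_iff)

lemma move_root_mon: "move simple_root a (root_mon n \<theta>) = move id a (pair_mon n \<theta>)"
proof -
  have rep: "(\<Sum>v\<in>#repeat_mset k A. h v) = int k * (\<Sum>v\<in>#A. h v)" for k and A :: "'b multiset" and h
    by (induction k) (auto simp: algebra_simps)
  have rep2: "(\<Sum>v\<in>#replicate_mset k x. h v) = int k * h x" for k and x :: 'b and h
    by (induction k) (auto simp: algebra_simps)
  show ?thesis
    unfolding root_mon_def pair_mon_def move_sum[OF finite_pairs]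
  proof (rule ext, rule arg_cong[where f="\<lambda>x. _ + x"], rule sum.cong[OF refl])
    fix k p assume "p \<in> pairs n"
    then obtain i j where p: "p = (i, j)" "i \<le> j" by (auto simp: pairs_def)
    show "(\<Sum>v\<in>#(case p of (i, j) \<Rightarrow> repeat_mset (\<theta> i j) (mset_set {i..<j})). root_vec (simple_root v) k)
        = (\<Sum>v\<in>#(case p of (i, j) \<Rightarrow> replicate_mset (\<theta> i j) (i, j)). root_vec (id v) k)"
      using p by (simp add: rep rep2 sum_mset_mset_set_interval)
  qed
qed

interpretation rpair: raising n "pairs n" id
  by standard (auto simp: finite_pairs)

interpretation rroot: raising n "{1..<n}" simple_root
  by standard (auto simp: pairs_def)

text \<open>
  The operators \<open>R\<^sub>k\<^sub>l\<close> enter only through the simple raising operators \<open>R\<^sub>r\<^sub>,\<^sub>r\<^sub>+\<^sub>1\<close>, which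
  correspond to the variables of \<open>fser\<close>.
\<close>
lemma raise_apply_fser:
  "raise_apply n (raising_series n s) a = rroot.app n (fser n s q0 t0) a"
  and supp_fser: "rroot.supp n (fser n s q0 t0)"
proof -
  define S1 where "S1 = mfps_sum (\<lambda>\<theta>. mfps_const (cc n \<theta> s q0 t0) * mfps_mono (pair_mon n \<theta>)) (Mats n)"
  define S2 where "S2 = mfps_sum (\<lambda>\<theta>. mfps_const (cc n \<theta> s q0 t0) * mfps_mono (root_mon n \<theta>)) (Mats n)"
  have S1: "rpair.supp n S1" unfolding S1_def
    by (rule rpair.supp_mono_family[OF finite_fibre_pair set_pair_mon])
  have S2: "rroot.supp n S2" unfolding S2_def
    by (rule rroot.supp_mono_family[OF finite_fibre_root set_root_mon])
  have S12: "rpair.app n S1 a = rroot.app n S2 a" for a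
    unfolding S1_def S2_def
      rpair.app_mono_family[OF finite_fibre_pair set_pair_mon]
      rroot.app_mono_family[OF finite_fibre_root set_root_mon] move_root_mon ..
  have main: "rpair.supp n ((\<Prod>p\<in>P. 1 - mfps_mono {#p#}) * S1)
      \<and> rroot.supp n ((\<Prod>(k,l)\<in>P. 1 - mfps_mono (mset_set {k..<l})) * S2)
      \<and> (\<forall>a. rpair.app n ((\<Prod>p\<in>P. 1 - mfps_mono {#p#}) * S1) a
           = rroot.app n ((\<Prod>(k,l)\<in>P. 1 - mfps_mono (mset_set {k..<l})) * S2) a)"
    if "finite P" "P \<subseteq> pairs n" for P
    using that
  proof (induction P rule: finite_induct)
    case empty
    show ?case unfolding prod.empty mult_1_left using S1 S2 S12 by blast
  next
    case (insert p P)
    obtain k l where p: "p = (k, l)" "1 \<le> k" "k < l" "l \<le> n" using insert.prems by (auto simp: pairs_def)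
    let ?A = "(\<Prod>p\<in>P. 1 - mfps_mono {#p#}) * S1"
    let ?B = "(\<Prod>(k,l)\<in>P. 1 - mfps_mono (mset_set {k..<l})) * S2"
    have A: "rpair.supp n ?A" and B: "rroot.supp n ?B"
      and AB: "\<And>a. rpair.app n ?A a = rroot.app n ?B a"
      using insert.IH insert.prems by blast+
    have pV: "set_mset {#p#} \<subseteq> pairs n" "set_mset (mset_set {k..<l}) \<subseteq> {1..<n}"
      using insert.prems p by auto
    have eqs: "(\<Prod>p\<in>insert p P. 1 - mfps_mono {#p#}) * S1 = (1 - mfps_mono {#p#}) * ?A"
      "(\<Prod>(k,l)\<in>insert p P. 1 - mfps_mono (mset_set {k..<l})) * S2 = (1 - mfps_mono (mset_set {k..<l})) * ?B"
      using insert.hyps p(1) by (simp_all add: mult.assoc)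
    show ?case unfolding eqs
    proof (intro conjI allI)
      show "rpair.supp n ((1 - mfps_mono {#p#}) * ?A)"
        by (rule rpair.app_one_minus_mult(1)[OF A pV(1)])
      show "rroot.supp n ((1 - mfps_mono (mset_set {k..<l})) * ?B)"
        by (rule rroot.app_one_minus_mult(1)[OF B pV(2)])
      fix a
      show "rpair.app n ((1 - mfps_mono {#p#}) * ?A) a
          = rroot.app n ((1 - mfps_mono (mset_set {k..<l})) * ?B) a"
        unfolding rpair.app_one_minus_mult(2)[OF A pV(1)] rroot.app_one_minus_mult(2)[OF B pV(2)] AB
        unfolding p(1) move_interval[OF less_imp_le[OF p(3)]] ..
    qed
  qed
  have f: "fser n s q0 t0 = (\<Prod>(k,l)\<in>pairs n. 1 - mfps_mono (mset_set {k..<l})) * S2"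
    unfolding fser_def S2_def root_mon by (simp add: xratio_mono)
  have r: "raising_series n s = (\<Prod>p\<in>pairs n. 1 - mfps_mono {#p#}) * S1"
    unfolding raising_series_def S1_def pair_mon
    by (simp add: mfps_var_eq_mono case_prod_unfold)
  note m = main[OF finite_pairs order_refl]
  show "rroot.supp n (fser n s q0 t0)" unfolding f using m by blast
  have "raise_apply n (raising_series n s) a = rpair.app n (raising_series n s) a"
    unfolding raise_apply_def fold_Raise by (rule rpair.app_eq[symmetric]) (use m r in simp)
  also have "\<dots> = rroot.app n (fser n s q0 t0) a" unfolding r f using m by blast
  finally show "raise_apply n (raising_series n s) a = rroot.app n (fser n s q0 t0) a" .
qed

section \<open>Specialization of the indeterminates\<close>

definition mval :: "(nat \<Rightarrow> Qqt) \<Rightarrow> (nat \<Rightarrow>\<^sub>0 nat) \<Rightarrow> Qqt" where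
  "mval \<sigma> m = (\<Prod>i\<in>Poly_Mapping.keys m. \<sigma> i ^ Poly_Mapping.lookup m i)"

lemma mval_superset:
  "finite A \<Longrightarrow> Poly_Mapping.keys m \<subseteq> A \<Longrightarrow> mval \<sigma> m = (\<Prod>i\<in>A. \<sigma> i ^ Poly_Mapping.lookup m i)"
  unfolding mval_def by (rule prod.mono_neutral_left) (auto simp: in_keys_iff)

lemma mval_add: "mval \<sigma> (m + m') = mval \<sigma> m * mval \<sigma> m'"
proof -
  let ?A = "Poly_Mapping.keys m \<union> Poly_Mapping.keys m'"
  have "Poly_Mapping.keys (m + m') \<subseteq> ?A" by (rule Poly_Mapping.keys_add)
  then show ?thesis
    by (simp add: mval_superset[of ?A] lookup_add power_add prod.distrib)
qed

definition poly_eval :: "(nat \<Rightarrow> Qqt) \<Rightarrow> ((nat \<Rightarrow>\<^sub>0 nat) \<Rightarrow>\<^sub>0 Qqt) \<Rightarrow> Qqt" where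
  "poly_eval \<sigma> p = (\<Sum>m\<in>Poly_Mapping.keys p. Poly_Mapping.lookup p m * mval \<sigma> m)"

lemma poly_eval_superset:
  "finite A \<Longrightarrow> Poly_Mapping.keys p \<subseteq> A \<Longrightarrow> poly_eval \<sigma> p = (\<Sum>m\<in>A. Poly_Mapping.lookup p m * mval \<sigma> m)"
  unfolding poly_eval_def by (rule sum.mono_neutral_left) (auto simp: in_keys_iff)

lemma poly_eval_add: "poly_eval \<sigma> (p + r) = poly_eval \<sigma> p + poly_eval \<sigma> r"
proof -
  let ?A = "Poly_Mapping.keys p \<union> Poly_Mapping.keys r"
  have "Poly_Mapping.keys (p + r) \<subseteq> ?A" by (rule Poly_Mapping.keys_add)
  then show ?thesis
    by (simp add: poly_eval_superset[of ?A] lookup_add distrib_right sum.distrib)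
qed

lemma poly_eval_0 [simp]: "poly_eval \<sigma> 0 = 0"
  by (simp add: poly_eval_def)

lemma poly_eval_single: "poly_eval \<sigma> (Poly_Mapping.single m c) = c * mval \<sigma> m"
  by (cases "c = 0") (auto simp: poly_eval_def)

lemma poly_eval_1 [simp]: "poly_eval \<sigma> 1 = 1"
  using poly_eval_single[of \<sigma> 0 1] by (simp add: mval_def)

lemma poly_eval_sum: "poly_eval \<sigma> (sum h I) = (\<Sum>i\<in>I. poly_eval \<sigma> (h i))"
  by (induction I rule: infinite_finite_induct) (auto simp: poly_eval_add)

lemma poly_mapping_eq_sum_single:
  "p = (\<Sum>m\<in>Poly_Mapping.keys p. Poly_Mapping.single m (Poly_Mapping.lookup p m))"
proof (rule poly_mapping_eqI)
  fix k
  have "Poly_Mapping.lookup (\<Sum>m\<in>Poly_Mapping.keys p. Poly_Mapping.single m (Poly_Mapping.lookup p m)) k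
      = (\<Sum>m\<in>Poly_Mapping.keys p. if m = k then Poly_Mapping.lookup p k else 0)"
    unfolding lookup_sum by (intro sum.cong) (auto simp: lookup_single when_def)
  also have "\<dots> = Poly_Mapping.lookup p k" by (auto simp: sum.delta' in_keys_iff)
  finally show "Poly_Mapping.lookup p k
      = Poly_Mapping.lookup (\<Sum>m\<in>Poly_Mapping.keys p. Poly_Mapping.single m (Poly_Mapping.lookup p m)) k" ..
qed

lemma poly_eval_mult: "poly_eval \<sigma> (p * r) = poly_eval \<sigma> p * poly_eval \<sigma> r"
proof -
  let ?s = "\<lambda>p m. Poly_Mapping.single m (Poly_Mapping.lookup p m)"
  have "poly_eval \<sigma> (p * r) = poly_eval \<sigma> ((\<Sum>m\<in>Poly_Mapping.keys p. ?s p m) * (\<Sum>m\<in>Poly_Mapping.keys r. ?s r m))"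
    using poly_mapping_eq_sum_single[of p] poly_mapping_eq_sum_single[of r] by simp
  also have "\<dots> = poly_eval \<sigma> p * poly_eval \<sigma> r"
    by (simp add: sum_product poly_eval_sum mult_single poly_eval_single mval_add mult_ac) (simp add: poly_eval_def sum_product mult_ac)
  finally show ?thesis .
qed

definition spec :: "(nat \<Rightarrow> Qqt) \<Rightarrow> Qqts \<Rightarrow> Qqt \<Rightarrow> bool" where
  "spec \<sigma> x v \<longleftrightarrow> (\<exists>a b. x = Fract a b \<and> poly_eval \<sigma> b \<noteq> 0 \<and> v = poly_eval \<sigma> a / poly_eval \<sigma> b)"

lemma poly_eval_uminus: "poly_eval \<sigma> (- p) = - poly_eval \<sigma> p"
  using poly_eval_add[of \<sigma> p "- p"] by (simp add: add_eq_0_iff2)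

lemma poly_eval_nonzeroD: "poly_eval \<sigma> b \<noteq> 0 \<Longrightarrow> b \<noteq> 0"
  by auto

lemma spec_unique:
  assumes "spec \<sigma> x v" "spec \<sigma> x w"
  shows "v = w"
proof -
  obtain a b c d where *: "x = Fract a b" "poly_eval \<sigma> b \<noteq> 0" "v = poly_eval \<sigma> a / poly_eval \<sigma> b"
    "x = Fract c d" "poly_eval \<sigma> d \<noteq> 0" "w = poly_eval \<sigma> c / poly_eval \<sigma> d"
    using assms unfolding spec_def by blast
  then have "a * d = c * b" using eq_fract(1)[of b d a c] by (auto dest: poly_eval_nonzeroD)
  then have "poly_eval \<sigma> a * poly_eval \<sigma> d = poly_eval \<sigma> c * poly_eval \<sigma> b" by (metis poly_eval_mult)
  then show ?thesis using * by (simp add: frac_eq_eq)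
qed

context
  fixes \<sigma> :: "nat \<Rightarrow> Qqt"
begin

lemma spec_const: "spec \<sigma> (to_Qqts c) c"
  unfolding spec_def to_Qqts_def
  by (intro exI[of _ "Poly_Mapping.single 0 c"] exI[of _ 1]) (simp add: poly_eval_single mval_def)

lemma spec_var: "spec \<sigma> (sv i) (\<sigma> i)"
  unfolding spec_def sv_def
  by (intro exI[of _ "Poly_Mapping.single (Poly_Mapping.single i 1) 1"] exI[of _ 1])
    (simp add: poly_eval_single mval_def)

lemma spec_0: "spec \<sigma> 0 0"
  unfolding spec_def by (intro exI[of _ 0] exI[of _ 1]) (simp add: Zero_fract_def[where 'a="(nat \<Rightarrow>\<^sub>0 nat) \<Rightarrow>\<^sub>0 Qqt"])

lemma spec_1: "spec \<sigma> 1 1"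
  unfolding spec_def by (intro exI[of _ 1] exI[of _ 1]) (simp add: One_fract_def[where 'a="(nat \<Rightarrow>\<^sub>0 nat) \<Rightarrow>\<^sub>0 Qqt"])

lemma spec_add: "spec \<sigma> x v \<Longrightarrow> spec \<sigma> y w \<Longrightarrow> spec \<sigma> (x + y) (v + w)"
proof -
  assume "spec \<sigma> x v" "spec \<sigma> y w"
  then obtain a b c d where *: "x = Fract a b" "poly_eval \<sigma> b \<noteq> 0" "v = poly_eval \<sigma> a / poly_eval \<sigma> b"
    "y = Fract c d" "poly_eval \<sigma> d \<noteq> 0" "w = poly_eval \<sigma> c / poly_eval \<sigma> d"
    unfolding spec_def by blast
  have "b \<noteq> 0" "d \<noteq> 0" using * by (auto dest: poly_eval_nonzeroD)
  then have "x + y = Fract (a * d + c * b) (b * d)" using * by simp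
  moreover have "poly_eval \<sigma> (b * d) \<noteq> 0" using * by (simp add: poly_eval_mult)
  moreover have "v + w = poly_eval \<sigma> (a * d + c * b) / poly_eval \<sigma> (b * d)"
    using * by (simp add: poly_eval_mult poly_eval_add add_frac_eq)
  ultimately show ?thesis unfolding spec_def by blast
qed

lemma spec_mult: "spec \<sigma> x v \<Longrightarrow> spec \<sigma> y w \<Longrightarrow> spec \<sigma> (x * y) (v * w)"
proof -
  assume "spec \<sigma> x v" "spec \<sigma> y w"
  then obtain a b c d where *: "x = Fract a b" "poly_eval \<sigma> b \<noteq> 0" "v = poly_eval \<sigma> a / poly_eval \<sigma> b"
    "y = Fract c d" "poly_eval \<sigma> d \<noteq> 0" "w = poly_eval \<sigma> c / poly_eval \<sigma> d"
    unfolding spec_def by blast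
  then have "x * y = Fract (a * c) (b * d)" by simp
  moreover have "poly_eval \<sigma> (b * d) \<noteq> 0" using * by (simp add: poly_eval_mult)
  moreover have "v * w = poly_eval \<sigma> (a * c) / poly_eval \<sigma> (b * d)" using * by (simp add: poly_eval_mult)
  ultimately show ?thesis unfolding spec_def by blast
qed

lemma spec_uminus: "spec \<sigma> x v \<Longrightarrow> spec \<sigma> (- x) (- v)"
proof -
  assume "spec \<sigma> x v"
  then obtain a b where *: "x = Fract a b" "poly_eval \<sigma> b \<noteq> 0" "v = poly_eval \<sigma> a / poly_eval \<sigma> b"
    unfolding spec_def by blast
  then have "- x = Fract (- a) b" "- v = poly_eval \<sigma> (- a) / poly_eval \<sigma> b" by (simp_all add: poly_eval_uminus)
  then show ?thesis unfolding spec_def using * by blast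
qed

lemma spec_diff: "spec \<sigma> x v \<Longrightarrow> spec \<sigma> y w \<Longrightarrow> spec \<sigma> (x - y) (v - w)"
  using spec_add[of x v "- y" "- w"] spec_uminus by simp

lemma spec_inverse: "spec \<sigma> x v \<Longrightarrow> v \<noteq> 0 \<Longrightarrow> spec \<sigma> (inverse x) (inverse v)"
proof -
  assume "spec \<sigma> x v" "v \<noteq> 0"
  then obtain a b where *: "x = Fract a b" "poly_eval \<sigma> b \<noteq> 0" "v = poly_eval \<sigma> a / poly_eval \<sigma> b" "v \<noteq> 0"
    unfolding spec_def by blast
  then have "inverse x = Fract b a" "inverse v = poly_eval \<sigma> b / poly_eval \<sigma> a" "poly_eval \<sigma> a \<noteq> 0" by auto
  then show ?thesis unfolding spec_def by blast
qed

lemma spec_divide: "spec \<sigma> x v \<Longrightarrow> spec \<sigma> y w \<Longrightarrow> w \<noteq> 0 \<Longrightarrow> spec \<sigma> (x / y) (v / w)"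
  by (simp add: divide_inverse spec_mult spec_inverse)

lemma spec_power: "spec \<sigma> x v \<Longrightarrow> spec \<sigma> (x ^ k) (v ^ k)"
  by (induction k) (auto intro: spec_1 spec_mult)

lemma spec_powi: "spec \<sigma> x v \<Longrightarrow> v \<noteq> 0 \<Longrightarrow> spec \<sigma> (x powi k) (v powi k)"
  unfolding power_int_def by (auto intro: spec_power spec_inverse)

lemma spec_sum: "(\<And>i. i \<in> I \<Longrightarrow> spec \<sigma> (h i) (h' i)) \<Longrightarrow> spec \<sigma> (sum h I) (sum h' I)"
  by (induction I rule: infinite_finite_induct) (auto intro: spec_0 spec_add)

lemma spec_prod: "(\<And>i. i \<in> I \<Longrightarrow> spec \<sigma> (h i) (h' i)) \<Longrightarrow> spec \<sigma> (prod h I) (prod h' I)"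
  by (induction I rule: infinite_finite_induct) (auto intro: spec_1 spec_mult)

lemma spec_qpoch: "spec \<sigma> a a' \<Longrightarrow> spec \<sigma> b b' \<Longrightarrow> spec \<sigma> (qpoch a b m) (qpoch a' b' m)"
  unfolding qpoch_def by (intro spec_prod spec_diff spec_1 spec_mult spec_power)

end

lemma qpoch_nonzero: "(\<And>i. i < m \<Longrightarrow> a * b ^ i \<noteq> 1) \<Longrightarrow> qpoch a b m \<noteq> (0 :: 'a::field)"
  unfolding qpoch_def by (subst prod_zero_iff) (auto simp: eq_commute[of 1])

lemma spec_cc:
  assumes q: "spec \<sigma> Q q0" and t: "spec \<sigma> T t0"
  shows "n \<le> N \<Longrightarrow> (\<And>i. 1 \<le> i \<Longrightarrow> i \<le> n \<Longrightarrow> spec \<sigma> (S i) (t0 ^ (N - i) * q0 ^ e i))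
    \<Longrightarrow> spec \<sigma> (cc n \<theta> S Q T) (cc n \<theta> (\<lambda>i. t0 ^ (N - i) * q0 ^ e i) q0 t0)"
proof (induction n arbitrary: S e rule: less_induct)
  case (less n)
  let ?s = "\<lambda>i. t0 ^ (N - i) * q0 ^ e i"
  consider "n = 0" | "n = 1" | r where "n = Suc (Suc r)"
    by (metis One_nat_def not0_implies_Suc)
  then show ?case
  proof cases
    case 3
    have s0: "?s i \<noteq> 0" for i by simp
    have IH: "spec \<sigma> (cc (Suc r) \<theta> (\<lambda>i. Q ^ \<theta> i n * S i) Q T)
        (cc (Suc r) \<theta> (\<lambda>i. q0 ^ \<theta> i n * ?s i) q0 t0)"
    proof -
      have eq: "(\<lambda>i. q0 ^ \<theta> i n * ?s i) = (\<lambda>i. t0 ^ (N - i) * q0 ^ (\<theta> i n + e i))"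
        by (simp add: power_add mult_ac)
      show ?thesis unfolding eq
      proof (rule less.IH)
        fix i assume "1 \<le> i" "i \<le> Suc r"
        then have "spec \<sigma> (Q ^ \<theta> i n * S i) (q0 ^ \<theta> i n * ?s i)"
          using less.prems 3 by (intro spec_mult spec_power q) auto
        then show "spec \<sigma> (Q ^ \<theta> i n * S i) (t0 ^ (N - i) * q0 ^ (\<theta> i n + e i))"
          by (simp add: power_add mult_ac)
      qed (use 3 less.prems in auto)
    qed
    have ne: "q0 ^ a * ?s l \<noteq> q0 ^ b * ?s m" if "l < m" "m \<le> n" for a b l m
    proof -
      have "N - l \<noteq> N - m" using that less.prems(1) by auto
      then have "t0 ^ (N - l) * q0 ^ (a + e l) \<noteq> t0 ^ (N - m) * q0 ^ (b + e m)"
        by (simp add: qt_power_eq_iff)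
      then show ?thesis by (simp add: power_add mult_ac)
    qed
    have ne1: "q0 * ?s l / ?s m * q0 ^ i \<noteq> 1" if "l < m" "m \<le> n" for l m i
    proof
      assume "q0 * ?s l / ?s m * q0 ^ i = 1"
      then have "q0 ^ Suc i * ?s l = q0 ^ 0 * ?s m" using s0[of m] by (simp add: field_simps)
      then show False using ne[OF that] by blast
    qed
    have ne2: "q0 powi (- int k) * ?s l / ?s m * q0 ^ i \<noteq> 1" if "l < m" "m \<le> n" for l m i k
    proof
      assume "q0 powi (- int k) * ?s l / ?s m * q0 ^ i = 1"
      then have "q0 ^ i * ?s l = q0 ^ k * ?s m" using s0[of m]
        by (simp add: field_simps power_int_minus)
      then show False using ne[OF that] by blast
    qed
    have ne3: "q0 * q0 ^ i \<noteq> 1" for i using q0_power_eq_1_iff[of "Suc i"] by simp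
    have S: "spec \<sigma> (S i) (?s i)" if "1 \<le> i" "i \<le> n" for i using less.prems that by blast
    have qp: "qpoch a q0 k \<noteq> 0" if "\<And>i. a * q0 ^ i \<noteq> 1" for a k using that by (intro qpoch_nonzero)
    have A: "spec \<sigma>
        (\<Prod>k = 1..n - 1. T ^ \<theta> k n * (qpoch (Q / T) Q (\<theta> k n) / qpoch Q Q (\<theta> k n))
          * (qpoch (Q / T * S k / S n) Q (\<theta> k n) / qpoch (Q * S k / S n) Q (\<theta> k n)))
        (\<Prod>k = 1..n - 1. t0 ^ \<theta> k n * (qpoch (q0 / t0) q0 (\<theta> k n) / qpoch q0 q0 (\<theta> k n))
          * (qpoch (q0 / t0 * ?s k / ?s n) q0 (\<theta> k n) / qpoch (q0 * ?s k / ?s n) q0 (\<theta> k n)))"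
      using 3 by (intro spec_prod spec_mult spec_power spec_divide spec_qpoch q t S s0 t0_nonzero qp ne1 ne3) auto
    have B: "spec \<sigma>
        (\<Prod>(l, m) \<in> pairs (n - 1).
          (qpoch (Q / T * S l / S m) Q (\<theta> l n) / qpoch (Q * S l / S m) Q (\<theta> l n))
          * (qpoch (Q powi (- int (\<theta> m n)) * T * S l / S m) Q (\<theta> l n)
             / qpoch (Q powi (- int (\<theta> m n)) * S l / S m) Q (\<theta> l n)))
        (\<Prod>(l, m) \<in> pairs (n - 1).
          (qpoch (q0 / t0 * ?s l / ?s m) q0 (\<theta> l n) / qpoch (q0 * ?s l / ?s m) q0 (\<theta> l n))
          * (qpoch (q0 powi (- int (\<theta> m n)) * t0 * ?s l / ?s m) q0 (\<theta> l n)
             / qpoch (q0 powi (- int (\<theta> m n)) * ?s l / ?s m) q0 (\<theta> l n)))"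
      unfolding case_prod_unfold
      by (intro spec_prod spec_mult spec_power spec_divide spec_qpoch spec_powi q t S s0 t0_nonzero q0_nonzero qp ne1 ne2)
        (auto simp: pairs_def)
    show ?thesis
      using spec_mult[OF spec_mult[OF IH A] B]
      unfolding 3 cc.simps Let_def .
  qed (auto intro: spec_1)
qed

definition specM :: "(nat \<Rightarrow> Qqt) \<Rightarrow> ('v, Qqts) mfps \<Rightarrow> ('v, Qqt) mfps \<Rightarrow> bool" where
  "specM \<sigma> F G \<longleftrightarrow> (\<forall>M. spec \<sigma> (mfps_nth F M) (mfps_nth G M))"

lemma specM_unique: "specM \<sigma> F G \<Longrightarrow> specM \<sigma> F H \<Longrightarrow> G = H"
  unfolding specM_def by (metis mfps_eqI spec_unique)

lemma specM_mono: "specM \<sigma> (mfps_mono A) (mfps_mono A)"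
  by (simp add: specM_def spec_0 spec_1)

lemma specM_const: "spec \<sigma> c d \<Longrightarrow> specM \<sigma> (mfps_const c) (mfps_const d)"
  by (simp add: specM_def spec_0)

lemma specM_1: "specM \<sigma> 1 1"
  by (simp add: specM_def spec_0 spec_1)

lemma specM_add: "specM \<sigma> F F' \<Longrightarrow> specM \<sigma> G G' \<Longrightarrow> specM \<sigma> (F + G) (F' + G')"
  by (simp add: specM_def spec_add)

lemma specM_diff: "specM \<sigma> F F' \<Longrightarrow> specM \<sigma> G G' \<Longrightarrow> specM \<sigma> (F - G) (F' - G')"
  by (simp add: specM_def spec_diff)

lemma specM_mult: "specM \<sigma> F F' \<Longrightarrow> specM \<sigma> G G' \<Longrightarrow> specM \<sigma> (F * G) (F' * G')"
  unfolding specM_def mfps_nth_mult by (intro allI spec_sum spec_mult) auto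

lemma specM_prod: "(\<And>i. i \<in> I \<Longrightarrow> specM \<sigma> (h i) (h' i)) \<Longrightarrow> specM \<sigma> (prod h I) (prod h' I)"
  by (induction I rule: infinite_finite_induct) (auto intro: specM_1 specM_mult)

lemma specM_sum: "(\<And>i. i \<in> I \<Longrightarrow> specM \<sigma> (h i) (h' i)) \<Longrightarrow> specM \<sigma> (sum h I) (sum h' I)"
  unfolding specM_def mfps_nth_sum by (intro allI spec_sum) auto

lemma specM_power: "specM \<sigma> F F' \<Longrightarrow> specM \<sigma> (F ^ k) (F' ^ k)"
  by (induction k) (auto intro: specM_1 specM_mult)

lemma specM_geo:
  fixes F :: "('v, Qqts) mfps"
  assumes "specM \<sigma> F F'" "mfps_nth F {#} = 0" "mfps_nth F' {#} = 0"
  shows "specM \<sigma> (mfps_geo F) (mfps_geo F')"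
  unfolding specM_def
proof
  fix M :: "'v multiset"
  have "specM \<sigma> (\<Sum>k\<le>size M. F ^ k) (\<Sum>k\<le>size M. F' ^ k)"
    by (intro specM_sum specM_power assms)
  then show "spec \<sigma> (mfps_nth (mfps_geo F) M) (mfps_nth (mfps_geo F') M)"
    unfolding mfps_nth_geo[OF assms(2) order_refl] mfps_nth_geo[OF assms(3) order_refl]
    by (simp add: specM_def)
qed

lemma nth_0_xratio: "i < j \<Longrightarrow> mfps_nth (xratio i j) {#} = 0"
  using finite_atLeastLessThan[of i j] by (auto simp: xratio_mono mset_set_empty_iff)

lemma specM_ratfac:
  assumes "spec \<sigma> a a'" "spec \<sigma> b b'" "i < j"
  shows "specM \<sigma> (ratfac a b (xratio i j)) (ratfac a' b' (xratio i j))"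
  unfolding ratfac_eq_geo[OF nth_0_xratio[OF assms(3)]]
  using assms
  by (intro specM_add specM_mult specM_diff specM_geo specM_1 specM_const spec_diff spec_1)
    (auto simp: xratio_mono specM_mono nth_0_xratio mset_set_empty_iff)

lemma specM_Tshift:
  assumes "spec \<sigma> p p'" "p' \<noteq> 0" "specM \<sigma> F F'"
  shows "specM \<sigma> (Tshift p i F) (Tshift p' i F')"
  using assms unfolding specM_def Tshift_def mfps_nth_Abs_mfps
  by (intro allI spec_mult spec_powi) auto

lemma specM_D1:
  assumes "\<And>i. spec \<sigma> (S i) (S' i)" "spec \<sigma> Q q0" "spec \<sigma> T t0" "specM \<sigma> F F'"
  shows "specM \<sigma> (D1 n S Q T F) (D1 n S' q0 t0 F')"
  unfolding D1_def
  by (intro specM_sum specM_mult specM_const specM_prod specM_ratfac specM_Tshift spec_inverse assms)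
    auto

lemma specM_fser:
  assumes "spec \<sigma> Q q0" "spec \<sigma> T t0"
    "\<And>i. 1 \<le> i \<Longrightarrow> i \<le> n \<Longrightarrow> spec \<sigma> (S i) (t0 ^ (n - i) * q0 ^ e i)"
  shows "specM \<sigma> (fser n S Q T) (fser n (\<lambda>i. t0 ^ (n - i) * q0 ^ e i) q0 t0)"
proof -
  have nth: "mfps_nth (mfps_sum (\<lambda>\<theta>. mfps_const (c \<theta>) * mfps_mono (root_mon n \<theta>)) (Mats n)) M
      = (\<Sum>\<theta> | \<theta> \<in> Mats n \<and> root_mon n \<theta> = M. c \<theta>)" for c :: "_ \<Rightarrow> 'b::comm_ring_1" and M
    by (subst mfps_nth_mfps_sum[where J="{\<theta>\<in>Mats n. root_mon n \<theta> = M}"]) (auto simp: finite_fibre_root)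
  have "specM \<sigma> (mfps_sum (\<lambda>\<theta>. mfps_const (cc n \<theta> S Q T) * mfps_mono (root_mon n \<theta>)) (Mats n))
     (mfps_sum (\<lambda>\<theta>. mfps_const (cc n \<theta> (\<lambda>i. t0 ^ (n - i) * q0 ^ e i) q0 t0) * mfps_mono (root_mon n \<theta>)) (Mats n))"
    unfolding specM_def nth
    by (intro allI spec_sum spec_cc assms) auto
  moreover have "specM \<sigma> (\<Prod>(k, l)\<in>pairs n. 1 - xratio k l) (\<Prod>(k, l)\<in>pairs n. 1 - xratio k l)"
    unfolding xratio_mono case_prod_unfold by (intro specM_prod specM_diff specM_1 specM_mono)
  ultimately show ?thesis
    unfolding fser_def root_mon using specM_mult by blast
qed

lemma eigen_specialized:
  fixes lam :: "nat \<Rightarrow> nat"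
  assumes "D1 n sv (to_Qqts q0) (to_Qqts t0) (fser n sv (to_Qqts q0) (to_Qqts t0))
      = mfps_const (\<Sum>i = 1..n. sv i) * fser n sv (to_Qqts q0) (to_Qqts t0)"
  defines "s \<equiv> \<lambda>i. t0 ^ (n - i) * q0 ^ lam i"
  shows "D1 n s q0 t0 (fser n s q0 t0) = mfps_const (\<Sum>i = 1..n. s i) * fser n s q0 t0"
proof -
  have sv: "spec s (sv i) (s i)" for i by (rule spec_var)
  have F: "specM s (fser n sv (to_Qqts q0) (to_Qqts t0)) (fser n s q0 t0)"
    unfolding s_def
  proof (rule specM_fser)
    show "spec (\<lambda>i. t0 ^ (n - i) * q0 ^ lam i) (sv i) (t0 ^ (n - i) * q0 ^ lam i)" for i
      using sv[of i] by (simp only: s_def)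
  qed (rule spec_const)+
  have "specM s (D1 n sv (to_Qqts q0) (to_Qqts t0) (fser n sv (to_Qqts q0) (to_Qqts t0)))
      (D1 n s q0 t0 (fser n s q0 t0))"
    by (intro specM_D1 spec_const F sv)
  moreover have "specM s (mfps_const (\<Sum>i = 1..n. sv i) * fser n sv (to_Qqts q0) (to_Qqts t0))
      (mfps_const (\<Sum>i = 1..n. s i) * fser n s q0 t0)"
    by (intro specM_mult specM_const spec_sum F sv)
  ultimately show ?thesis unfolding assms(1) by (rule specM_unique)
qed

section \<open>Partial fractions and the adjoint of \<open>D\<^sup>1\<close>\<close>

definition residue_coeff :: "'a::comm_ring_1 \<Rightarrow> 'a \<Rightarrow> (nat \<Rightarrow> nat \<Rightarrow> 'a) \<Rightarrow> (nat \<Rightarrow> nat \<Rightarrow> 'a) \<Rightarrow> nat \<Rightarrow> nat \<Rightarrow> 'a" where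
  "residue_coeff t \<tau> x u n i = (1 - \<tau>) * \<tau> ^ (i - 1)
     * (\<Prod>j=1..<i. (1 - t * x j i) * u j i) * (\<Prod>k=i+1..n. (1 - \<tau> * x i k) * u i k)"

text \<open>
  Partial fractions for \<open>\<Prod>\<^sub>j (a\<^sub>j - \<tau> b\<^sub>j) / (a\<^sub>j - b\<^sub>j)\<close>, homogenized so that the induction may
  evaluate at the last pole: \<open>a\<^sub>j : b\<^sub>j\<close> stands for \<open>z : y\<^sub>j\<close>, and \<open>x\<^sub>i\<^sub>j\<close> for \<open>y\<^sub>j / y\<^sub>i\<close>.
\<close>
lemma partial_fractions:
  fixes t \<tau> :: "'a::comm_ring_1"
  assumes t: "t * \<tau> = 1"
    and x: "\<And>i j k. 1 \<le> i \<Longrightarrow> i < j \<Longrightarrow> j < k \<Longrightarrow> k \<le> n \<Longrightarrow> x i k = x i j * x j k"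
    and u: "\<And>i j. 1 \<le> i \<Longrightarrow> i < j \<Longrightarrow> j \<le> n \<Longrightarrow> (1 - x i j) * u i j = 1"
    and e: "\<And>i. 1 \<le> i \<Longrightarrow> i \<le> n \<Longrightarrow> (a i - b i) * e i = 1"
    and ab: "\<And>i j. 1 \<le> i \<Longrightarrow> i < j \<Longrightarrow> j \<le> n \<Longrightarrow> b j * a i = x i j * b i * a j"
  shows "(\<Prod>j=1..n. (a j - \<tau> * b j) * e j) = \<tau> ^ n + (\<Sum>i=1..n. residue_coeff t \<tau> x u n i * (a i * e i))"
  using x u e ab
proof (induction n arbitrary: a b e)
  case (Suc n)
  let ?N = "Suc n"
  let ?A = "residue_coeff t \<tau> x u"
  have A_step: "?A ?N i = ?A n i * ((1 - \<tau> * x i ?N) * u i ?N)" if "i \<in> {1..n}" for i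
  proof -
    have "{i + 1..?N} = insert ?N {i + 1..n}" using that by auto
    then show ?thesis by (simp add: residue_coeff_def mult_ac)
  qed
  have IH: "(\<Prod>j=1..n. (a j - \<tau> * b j) * e j) = \<tau> ^ n + (\<Sum>i=1..n. ?A n i * (a i * e i))"
    using Suc.prems by (intro Suc.IH) auto
  have IH': "(\<Prod>j=1..n. (x j ?N - \<tau> * 1) * - u j ?N) = \<tau> ^ n + (\<Sum>i=1..n. ?A n i * (x i ?N * - u i ?N))"
  proof (rule Suc.IH)
    fix i assume "1 \<le> i" "i \<le> n"
    then show "(x i ?N - 1) * - u i ?N = 1"
      using Suc.prems(2)[of i ?N] by (simp add: algebra_simps)
  next
    fix i j assume "1 \<le> i" "i < j" "j \<le> n"
    then show "1 * x i ?N = x i j * 1 * x j ?N" using Suc.prems(1)[of i j ?N] by simp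
  qed (use Suc.prems in auto)
  have "(x j ?N - \<tau> * 1) * - u j ?N = \<tau> * ((1 - t * x j ?N) * u j ?N)" for j
  proof -
    have "\<tau> * ((1 - t * x j ?N) * u j ?N) = (\<tau> - (t * \<tau>) * x j ?N) * u j ?N"
      by (simp add: algebra_simps)
    then show ?thesis unfolding t by (simp add: algebra_simps)
  qed
  then have prodN: "(\<Prod>j=1..n. (x j ?N - \<tau> * 1) * - u j ?N) = \<tau> ^ n * (\<Prod>j=1..n. (1 - t * x j ?N) * u j ?N)"
    by (simp add: prod.distrib)
  have AN: "?A ?N ?N = (1 - \<tau>) * (\<tau> ^ n + (\<Sum>i=1..n. ?A n i * (x i ?N * - u i ?N)))"
    unfolding IH'[symmetric] prodN by (simp add: residue_coeff_def atLeastLessThanSuc_atLeastAtMost mult_ac)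
  have split: "a i * e i * ((a ?N - \<tau> * b ?N) * e ?N)
      = (1 - \<tau> * x i ?N) * u i ?N * (a i * e i) + (1 - \<tau>) * (x i ?N * - u i ?N) * (a ?N * e ?N)"
    if i: "i \<in> {1..n}" for i
  proof -
    define X where "X = x i ?N"
    define W where "W = u i ?N"
    have 1: "(1 - X) * W = 1" "(a i - b i) * e i = 1" "(a ?N - b ?N) * e ?N = 1"
      using Suc.prems(2,3) i by (auto simp: X_def W_def)
    have rel: "b ?N * a i = X * b i * a ?N" using Suc.prems(4)[of i ?N] i by (simp add: X_def)
    have "a i * (a ?N - \<tau> * b ?N) * (1 - X)
        = a i * a ?N - X * a i * a ?N - \<tau> * (b ?N * a i) + \<tau> * X * (b ?N * a i)"
      by (simp add: algebra_simps)
    also have "\<dots> = (1 - \<tau> * X) * a i * (a ?N - b ?N) - (1 - \<tau>) * X * a ?N * (a i - b i)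
        + (1 - \<tau>) * (b ?N * a i - X * b i * a ?N)"
      by (simp add: algebra_simps)
    finally have poly: "a i * (a ?N - \<tau> * b ?N) * (1 - X)
        = (1 - \<tau> * X) * a i * (a ?N - b ?N) - (1 - \<tau>) * X * a ?N * (a i - b i)"
      by (simp add: rel)
    have "a i * e i * ((a ?N - \<tau> * b ?N) * e ?N)
        = ((1 - X) * W) * (a i * e i * ((a ?N - \<tau> * b ?N) * e ?N))" by (simp add: 1)
    also have "\<dots> = (a i * (a ?N - \<tau> * b ?N) * (1 - X)) * (W * e i * e ?N)" by (simp add: mult_ac)
    also have "\<dots> = (1 - \<tau> * X) * W * (a i * e i) * ((a ?N - b ?N) * e ?N)
        - (1 - \<tau>) * X * W * (a ?N * e ?N) * ((a i - b i) * e i)"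
      unfolding poly by (simp add: algebra_simps)
    finally have "a i * e i * ((a ?N - \<tau> * b ?N) * e ?N)
        = (1 - \<tau> * X) * W * (a i * e i) - (1 - \<tau>) * X * W * (a ?N * e ?N)"
      unfolding 1 mult_1_right .
    then show ?thesis by (simp add: X_def W_def mult_ac)
  qed
  have eN: "(a ?N - \<tau> * b ?N) * e ?N = \<tau> + (1 - \<tau>) * (a ?N * e ?N)"
  proof -
    have "(a ?N - \<tau> * b ?N) * e ?N = \<tau> * ((a ?N - b ?N) * e ?N) + (1 - \<tau>) * (a ?N * e ?N)"
      by (simp add: algebra_simps)
    then show ?thesis using Suc.prems(3)[of ?N] by simp
  qed
  have "(\<Prod>j=1..?N. (a j - \<tau> * b j) * e j)
      = \<tau> ^ n * ((a ?N - \<tau> * b ?N) * e ?N)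
        + (\<Sum>i=1..n. ?A n i * (a i * e i * ((a ?N - \<tau> * b ?N) * e ?N)))"
  proof -
    have "(\<Prod>j=1..?N. (a j - \<tau> * b j) * e j) = (\<Prod>j=1..n. (a j - \<tau> * b j) * e j) * ((a ?N - \<tau> * b ?N) * e ?N)"
      by simp
    then show ?thesis unfolding IH distrib_right sum_distrib_right by (simp only: mult.assoc)
  qed
  also have "(\<Sum>i=1..n. ?A n i * (a i * e i * ((a ?N - \<tau> * b ?N) * e ?N)))
      = (\<Sum>i=1..n. ?A ?N i * (a i * e i) + (1 - \<tau>) * (?A n i * (x i ?N * - u i ?N)) * (a ?N * e ?N))"
    by (intro sum.cong refl) (simp only: split A_step, simp add: algebra_simps)
  also have "\<dots> = (\<Sum>i=1..n. ?A ?N i * (a i * e i))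
      + (1 - \<tau>) * (\<Sum>i=1..n. ?A n i * (x i ?N * - u i ?N)) * (a ?N * e ?N)"
    by (simp only: sum.distrib sum_distrib_left sum_distrib_right)
  also have "\<tau> ^ n * ((a ?N - \<tau> * b ?N) * e ?N) = \<tau> ^ ?N + (1 - \<tau>) * \<tau> ^ n * (a ?N * e ?N)"
    unfolding eN by (simp add: algebra_simps)
  finally show ?case
    unfolding sum.atLeast_Suc_atMost_Suc_shift[symmetric] by (simp add: AN distrib_left distrib_right add_ac)
qed simp

lemma residue_coeff_sum:
  fixes t \<tau> :: "'a::comm_ring_1"
  assumes "t * \<tau> = 1"
    and "\<And>i j k. 1 \<le> i \<Longrightarrow> i < j \<Longrightarrow> j < k \<Longrightarrow> k \<le> n \<Longrightarrow> x i k = x i j * x j k"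
    and "\<And>i j. 1 \<le> i \<Longrightarrow> i < j \<Longrightarrow> j \<le> n \<Longrightarrow> (1 - x i j) * u i j = 1"
  shows "(\<Sum>i=1..n. residue_coeff t \<tau> x u n i) = 1 - \<tau> ^ n"
proof -
  have "(\<Prod>j=1..n. (1 - \<tau> * 0) * 1) = \<tau> ^ n + (\<Sum>i=1..n. residue_coeff t \<tau> x u n i * (1 * 1))"
    by (rule partial_fractions) (use assms in auto)
  then show ?thesis by (simp add: algebra_simps)
qed

text \<open>
  Since the right-hand side is symmetric in the two sets of variables, the operators in \<open>y\<close> and
  in \<open>w\<close> act alike on the kernel, for arbitrary numbers \<open>n\<close> and \<open>m\<close> of variables.
\<close>
lemma kernel_symmetric:
  fixes t \<tau> :: "'a::comm_ring_1"
  assumes t: "t * \<tau> = 1"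
    and x: "\<And>i j k. 1 \<le> i \<Longrightarrow> i < j \<Longrightarrow> j < k \<Longrightarrow> k \<le> n \<Longrightarrow> x i k = x i j * x j k"
    and u: "\<And>i j. 1 \<le> i \<Longrightarrow> i < j \<Longrightarrow> j \<le> n \<Longrightarrow> (1 - x i j) * u i j = 1"
    and x': "\<And>i j k. 1 \<le> i \<Longrightarrow> i < j \<Longrightarrow> j < k \<Longrightarrow> k \<le> m \<Longrightarrow> x' i k = x' i j * x' j k"
    and u': "\<And>i j. 1 \<le> i \<Longrightarrow> i < j \<Longrightarrow> j \<le> m \<Longrightarrow> (1 - x' i j) * u' i j = 1"
    and w: "\<And>i j. 1 \<le> i \<Longrightarrow> i < j \<Longrightarrow> j \<le> m \<Longrightarrow> w j = x' i j * w i"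
    and g: "\<And>i j. i \<in> {1..n} \<Longrightarrow> j \<in> {1..m} \<Longrightarrow> (1 - t * (y i * w j)) * g i j = 1"
  shows "(\<Sum>i=1..n. residue_coeff t \<tau> x u n i * (\<Prod>j=1..m. (1 - y i * w j) * g i j)) + \<tau> ^ n
    = \<tau> ^ m + \<tau> ^ n - \<tau> ^ m * \<tau> ^ n
      + (\<Sum>i=1..n. \<Sum>j=1..m. residue_coeff t \<tau> x u n i * residue_coeff t \<tau> x' u' m j * g i j)"
proof -
  have U: "(\<Prod>j=1..m. (1 - y i * w j) * g i j) = \<tau> ^ m + (\<Sum>j=1..m. residue_coeff t \<tau> x' u' m j * g i j)"
    if i: "i \<in> {1..n}" for i
  proof -
    have "(\<Prod>j=1..m. (1 - \<tau> * (t * (y i * w j))) * g i j)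
        = \<tau> ^ m + (\<Sum>j=1..m. residue_coeff t \<tau> x' u' m j * (1 * g i j))"
    proof (rule partial_fractions[OF t x' u'])
      fix j k assume "1 \<le> j" "j < k" "k \<le> m"
      then show "t * (y i * w k) * 1 = x' j k * (t * (y i * w j)) * 1"
        using w[of j k] by (simp add: mult_ac)
    qed (use i g in auto)
    moreover have "\<tau> * (t * z) = z" for z using t by (metis mult.assoc mult.commute mult_1_left)
    ultimately show ?thesis by simp
  qed
  have "(\<Sum>i=1..n. residue_coeff t \<tau> x u n i * (\<Prod>j=1..m. (1 - y i * w j) * g i j))
      = (\<Sum>i=1..n. residue_coeff t \<tau> x u n i * \<tau> ^ m
          + (\<Sum>j=1..m. residue_coeff t \<tau> x u n i * residue_coeff t \<tau> x' u' m j * g i j))"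
    by (intro sum.cong refl) (simp only: U distrib_left sum_distrib_left mult.assoc)
  also have "\<dots> = (\<Sum>i=1..n. residue_coeff t \<tau> x u n i) * \<tau> ^ m
      + (\<Sum>i=1..n. \<Sum>j=1..m. residue_coeff t \<tau> x u n i * residue_coeff t \<tau> x' u' m j * g i j)"
    by (simp only: sum.distrib sum_distrib_right)
  also have "(\<Sum>i=1..n. residue_coeff t \<tau> x u n i) = 1 - \<tau> ^ n"
    by (rule residue_coeff_sum[OF t x u])
  finally show ?thesis by (simp add: algebra_simps)
qed

lemma Tshift_scale: "Tshift p i F = mfps_scale (\<lambda>M. p powi (int (count M (i - 1)) - int (count M i))) F"
  by (rule mfps_eqI) (simp add: Tshift_def)

lemma powi_count_add:
  "p \<noteq> 0 \<Longrightarrow> p powi (int (count (A + B) k) - int (count (A + B) l))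
    = p powi (int (count A k) - int (count A l)) * p powi (int (count B k) - int (count B l))" for p :: "'a::field"
  by (simp add: power_int_add[symmetric] algebra_simps)

lemma Tshift_mult: "p \<noteq> 0 \<Longrightarrow> Tshift p i (F * G) = Tshift p i F * Tshift p i G"
  unfolding Tshift_scale by (rule mfps_scale_mult) (rule powi_count_add)

lemma Tshift_prod: "p \<noteq> 0 \<Longrightarrow> Tshift p i (\<Prod>j\<in>I. h j) = (\<Prod>j\<in>I. Tshift p i (h j))"
  unfolding Tshift_scale by (rule mfps_scale_prod) (rule powi_count_add, simp_all)

lemma Tshift_ratfac:
  assumes p: "p \<noteq> 0" and A: "A \<noteq> {#}"
  shows "Tshift p i (ratfac a 1 (mfps_mono A))
    = ratfac a (p powi (int (count A (i - 1)) - int (count A i))) (mfps_mono A)"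
proof -
  let ?\<chi> = "\<lambda>M. p powi (int (count M (i - 1)) - int (count M i))"
  have nth: "mfps_nth (mfps_mono A) {#} = 0" using A by simp
  have "mfps_scale ?\<chi> (mfps_geo (mfps_mono A)) = mfps_geo (mfps_const (?\<chi> A) * mfps_mono A)"
    unfolding mfps_scale_mono[of ?\<chi> A, symmetric]
    by (rule mfps_scale_mfps_geo[OF powi_count_add[OF p] _ nth]) simp
  then show ?thesis
    unfolding Tshift_scale ratfac_eq_geo[OF nth]
    by (simp add: mfps_scale_add mfps_scale_diff mfps_scale_1 mfps_scale_const del: One_nat_def
        add: mfps_scale_mult[where \<chi>="?\<chi>", OF powi_count_add[OF p]] mfps_const_simps(2))
qed

lemma ratfac_geo:
  "mfps_nth x {#} = 0 \<Longrightarrow> ratfac a 1 x = (1 - mfps_const a * x) * mfps_geo x"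
proof -
  assume x: "mfps_nth x {#} = 0"
  have "ratfac a 1 x = ((1 - x) * mfps_geo x) * ratfac a 1 x" by (simp add: mfps_geo_mult[OF x])
  also have "\<dots> = ((1 - mfps_const 1 * x) * ratfac a 1 x) * mfps_geo x"
    by (simp add: mfps_const_simps(2) mult_ac)
  also have "\<dots> = (1 - mfps_const a * x) * mfps_geo x" unfolding ratfac_mult[OF x] by simp
  finally show ?thesis .
qed

definition Bcoef :: "nat \<Rightarrow> nat \<Rightarrow> (nat, Qqt) mfps" where
  "Bcoef n i = (\<Prod>j = 1..<i. ratfac t0 1 (xratio j i)) * (\<Prod>k = i+1..n. ratfac (inverse t0) 1 (xratio i k))"

lemma Tshift_Bcoef:
  assumes "i \<ge> 1"
  shows "Tshift (inverse q0) i (Bcoef n i)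
    = (\<Prod>j = 1..<i. ratfac t0 (inverse q0) (xratio j i)) * (\<Prod>k = i+1..n. ratfac (inverse t0) q0 (xratio i k))"
proof -
  have p: "inverse q0 \<noteq> 0" by simp
  have 1: "Tshift (inverse q0) i (ratfac t0 1 (xratio j i)) = ratfac t0 (inverse q0) (xratio j i)"
    if "j \<in> {1..<i}" for j
  proof -
    have "mset_set {j..<i} \<noteq> {#}" using that by (simp add: mset_set_empty_iff)
    moreover have "i - 1 \<in> {j..<i}" "i \<notin> {j..<i}" using that by auto
    then have "int (count (mset_set {j..<i}) (i - 1)) - int (count (mset_set {j..<i}) i) = 1" by simp
    ultimately show ?thesis unfolding xratio_mono by (subst Tshift_ratfac[OF p]) auto
  qed
  have 2: "Tshift (inverse q0) i (ratfac (inverse t0) 1 (xratio i k)) = ratfac (inverse t0) q0 (xratio i k)"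
    if "k \<in> {i+1..n}" for k
  proof -
    have "mset_set {i..<k} \<noteq> {#}" using that by (simp add: mset_set_empty_iff)
    moreover have "i - 1 \<notin> {i..<k}" "i \<in> {i..<k}" using that assms by auto
    then have "int (count (mset_set {i..<k}) (i - 1)) - int (count (mset_set {i..<k}) i) = - 1" by simp
    ultimately show ?thesis unfolding xratio_mono by (subst Tshift_ratfac[OF p]) (auto simp: power_int_minus)
  qed
  show ?thesis unfolding Bcoef_def Tshift_mult[OF p] Tshift_prod[OF p]
    using 1 2 by (intro arg_cong2[where f="(*)"] prod.cong) auto
qed

lemma Bcoef_residue:
  assumes "i \<in> {1..n}"
  shows "mfps_const ((t0 - 1) * inverse t0 ^ i) * Bcoef n i
    = residue_coeff (mfps_const t0) (mfps_const (inverse t0)) xratio (\<lambda>i j. mfps_geo (xratio i j)) n i"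
proof -
  have "(t0 - 1) * inverse t0 ^ i = (1 - inverse t0) * inverse t0 ^ (i - 1)"
  proof -
    have "i = Suc (i - 1)" using assms by auto
    then have "inverse t0 ^ i = inverse t0 * inverse t0 ^ (i - 1)" by (metis power_Suc)
    then show ?thesis by (simp add: algebra_simps)
  qed
  moreover have "(\<Prod>j = 1..<i. ratfac t0 1 (xratio j i)) = (\<Prod>j=1..<i. (1 - mfps_const t0 * xratio j i) * mfps_geo (xratio j i))"
    by (intro prod.cong refl ratfac_geo nth_0_xratio) auto
  moreover have "(\<Prod>k = i+1..n. ratfac (inverse t0) 1 (xratio i k)) = (\<Prod>k=i+1..n. (1 - mfps_const (inverse t0) * xratio i k) * mfps_geo (xratio i k))"
    by (intro prod.cong refl ratfac_geo nth_0_xratio) auto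
  ultimately show ?thesis
    unfolding Bcoef_def residue_coeff_def
    by (simp add: mfps_const_simps mfps_const_power mult_ac)
qed

lemma xratio_mult: "i \<le> j \<Longrightarrow> j \<le> k \<Longrightarrow> xratio i k = xratio i j * xratio j k"
  unfolding xratio_def by (simp add: prod.atLeastLessThan_concat)

locale eigen_side = mono_emb \<psi> for \<psi> :: "nat multiset \<Rightarrow> 'w multiset" +
  fixes n :: nat and lam :: "nat \<Rightarrow> nat" and \<chi> :: "nat \<Rightarrow> 'w multiset \<Rightarrow> Qqt" and \<Theta> :: "'w multiset"
    and f :: "(nat, Qqt) mfps" and h K :: "('w, Qqt) mfps" and U :: "nat \<Rightarrow> ('w, Qqt) mfps"
  assumes eigen: "D1 n (\<lambda>i. t0 ^ (n - i) * q0 ^ lam i) q0 t0 f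
      = mfps_const (\<Sum>i = 1..n. t0 ^ (n - i) * q0 ^ lam i) * f"
    and \<chi>_add: "\<And>i A B. \<chi> i (A + B) = \<chi> i A * \<chi> i B"
    and \<chi>_\<psi>: "\<And>i M. i \<in> {1..n} \<Longrightarrow> \<chi> i (\<psi> M) = inverse q0 powi (int (count M (i - 1)) - int (count M i))"
    and \<chi>_\<Theta>: "\<And>i. i \<in> {1..n} \<Longrightarrow> \<chi> i \<Theta> = inverse q0 ^ lam i"
    and h: "\<And>i. i \<in> {1..n} \<Longrightarrow> mfps_scale (\<chi> i) h = h"
    and K: "\<And>i. i \<in> {1..n} \<Longrightarrow> mfps_scale (\<chi> i) (U i * K) = K"
begin

definition eps :: Qqt where
  "eps = (t0 - 1) * (\<Sum>i=1..n. inverse t0 ^ i * q0 ^ lam i) + inverse t0 ^ n"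

lemma scale_push_Tshift:
  "i \<in> {1..n} \<Longrightarrow> mfps_scale (\<chi> i) (mfps_push \<psi> F) = mfps_push \<psi> (Tshift (inverse q0) i F)"
  unfolding scale_push Tshift_scale by (simp add: \<chi>_\<psi>)

text \<open>
  The adjoint of \<open>D1\<close> acts on the kernel \<open>K\<close>: extracting the coefficient at \<open>\<Theta>\<close> intertwines
  the shift operators with the scalars \<open>q\<^sup>-\<^sup>\<lambda>\<^sup>i\<close>.
\<close>
lemma eps_mult:
  "eps * mfps_nth (mfps_push \<psi> f * h * K) \<Theta>
    = mfps_nth (mfps_push \<psi> f * h * K *
        ((\<Sum>i=1..n. mfps_push \<psi> (residue_coeff (mfps_const t0) (mfps_const (inverse t0)) xratio (\<lambda>i j. mfps_geo (xratio i j)) n i) * U i)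
         + mfps_const (inverse t0 ^ n))) \<Theta>"
proof -
  let ?F = "mfps_push \<psi> f * h * K"
  let ?s = "\<lambda>i. t0 ^ (n - i) * q0 ^ lam i"
  let ?B = "\<lambda>i. mfps_push \<psi> (Bcoef n i)"
  have summand: "mfps_nth (mfps_push \<psi> (mfps_const (?s i)
        * (\<Prod>j = 1..<i. ratfac t0 (inverse q0) (xratio j i))
        * (\<Prod>k = i+1..n. ratfac (inverse t0) q0 (xratio i k))
        * Tshift (inverse q0) i f) * h * K) \<Theta>
      = t0 ^ (n - i) * mfps_nth (?F * (?B i * U i)) \<Theta>" if i: "i \<in> {1..n}" for i
  proof -
    have "mfps_push \<psi> (mfps_const (?s i)
        * (\<Prod>j = 1..<i. ratfac t0 (inverse q0) (xratio j i))
        * (\<Prod>k = i+1..n. ratfac (inverse t0) q0 (xratio i k))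
        * Tshift (inverse q0) i f) * h * K
      = mfps_const (?s i) * (mfps_push \<psi> (Tshift (inverse q0) i (Bcoef n i))
        * mfps_push \<psi> (Tshift (inverse q0) i f) * h * K)"
      using i by (simp add: Tshift_Bcoef push_mult mult_ac)
    also have "\<dots> = mfps_const (?s i) * mfps_scale (\<chi> i) (?B i * mfps_push \<psi> f * h * (U i * K))"
    proof -
      have "mfps_scale (\<chi> i) (?B i * mfps_push \<psi> f * h * (U i * K))
          = mfps_scale (\<chi> i) (?B i) * mfps_scale (\<chi> i) (mfps_push \<psi> f) * mfps_scale (\<chi> i) h
            * mfps_scale (\<chi> i) (U i * K)"
        by (simp only: mfps_scale_mult[where \<chi>="\<chi> i", OF \<chi>_add])
      then show ?thesis unfolding scale_push_Tshift[OF i] h[OF i] K[OF i] by simp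
    qed
    also have "mfps_nth \<dots> \<Theta> = ?s i * (inverse q0 ^ lam i * mfps_nth (?B i * mfps_push \<psi> f * h * (U i * K)) \<Theta>)"
      by (simp add: \<chi>_\<Theta>[OF i])
    also have "\<dots> = t0 ^ (n - i) * mfps_nth (?B i * mfps_push \<psi> f * h * (U i * K)) \<Theta>"
      by (simp add: power_inverse)
    finally show ?thesis by (simp add: mult_ac)
  qed
  have "(\<Sum>i=1..n. ?s i) * mfps_nth ?F \<Theta> = mfps_nth (mfps_push \<psi> (mfps_const (\<Sum>i=1..n. ?s i) * f) * h * K) \<Theta>"
    by (simp add: push_mult mult.assoc)
  also have "\<dots> = (\<Sum>i=1..n. t0 ^ (n - i) * mfps_nth (?F * (?B i * U i)) \<Theta>)"
    unfolding eigen[symmetric] D1_def push_sum sum_distrib_right mfps_nth_sum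
    by (rule sum.cong[OF refl summand])
  finally have main: "(\<Sum>i=1..n. ?s i) * mfps_nth ?F \<Theta> = (\<Sum>i=1..n. t0 ^ (n - i) * mfps_nth (?F * (?B i * U i)) \<Theta>)" .
  have tpow: "inverse t0 ^ n * t0 ^ (n - i) = inverse t0 ^ i" if "i \<in> {1..n}" for i
  proof -
    have "inverse t0 ^ n = inverse t0 ^ i * inverse t0 ^ (n - i)"
      using that by (simp flip: power_add)
    then show ?thesis by (simp add: power_inverse)
  qed
  have "(\<Sum>i=1..n. inverse t0 ^ i * q0 ^ lam i) = inverse t0 ^ n * (\<Sum>i=1..n. ?s i)"
    unfolding sum_distrib_left by (intro sum.cong refl) (simp add: mult.assoc[symmetric] tpow)
  then have "eps * mfps_nth ?F \<Theta>
      = (t0 - 1) * (inverse t0 ^ n * ((\<Sum>i=1..n. ?s i) * mfps_nth ?F \<Theta>)) + inverse t0 ^ n * mfps_nth ?F \<Theta>"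
    by (simp add: eps_def algebra_simps)
  also have "\<dots> = (\<Sum>i=1..n. (t0 - 1) * (inverse t0 ^ n * (t0 ^ (n - i) * mfps_nth (?F * (?B i * U i)) \<Theta>)))
      + inverse t0 ^ n * mfps_nth ?F \<Theta>"
    unfolding main by (simp only: sum_distrib_left)
  also have "(\<Sum>i=1..n. (t0 - 1) * (inverse t0 ^ n * (t0 ^ (n - i) * mfps_nth (?F * (?B i * U i)) \<Theta>)))
     = (\<Sum>i=1..n. mfps_nth (?F * (mfps_push \<psi> (residue_coeff (mfps_const t0) (mfps_const (inverse t0)) xratio (\<lambda>i j. mfps_geo (xratio i j)) n i) * U i)) \<Theta>)"
  proof (rule sum.cong[OF refl])
    fix i assume i: "i \<in> {1..n}"
    have "(t0 - 1) * (inverse t0 ^ n * (t0 ^ (n - i) * mfps_nth (?F * (?B i * U i)) \<Theta>))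
        = ((t0 - 1) * inverse t0 ^ i) * mfps_nth (?F * (?B i * U i)) \<Theta>"
      using tpow[OF i] by (simp add: mult.assoc[symmetric])
    also have "\<dots> = mfps_nth (mfps_const ((t0 - 1) * inverse t0 ^ i) * (?F * (?B i * U i))) \<Theta>"
      by (simp only: mfps_nth_const_mult)
    also have "mfps_const ((t0 - 1) * inverse t0 ^ i) * (?F * (?B i * U i))
        = ?F * (mfps_push \<psi> (mfps_const ((t0 - 1) * inverse t0 ^ i) * Bcoef n i) * U i)"
      by (simp only: push_mult push_const mult_ac)
    finally show "(t0 - 1) * (inverse t0 ^ n * (t0 ^ (n - i) * mfps_nth (?F * (?B i * U i)) \<Theta>))
        = mfps_nth (?F * (mfps_push \<psi> (residue_coeff (mfps_const t0) (mfps_const (inverse t0)) xratio (\<lambda>i j. mfps_geo (xratio i j)) n i) * U i)) \<Theta>"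
      unfolding Bcoef_residue[OF i] .
  qed
  also have "inverse t0 ^ n * mfps_nth ?F \<Theta> = mfps_nth (?F * mfps_const (inverse t0 ^ n)) \<Theta>"
    by (simp add: mult.commute[of _ "mfps_const _"])
  finally show ?thesis
    by (simp add: distrib_left sum_distrib_left mfps_nth_sum)
qed

end

section \<open>The kernel in two sets of variables\<close>

definition left_part :: "('v + 'w) multiset \<Rightarrow> 'v multiset" where
  "left_part N = image_mset projl (filter_mset isl N)"

definition right_part :: "('v + 'w) multiset \<Rightarrow> 'w multiset" where
  "right_part N = image_mset projr (filter_mset (\<lambda>x. \<not> isl x) N)"

definition join :: "'v multiset \<Rightarrow> 'w multiset \<Rightarrow> ('v + 'w) multiset" where
  "join A B = image_mset Inl A + image_mset Inr B"

lemma left_part_Inl [simp]: "left_part (image_mset Inl A) = A"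
  by (induction A) (simp_all add: left_part_def)

lemma right_part_Inl [simp]: "right_part (image_mset Inl A) = {#}"
  by (induction A) (simp_all add: right_part_def)

lemma left_part_Inr [simp]: "left_part (image_mset Inr B) = {#}"
  by (induction B) (simp_all add: left_part_def)

lemma right_part_Inr [simp]: "right_part (image_mset Inr B) = B"
  by (induction B) (simp_all add: right_part_def)

lemma left_part_add: "left_part (M + N) = left_part M + left_part N" and right_part_add: "right_part (M + N) = right_part M + right_part N"
  by (simp_all add: left_part_def right_part_def)

lemma left_part_join [simp]: "left_part (join A B) = A" and right_part_join [simp]: "right_part (join A B) = B"
  by (simp_all add: join_def left_part_add right_part_add)

lemma join_left_part_right_part: "join (left_part N) (right_part N) = N"
proof (induction N)
  case (add x N)
  then show ?case by (cases x) (auto simp: join_def left_part_def right_part_def)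
qed (simp add: join_def left_part_def right_part_def)

lemma join_add: "join A B + join A' B' = join (A + A') (B + B')"
  by (simp add: join_def)

lemma count_join [simp]: "count (join A B) (Inl i) = count A i" "count (join A B) (Inr j) = count B j"
proof -
  have A: "count (image_mset Inl A) (Inl i) = count A i" "count (image_mset Inl A) (Inr j) = 0"
    by (induction A) auto
  have B: "count (image_mset Inr B) (Inr j) = count B j" "count (image_mset Inr B) (Inl i) = 0"
    by (induction B) auto
  show "count (join A B) (Inl i) = count A i" "count (join A B) (Inr j) = count B j"
    by (simp_all add: join_def A B)
qed

lemma join_subset_iff: "join A B \<subseteq># join A' B' \<longleftrightarrow> A \<subseteq># A' \<and> B \<subseteq># B'"
  unfolding subseteq_mset_def
proof (intro iffI conjI allI)
  fix a assume *: "\<forall>a. count (join A B) a \<le> count (join A' B') a"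
  show "count A a \<le> count A' a" using *[THEN spec, of "Inl a"] by simp
next
  fix a assume *: "\<forall>a. count (join A B) a \<le> count (join A' B') a"
  show "count B a \<le> count B' a" using *[THEN spec, of "Inr a"] by simp
next
  fix a assume *: "(\<forall>a. count A a \<le> count A' a) \<and> (\<forall>a. count B a \<le> count B' a)"
  then show "count (join A B) a \<le> count (join A' B') a" by (cases a) auto
qed

lemma join_diff: "join A' B' - join A B = join (A' - A) (B' - B)"
proof (rule multiset_eqI)
  fix x show "count (join A' B' - join A B) x = count (join (A' - A) (B' - B)) x"
    by (cases x) auto
qed

lemma join_eq_iff: "join A B = join A' B' \<longleftrightarrow> A = A' \<and> B = B'"
  by (metis left_part_join right_part_join)

definition slot_series :: "nat \<Rightarrow> nat \<Rightarrow> (nat \<Rightarrow> nat \<Rightarrow> sfun) \<Rightarrow> (nat + nat, Qqt) mfps" where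
  "slot_series n m \<gamma> = Abs_mfps (\<lambda>N. if set_mset (left_part N) \<subseteq> {..<n} \<and> set_mset (right_part N) \<subseteq> {..<m}
     then mfps_nth (\<Prod>j<m. \<gamma> j (count (right_part N) j)) (left_part N) else 0)"

lemma slot_series_nth: "mfps_nth (slot_series n m \<gamma>) (join A B)
    = (if set_mset A \<subseteq> {..<n} \<and> set_mset B \<subseteq> {..<m} then mfps_nth (\<Prod>j<m. \<gamma> j (count B j)) A else 0)"
  by (simp add: slot_series_def)

lemma mfps_eqI_join:
  "(\<And>A B. mfps_nth F (join A B) = mfps_nth G (join A B)) \<Longrightarrow> F = G"
  by (rule mfps_eqI) (metis join_left_part_right_part)

lemma slot_series_mono_mult:
  assumes i: "i < n" and j: "j < m"
  shows "mfps_mono (join {#i#} {#j#}) * slot_series n m \<gamma>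
    = slot_series n m (\<gamma>(j := \<lambda>k. if k = 0 then 0 else mfps_mono {#i#} * \<gamma> j (k - 1)))"
proof (rule mfps_eqI_join)
  fix A B :: "nat multiset"
  let ?\<gamma> = "\<gamma>(j := \<lambda>k. if k = 0 then 0 else mfps_mono {#i#} * \<gamma> j (k - 1))"
  have split: "(\<Prod>j'<m. h j') = h j * (\<Prod>j'\<in>{..<m} - {j}. h j')" for h :: "nat \<Rightarrow> sfun"
    using j by (simp add: prod.remove)
  have others: "(\<Prod>j'\<in>{..<m} - {j}. ?\<gamma> j' (count B j')) = (\<Prod>j'\<in>{..<m} - {j}. \<gamma> j' (count (B - {#j#}) j'))"
    by (intro prod.cong) auto
  have setA: "set_mset (A - {#i#}) \<subseteq> {..<n} \<longleftrightarrow> set_mset A \<subseteq> {..<n}"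
    using i by (auto simp: in_diff_count not_in_iff split: if_splits) (metis in_diffD insert_DiffM insert_noteq_member lessThan_iff subsetD insert_iff set_mset_add_mset_insert diff_single_trivial)
  have setB: "set_mset (B - {#j#}) \<subseteq> {..<m} \<longleftrightarrow> set_mset B \<subseteq> {..<m}"
    using j by (metis diff_single_trivial insert_DiffM insert_subset lessThan_iff set_mset_add_mset_insert)
  have R: "(\<Prod>j'<m. ?\<gamma> j' (count B j'))
      = (if j \<in># B then mfps_mono {#i#} * (\<Prod>j'<m. \<gamma> j' (count (B - {#j#}) j')) else 0)"
  proof (cases "j \<in># B")
    case True
    then have "count B j \<noteq> 0" by (simp add: count_eq_zero_iff)
    then show ?thesis unfolding split[of "\<lambda>j'. ?\<gamma> j' (count B j')"] others
      split[of "\<lambda>j'. \<gamma> j' (count (B - {#j#}) j')"] using True by (auto simp: mult.assoc count_eq_zero_iff)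
  next
    case False
    then have "count B j = 0" by (simp add: count_eq_zero_iff)
    then show ?thesis unfolding split[of "\<lambda>j'. ?\<gamma> j' (count B j')"] using False by simp
  qed
  show "mfps_nth (mfps_mono (join {#i#} {#j#}) * slot_series n m \<gamma>) (join A B) = mfps_nth (slot_series n m ?\<gamma>) (join A B)"
    unfolding mfps_nth_mono_mult join_subset_iff join_diff slot_series_nth setA setB R
    by (auto simp: mfps_nth_mono_mult)
qed

text \<open>
  Multiplication by \<open>1 - c x\<^sub>i z\<^sub>j\<close> of a series whose coefficient at \<open>\<Prod>\<^sub>j z\<^sub>j\<^sup>k\<^sup>j\<close> is a product
  over \<open>j\<close> changes only the factor number \<open>j\<close>.
\<close>
definition slot :: "Qqt \<Rightarrow> nat \<Rightarrow> (nat \<Rightarrow> sfun) \<Rightarrow> nat \<Rightarrow> sfun" where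
  "slot c i g k = g k - mfps_const c * (if k = 0 then 0 else mfps_mono {#i#} * g (k - 1))"

lemma slot_series_linear:
  assumes j: "j < m"
  shows "slot_series n m (\<gamma>(j := \<lambda>k. \<gamma> j k - mfps_const c * \<delta> k)) = slot_series n m \<gamma> - mfps_const c * slot_series n m (\<gamma>(j := \<delta>))"
proof (rule mfps_eqI_join)
  fix A B :: "nat multiset"
  have split: "(\<Prod>j'<m. (\<gamma>(j := \<alpha>)) j' (count B j')) = \<alpha> (count B j) * (\<Prod>j'\<in>{..<m} - {j}. \<gamma> j' (count B j'))" for \<alpha>
  proof -
    have "(\<Prod>j'\<in>{..<m} - {j}. (\<gamma>(j := \<alpha>)) j' (count B j')) = (\<Prod>j'\<in>{..<m} - {j}. \<gamma> j' (count B j'))"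
      by (intro prod.cong) auto
    then show ?thesis using j by (simp add: prod.remove)
  qed
  have base: "(\<Prod>j'<m. \<gamma> j' (count B j')) = \<gamma> j (count B j) * (\<Prod>j'\<in>{..<m} - {j}. \<gamma> j' (count B j'))"
    using split[of "\<gamma> j"] by simp
  show "mfps_nth (slot_series n m (\<gamma>(j := \<lambda>k. \<gamma> j k - mfps_const c * \<delta> k))) (join A B)
      = mfps_nth (slot_series n m \<gamma> - mfps_const c * slot_series n m (\<gamma>(j := \<delta>))) (join A B)"
    unfolding mfps_nth_simps mfps_nth_const_mult slot_series_nth split base
    by (simp add: left_diff_distrib mult.assoc)
qed

lemma slot_series_slot:
  assumes "i < n" "j < m"
  shows "(1 - mfps_const c * mfps_mono (join {#i#} {#j#})) * slot_series n m \<gamma> = slot_series n m (\<gamma>(j := slot c i (\<gamma> j)))"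
proof -
  have "slot_series n m (\<gamma>(j := slot c i (\<gamma> j)))
      = slot_series n m \<gamma> - mfps_const c * (mfps_mono (join {#i#} {#j#}) * slot_series n m \<gamma>)"
    unfolding slot_series_mono_mult[OF assms] slot_series_linear[OF assms(2), symmetric]
    by (simp add: slot_def[abs_def] cong: if_cong)
  then show ?thesis by (simp add: left_diff_distrib mult.assoc)
qed

lemma slot_series_slots:
  assumes i: "i < n" and "finite J" "J \<subseteq> {..<m}"
  shows "(\<Prod>j\<in>J. 1 - mfps_const c * mfps_mono (join {#i#} {#j#})) * slot_series n m \<gamma>
    = slot_series n m (\<lambda>j. if j \<in> J then slot c i (\<gamma> j) else \<gamma> j)"
  using assms(2,3)
proof (induction J rule: finite_induct)
  case (insert j J)
  let ?\<gamma> = "\<lambda>j. if j \<in> J then slot c i (\<gamma> j) else \<gamma> j"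
  have "(\<Prod>j\<in>insert j J. 1 - mfps_const c * mfps_mono (join {#i#} {#j#})) * slot_series n m \<gamma>
      = (1 - mfps_const c * mfps_mono (join {#i#} {#j#})) * slot_series n m ?\<gamma>"
    using insert by (simp add: mult.assoc)
  also have "\<dots> = slot_series n m (?\<gamma>(j := slot c i (?\<gamma> j)))"
    by (rule slot_series_slot) (use i insert in auto)
  also have "?\<gamma>(j := slot c i (?\<gamma> j)) = (\<lambda>j'. if j' \<in> insert j J then slot c i (\<gamma> j') else \<gamma> j')"
    using insert.hyps by (auto simp: fun_eq_iff)
  finally show ?case .
qed simp

lemma slot_series_cong:
  "(\<And>j k. j < m \<Longrightarrow> \<gamma> j k = \<gamma>' j k) \<Longrightarrow> slot_series n m \<gamma> = slot_series n m \<gamma>'"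
  by (rule mfps_eqI_join) (simp add: slot_series_nth)

definition qvar :: "nat \<Rightarrow> nat multiset \<Rightarrow> Qqt" where
  "qvar i M = q0 ^ count M i"

lemma qvar_add: "qvar i (A + B) = qvar i A * qvar i B"
  by (simp add: qvar_def power_add)

lemma slot_series_scale:
  "mfps_scale (\<lambda>N. qvar i (left_part N)) (slot_series n m \<gamma>) = slot_series n m (\<lambda>j k. mfps_scale (qvar i) (\<gamma> j k))"
proof (rule mfps_eqI_join)
  fix A B :: "nat multiset"
  have "(\<Prod>j<m. mfps_scale (qvar i) (\<gamma> j (count B j))) = mfps_scale (qvar i) (\<Prod>j<m. \<gamma> j (count B j))"
    by (rule mfps_scale_prod[symmetric]) (auto simp: qvar_add, simp add: qvar_def)
  then show "mfps_nth (mfps_scale (\<lambda>N. qvar i (left_part N)) (slot_series n m \<gamma>)) (join A B)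
      = mfps_nth (slot_series n m (\<lambda>j k. mfps_scale (qvar i) (\<gamma> j k))) (join A B)"
    by (simp add: slot_series_nth)
qed

lemma slot_gfun:
  "slot t0 i (\<lambda>k. mfps_scale (qvar i) (gfun (int k))) = slot 1 i (\<lambda>k. gfun (int k))"
proof (rule ext, rule mfps_eqI)
  fix k and M :: "nat multiset"
  define c where "c = count M i"
  define M' where "M' = M - replicate_mset c i"
  have M: "M = replicate_mset c i + M'" and N: "i \<notin># M'"
    by (simp_all add: M'_def c_def replicate_mset_subseteq_iff not_in_iff)
  show "mfps_nth (slot t0 i (\<lambda>k. mfps_scale (qvar i) (gfun (int k))) k) M = mfps_nth (slot 1 i (\<lambda>k. gfun (int k)) k) M"
  proof (cases "c = 0")
    case True
    then have "i \<notin># M" by (simp add: c_def count_eq_zero_iff)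
    then show ?thesis using True by (simp add: slot_def mfps_nth_mono_mult gfun_nth qvar_def c_def)
  next
    case False
    then obtain d where d: "c = Suc d" by (cases c) auto
    have M1: "M = add_mset i (replicate_mset d i + M')" using M d by simp
    have h1: "hmon M = hq (Suc d) * hmon M'" using hmon_add[OF N, of c] M d by simp
    have h0: "hmon (replicate_mset d i + M') = hq d * hmon M'" by (rule hmon_add[OF N])
    have cnt: "count M i = Suc d" "count (replicate_mset d i + M') i = d" "count M' i = 0"
      using c_def d N by (auto simp: count_eq_zero_iff)
    have sz: "k \<noteq> 0 \<Longrightarrow> int (k - 1) = int (size (replicate_mset d i + M')) \<longleftrightarrow> int k = int (size M)"
      unfolding M1 by auto
    have "k = 0 \<Longrightarrow> int k \<noteq> int (size M)" unfolding M1 by simp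
    moreover have "q0 ^ Suc d * (hq (Suc d) * hmon M') - t0 * (q0 ^ d * (hq d * hmon M'))
        = hq (Suc d) * hmon M' - hq d * hmon M'"
      using arg_cong[OF hq_functional[of d], of "\<lambda>x. x * hmon M'"] by (simp add: algebra_simps)
    moreover have "mfps_nth (mfps_mono {#i#} * F) M = mfps_nth F (replicate_mset d i + M')" for F :: sfun
      unfolding M1 by (simp add: mfps_nth_mono_mult)
    ultimately show ?thesis
      using sz by (auto simp: slot_def gfun_nth qvar_def cnt h1 h0 simp del: power_Suc)
  qed
qed

definition kernel :: "nat \<Rightarrow> nat \<Rightarrow> (nat + nat, Qqt) mfps" where
  "kernel n m = slot_series n m (\<lambda>j k. gfun (int k))"

lemma kernel_nth:
  "mfps_nth (kernel n m) (join A B)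
    = (if set_mset A \<subseteq> {..<n} \<and> set_mset B \<subseteq> {..<m} then scalar_qt (gmono A) (gmono B) else 0)"
proof -
  have "(\<Prod>j<m. gfun (int (count B j))) = gmono B" if "set_mset B \<subseteq> {..<m}"
    using gmono_superset[OF _ that] by simp
  then show ?thesis by (simp add: kernel_def slot_series_nth scalar_gmono[OF gmono_pspan])
qed

lemma kernel_functional:
  assumes i: "i < n"
  shows "(\<Prod>j<m. 1 - mfps_const t0 * mfps_mono (join {#i#} {#j#})) * mfps_scale (\<lambda>N. qvar i (left_part N)) (kernel n m)
    = (\<Prod>j<m. 1 - mfps_const 1 * mfps_mono (join {#i#} {#j#})) * kernel n m"
  unfolding kernel_def slot_series_scale slot_series_slots[OF i finite_lessThan order_refl] slot_gfun
  by (rule slot_series_cong) simp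

text \<open>
  \<open>theta\<close> expresses \<open>x\<^sub>1, x\<^sub>2, \<dots>\<close> through the variables \<open>x\<^sub>r\<^sub>+\<^sub>1 / x\<^sub>r\<close> of \<open>fser\<close>, to which the
  otherwise unused variable number \<open>0\<close> is added with the meaning \<open>x\<^sub>1\<close>.
\<close>
definition theta :: "nat multiset \<Rightarrow> nat multiset" where
  "theta A = (\<Sum>x\<in>#A. mset_set {..x})"

lemma theta_add: "theta (A + B) = theta A + theta B"
  by (simp add: theta_def)

lemma count_theta: "count (theta A) r = count A r + count (theta A) (Suc r)"
  by (induction A) (auto simp: theta_def count_mset_set')

lemma theta_eqD: "theta A = theta B \<Longrightarrow> A = B"
  using count_theta[of A] count_theta[of B] by (intro multiset_eqI) (metis add_right_cancel)

lemma count_theta_0: "count (theta A) 0 = size A"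
  by (induction A) (auto simp: theta_def)

definition stair :: "(nat + nat) multiset \<Rightarrow> (nat + nat) multiset" where
  "stair N = join (theta (left_part N)) (theta (right_part N))"

lemma stair_join [simp]: "stair (join A B) = join (theta A) (theta B)"
  by (simp add: stair_def)

lemma stair_emb: "mono_emb stair"
proof
  show "inj stair"
  proof (rule injI)
    fix M N assume "stair M = stair N"
    then have "left_part M = left_part N" "right_part M = right_part N" by (auto simp: stair_def join_eq_iff dest: theta_eqD)
    then show "M = N" by (metis join_left_part_right_part)
  qed
qed (simp add: stair_def left_part_add right_part_add theta_add join_add)

interpretation stair: mono_emb stair by (rule stair_emb)

definition skernel :: "nat \<Rightarrow> nat \<Rightarrow> (nat + nat, Qqt) mfps" where
  "skernel n m = mfps_push stair (kernel n m)"

lemma skernel_nth: "mfps_nth (skernel n m) (join (theta A) (theta B))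
    = (if set_mset A \<subseteq> {..<n} \<and> set_mset B \<subseteq> {..<m} then scalar_qt (gmono A) (gmono B) else 0)"
  unfolding skernel_def stair_join[symmetric] stair.nth_push kernel_nth ..

lemma skernel_nth_out: "P \<notin> range theta \<or> R \<notin> range theta \<Longrightarrow> mfps_nth (skernel n m) (join P R) = 0"
  unfolding skernel_def by (rule stair.nth_push_out) (auto simp: stair_def join_eq_iff)

definition yw :: "nat \<Rightarrow> nat \<Rightarrow> (nat + nat) multiset" where
  "yw i j = join (mset_set {..<i}) (mset_set {..<j})"

definition ywinv :: "nat \<Rightarrow> nat \<Rightarrow> (nat + nat, Qqt) mfps" where
  "ywinv i j = mfps_geo (mfps_const t0 * mfps_mono (yw i j))"

definition chiL :: "nat \<Rightarrow> (nat + nat) multiset \<Rightarrow> Qqt" where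
  "chiL i N = inverse q0 powi (int (count N (Inl (i - 1))) - int (count N (Inl i)))"

definition chiR :: "nat \<Rightarrow> (nat + nat) multiset \<Rightarrow> Qqt" where
  "chiR j N = inverse q0 powi (int (count N (Inr (j - 1))) - int (count N (Inr j)))"

lemma chiL_add: "chiL i (A + B) = chiL i A * chiL i B" and chiR_add: "chiR i (A + B) = chiR i A * chiR i B"
  unfolding chiL_def chiR_def by (rule powi_count_add, simp)+

lemma yw_nonempty: "i \<ge> 1 \<Longrightarrow> yw i j \<noteq> {#}"
proof
  assume "i \<ge> 1" "yw i j = {#}"
  then have "count (yw i j) (Inl 0) = 0" by simp
  then show False using \<open>i \<ge> 1\<close> by (simp add: yw_def)
qed

lemma ywinv: "i \<ge> 1 \<Longrightarrow> (1 - mfps_const t0 * mfps_mono (yw i j)) * ywinv i j = 1"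
  unfolding ywinv_def by (rule mfps_geo_mult) (use yw_nonempty[of i j] in auto)

lemma skernel_left:
  assumes i: "i \<in> {1..n}"
  shows "mfps_scale (chiL i) ((\<Prod>j=1..m. (1 - mfps_mono (yw i j)) * ywinv i j) * skernel n m) = skernel n m"
proof -
  obtain i' where i': "i = Suc i'" "i' < n" using i by (cases i) auto
  let ?SK = "mfps_push stair (mfps_scale (\<lambda>N. qvar i' (left_part N)) (kernel n m))"
  have yw: "mfps_push stair (mfps_mono (join {#i'#} {#j#})) = mfps_mono (yw i (Suc j))" for j
    by (simp add: i' yw_def theta_def lessThan_Suc_atMost)
  have shift: "(\<Prod>j=1..m. h j) = (\<Prod>j<m. h (Suc j))" for h :: "nat \<Rightarrow> (nat + nat, Qqt) mfps"
    using prod.atLeast_Suc_atMost_Suc_shift[of h 0 "m - 1"]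
    by (cases m) (auto simp: lessThan_Suc_atMost atLeast0AtMost)
  have F: "(\<Prod>j<m. 1 - mfps_const t0 * mfps_mono (yw i (Suc j))) * ?SK
      = (\<Prod>j<m. 1 - mfps_mono (yw i (Suc j))) * skernel n m"
    using arg_cong[OF kernel_functional[OF i'(2), of m], of "mfps_push stair"]
    by (simp only: stair.push_mult stair.push_prod stair.push_diff stair.push_1 stair.push_const yw
        skernel_def mfps_const_simps(2) mult_1_left)
  have "(\<Prod>j=1..m. (1 - mfps_mono (yw i j)) * ywinv i j) * skernel n m
      = (\<Prod>j<m. ywinv i (Suc j)) * ((\<Prod>j<m. 1 - mfps_mono (yw i (Suc j))) * skernel n m)"
    unfolding shift by (simp add: prod.distrib mult_ac)
  also have "\<dots> = (\<Prod>j<m. (1 - mfps_const t0 * mfps_mono (yw i (Suc j))) * ywinv i (Suc j)) * ?SK"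
    unfolding F[symmetric] by (simp add: prod.distrib mult_ac)
  also have "\<dots> = ?SK" using ywinv[of i] i by simp
  finally have E: "(\<Prod>j=1..m. (1 - mfps_mono (yw i j)) * ywinv i j) * skernel n m = ?SK" .
  have "chiL i (stair N) * qvar i' (left_part N) = 1" for N
  proof -
    have "int (count (theta (left_part N)) i') - int (count (theta (left_part N)) i) = int (count (left_part N) i')"
      using count_theta[of "left_part N" i'] i' by simp
    then show ?thesis
      by (simp add: chiL_def stair_def i' qvar_def power_inverse)
  qed
  then have "mfps_scale (\<lambda>N. chiL i (stair N)) (mfps_scale (\<lambda>N. qvar i' (left_part N)) (kernel n m)) = kernel n m"
    by (intro mfps_eqI) (simp add: mult.assoc[symmetric])
  then show ?thesis unfolding E stair.scale_push by (simp add: skernel_def)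
qed

definition swap_sides :: "nat + nat \<Rightarrow> nat + nat" where
  "swap_sides = case_sum Inr Inl"

lemma swap_sides_swap_sides [simp]: "swap_sides (swap_sides x) = x"
  by (cases x) (auto simp: swap_sides_def)

interpretation swap_sides: mono_emb "image_mset swap_sides"
  by (rule mono_emb_image) (metis injI swap_sides_swap_sides)

lemma swap_sides_join [simp]: "image_mset swap_sides (join A B) = join B A"
  by (simp add: join_def swap_sides_def multiset.map_comp o_def add.commute)

lemma push_swap_sides_nth: "mfps_nth (mfps_push (image_mset swap_sides) F) (join A B) = mfps_nth F (join B A)"
  using swap_sides.nth_push[of F "join B A"] by simp

lemma skernel_swap_sides: "mfps_push (image_mset swap_sides) (skernel n m) = skernel m n"
proof (rule mfps_eqI_join)
  fix P R
  show "mfps_nth (mfps_push (image_mset swap_sides) (skernel n m)) (join P R) = mfps_nth (skernel m n) (join P R)"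
  proof (cases "P \<in> range theta \<and> R \<in> range theta")
    case True
    then show ?thesis by (auto simp: push_swap_sides_nth skernel_nth scalar_commute[OF gmono_pspan gmono_pspan])
  next
    case False
    then show ?thesis by (auto simp: push_swap_sides_nth skernel_nth_out)
  qed
qed

lemma skernel_right:
  assumes j: "j \<in> {1..m}"
  shows "mfps_scale (chiR j) ((\<Prod>i=1..n. (1 - mfps_mono (yw i j)) * ywinv i j) * skernel n m) = skernel n m"
proof -
  have chi: "chiR j (image_mset swap_sides N) = chiL j N" for N
    using join_left_part_right_part[of N] by (metis chiL_def chiR_def count_join swap_sides_join)
  have ywp: "mfps_push (image_mset swap_sides) (mfps_mono (yw j i)) = mfps_mono (yw i j)" for i
    by (simp add: yw_def)
  have inv: "mfps_push (image_mset swap_sides) (ywinv j i) = ywinv i j" for i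
  proof -
    have "mfps_nth (mfps_const t0 * mfps_mono (yw j i)) {#} = 0" using yw_nonempty[of j i] j by auto
    then show ?thesis unfolding ywinv_def by (simp add: swap_sides.push_geo swap_sides.push_mult ywp del: swap_sides.push_mono)
  qed
  have "mfps_push (image_mset swap_sides) (mfps_scale (chiL j) ((\<Prod>i=1..n. (1 - mfps_mono (yw j i)) * ywinv j i) * skernel m n))
      = mfps_scale (chiR j) (mfps_push (image_mset swap_sides) ((\<Prod>i=1..n. (1 - mfps_mono (yw j i)) * ywinv j i) * skernel m n))"
    unfolding swap_sides.scale_push chi ..
  then show ?thesis
    unfolding skernel_left[OF j] skernel_swap_sides
    by (simp add: swap_sides.push_mult swap_sides.push_prod swap_sides.push_diff ywp inv skernel_swap_sides del: swap_sides.push_mono)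
qed

section \<open>Orthogonality and triangularity\<close>

definition mon :: "nat \<Rightarrow> (nat \<Rightarrow> int) \<Rightarrow> nat multiset" where
  "mon n b = (\<Sum>k=1..n. replicate_mset (nat (b k)) (k - 1))"

lemma count_mon: "count (mon n b) r = (if r < n then nat (b (Suc r)) else 0)"
proof -
  have "count (mon n b) r = (\<Sum>k=1..n. if k = Suc r then nat (b (Suc r)) else 0)"
    unfolding mon_def count_sum by (intro sum.cong) auto
  then show ?thesis by (auto simp: sum.delta)
qed

lemma set_mon: "set_mset (mon n b) \<subseteq> {..<n}"
  by (auto simp: count_mon simp flip: count_greater_zero_iff split: if_splits)

abbreviation nonneg :: "nat \<Rightarrow> (nat \<Rightarrow> int) \<Rightarrow> bool" where
  "nonneg n b \<equiv> \<forall>k\<in>{1..n}. b k \<ge> 0"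

lemma gprod_mon: "gprod n b = (if nonneg n b then gmono (mon n b) else 0)"
proof (cases "nonneg n b")
  case True
  have "gmono (mon n b) = (\<Prod>r<n. gfun (int (count (mon n b) r)))"
    by (rule gmono_superset[OF finite_lessThan set_mon])
  also have "\<dots> = (\<Prod>r<n. gfun (b (Suc r)))"
    using True by (intro prod.cong refl) (auto simp: count_mon)
  also have "\<dots> = gprod n b"
    unfolding gprod_def using prod.atLeast1_atMost_eq[of "\<lambda>i. gfun (b i)" n] by simp
  finally show ?thesis using True by simp
next
  case False
  then obtain k where "1 \<le> k" "k \<le> n" "\<not> b k \<ge> 0" by auto
  then have "gprod n b = 0" using gprod_nonneg by blast
  then show ?thesis unfolding if_not_P[OF False] .
qed

lemma move_simple_root:
  "k \<ge> 1 \<Longrightarrow> move simple_root a C k = a k + int (count C k) - int (count C (k - 1))"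
  by (induction C) (auto simp: move_def root_vec_def)

lemma count_theta_out: "set_mset A \<subseteq> {..<n} \<Longrightarrow> n \<le> r \<Longrightarrow> count (theta A) r = 0"
  by (induction A) (auto simp: theta_def count_mset_set')

abbreviation raised :: "(nat \<Rightarrow> nat) \<Rightarrow> nat multiset \<Rightarrow> nat \<Rightarrow> int" where
  "raised lam C \<equiv> move simple_root (\<lambda>i. int (lam i)) C"

lemma theta_mon_move:
  assumes C: "set_mset C \<subseteq> {1..<n}" and nn: "nonneg n (raised lam C)"
  shows "theta (mon n (raised lam C)) + C = theta (mon n (\<lambda>i. int (lam i)))"
proof (rule multiset_eqI)
  let ?b = "raised lam C"
  fix r
  have out: "count C r = 0" if "n \<le> r" for r
    using C that by (auto simp flip: not_in_iff)
  show "count (theta (mon n ?b) + C) r = count (theta (mon n (\<lambda>i. int (lam i)))) r"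
  proof (cases "r \<le> n")
    case True
    then show ?thesis
    proof (induction r rule: inc_induct)
      case base
      show ?case using out count_theta_out[OF set_mon] by simp
    next
      case (step r)
      have b: "int (nat (?b (Suc r))) = int (lam (Suc r)) + int (count C (Suc r)) - int (count C r)"
        using bspec[OF nn, of "Suc r"] step.hyps by (simp add: move_simple_root)
      have "int (count (theta (mon n ?b) + C) r)
          = int (nat (?b (Suc r))) + int (count (theta (mon n ?b)) (Suc r)) + int (count C r)"
        using step.hyps count_theta[of "mon n ?b" r] by (simp add: count_mon)
      also have "\<dots> = int (lam (Suc r)) + int (count (theta (mon n ?b) + C) (Suc r))"
        unfolding b by simp
      also have "\<dots> = int (count (theta (mon n (\<lambda>i. int (lam i)))) r)"
        unfolding step.IH using step.hyps count_theta[of "mon n (\<lambda>i. int (lam i))" r] by (simp add: count_mon)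
      finally show ?case by simp
    qed
  next
    case False
    then show ?thesis using out count_theta_out[OF set_mon] by simp
  qed
qed

lemma theta_mon_conv:
  assumes "C \<subseteq># theta (mon n (\<lambda>i. int (lam i)))" "theta (mon n (\<lambda>i. int (lam i))) - C = theta a"
    and k: "k \<in> {1..n}"
  shows "raised lam C k = int (count a (k - 1))"
proof -
  let ?L = "mon n (\<lambda>i. int (lam i))"
  have sub: "count C r \<le> count (theta ?L) r" for r using assms(1) by (simp add: subseteq_mset_def)
  have ta: "int (count (theta a) r) = int (count (theta ?L) r) - int (count C r)" for r
    using arg_cong[OF assms(2), of "\<lambda>M. count M r"] sub[of r] by simp
  have "int (count a (k - 1)) = int (count (theta a) (k - 1)) - int (count (theta a) k)"
    using count_theta[of a "k - 1"] k by simp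
  moreover have "int (count (theta ?L) (k - 1)) = int (lam k) + int (count (theta ?L) k)"
  proof -
    have "Suc (k - 1) = k" "k - 1 < n" using k by auto
    then show ?thesis using count_theta[of ?L "k - 1"] by (simp add: count_mon)
  qed
  ultimately show ?thesis using k by (simp add: move_simple_root ta)
qed

lemma gprod_theta:
  assumes C: "set_mset C \<subseteq> {1..<n}" "C \<subseteq># theta (mon n (\<lambda>i. int (lam i)))"
  obtains a where "theta (mon n (\<lambda>i. int (lam i))) - C = theta a" "set_mset a \<subseteq> {..<n}"
      "gprod n (raised lam C) = gmono a"
  | "theta (mon n (\<lambda>i. int (lam i))) - C \<notin> range theta" "gprod n (raised lam C) = 0"
proof (cases "nonneg n (raised lam C)")
  case True
  have "theta (mon n (\<lambda>i. int (lam i))) - C = theta (mon n (raised lam C))"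
    using theta_mon_move[OF C(1) True] by (metis add_diff_cancel_right')
  then show ?thesis using that(1) True by (simp add: gprod_mon set_mon)
next
  case False
  then have "theta (mon n (\<lambda>i. int (lam i))) - C \<noteq> theta a" for a
    using theta_mon_conv[OF C(2), of a] by auto
  moreover have "gprod n (raised lam C) = 0"
    unfolding gprod_mon if_not_P[OF False] ..
  ultimately show ?thesis using that(2) by blast
qed

abbreviation sspec :: "nat \<Rightarrow> (nat \<Rightarrow> nat) \<Rightarrow> nat \<Rightarrow> Qqt" where
  "sspec n lam \<equiv> \<lambda>i. t0 ^ (n - i) * q0 ^ lam i"

abbreviation fspec :: "nat \<Rightarrow> (nat \<Rightarrow> nat) \<Rightarrow> (nat, Qqt) mfps" where
  "fspec n lam \<equiv> fser n (sspec n lam) q0 t0"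

definition Qraise :: "nat \<Rightarrow> (nat \<Rightarrow> nat) \<Rightarrow> sfun" where
  "Qraise n lam = raise_apply n (raising_series n (sspec n lam)) (\<lambda>i. int (lam i))"

definition below :: "nat \<Rightarrow> (nat \<Rightarrow> nat) \<Rightarrow> nat multiset set" where
  "below n lam = {C. C \<subseteq># theta (mon n (\<lambda>i. int (lam i)))}"

lemma finite_below: "finite (below n lam)"
  unfolding below_def by (rule finite_submultisets)

lemma fspec_supp: "mfps_nth (fspec n lam) C \<noteq> 0 \<Longrightarrow> set_mset C \<subseteq> {1..<n}"
  using supp_fser[of n "sspec n lam"] unfolding rroot.supp_def by blast

lemma Qraise_expand:
  "Qraise n lam = (\<Sum>C\<in>below n lam. mfps_const (mfps_nth (fspec n lam) C)
      * gprod n (raised lam C))"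
  unfolding Qraise_def raise_apply_fser rroot.G_def[symmetric]
proof (rule rroot.app_superset[OF supp_fser finite_below])
  fix C assume C: "C \<in> rroot.J n (\<lambda>i. int (lam i))" "mfps_nth (fspec n lam) C \<noteq> 0"
  then have set: "set_mset C \<subseteq> {1..<n}" by (rule_tac fspec_supp)
  have "gprod n (raised lam C) \<noteq> 0"
    using C(1) unfolding rroot.J_def rroot.G_def by blast
  then have "nonneg n (raised lam C)" by (auto simp: gprod_mon split: if_splits)
  from theta_mon_move[OF set this] show "C \<in> below n lam"
    unfolding below_def by (metis (mono_tags) mem_Collect_eq mset_subset_eq_add_right)
qed

lemma gprod_pspan: "gprod n b \<in> pspan"
  by (simp add: gprod_mon gmono_pspan)

lemma Qraise_pspan: "Qraise n lam \<in> pspan"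
  unfolding Qraise_expand by (intro pspan_sum pspan_const gprod_pspan)

lemma scalar_Qraise:
  assumes "H \<in> pspan"
  shows "scalar_qt (Qraise n lam) H = (\<Sum>C\<in>below n lam. mfps_nth (fspec n lam) C
      * scalar_qt (gprod n (raised lam C)) H)"
  unfolding Qraise_expand using assms
  by (simp add: scalar_sum_left pspan_const gprod_pspan scalar_const_left)

lemma inl_emb: "mono_emb (image_mset (Inl :: 'a \<Rightarrow> 'a + 'b))"
  by (rule mono_emb_image) simp

lemma inr_emb: "mono_emb (image_mset (Inr :: 'b \<Rightarrow> 'a + 'b))"
  by (rule mono_emb_image) simp

interpretation inl: mono_emb "image_mset (Inl :: nat \<Rightarrow> nat + nat)" by (rule inl_emb)
interpretation inr: mono_emb "image_mset (Inr :: nat \<Rightarrow> nat + nat)" by (rule inr_emb)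

lemma inl_join: "image_mset Inl A = join A {#}" and inr_join: "image_mset Inr B = join {#} B"
  by (simp_all add: join_def)

abbreviation top_mon :: "nat \<Rightarrow> (nat \<Rightarrow> nat) \<Rightarrow> nat multiset" where
  "top_mon n lam \<equiv> theta (mon n (\<lambda>i. int (lam i)))"

lemma nth_inl_mult:
  fixes A B :: "nat multiset"
  shows
  "mfps_nth (mfps_push (image_mset Inl) F * H) (join A B)
    = (\<Sum>C | C \<subseteq># A. mfps_nth F C * mfps_nth H (join (A - C) B))"
  by (subst inl.nth_push_mult[of "join A B" A])
    (simp_all add: inl_join join_subset_iff join_diff)

lemma nth_inr_mult:
  fixes A B :: "nat multiset"
  shows
  "mfps_nth (mfps_push (image_mset Inr) F * H) (join A B)
    = (\<Sum>C | C \<subseteq># B. mfps_nth F C * mfps_nth H (join A (B - C)))"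
  by (subst inr.nth_push_mult[of "join A B" B])
    (simp_all add: inr_join join_subset_iff join_diff)

lemma scalar_Qraise_Qraise:
  "scalar_qt (Qraise n lam) (Qraise m mu)
    = mfps_nth (mfps_push (image_mset Inl) (fspec n lam) * (mfps_push (image_mset Inr) (fspec m mu) * skernel n m))
        (join (top_mon n lam) (top_mon m mu))"
proof -
  have step: "mfps_nth (fspec n lam) C * (mfps_nth (fspec m mu) D * scalar_qt (gprod m (raised mu D))
        (gprod n (raised lam C)))
      = mfps_nth (fspec n lam) C * (mfps_nth (fspec m mu) D * mfps_nth (skernel n m) (join (top_mon n lam - C) (top_mon m mu - D)))"
    if C: "C \<in> below n lam" and D: "D \<in> below m mu" for C D
  proof (cases "mfps_nth (fspec n lam) C = 0 \<or> mfps_nth (fspec m mu) D = 0")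
    case False
    then have sC: "set_mset C \<subseteq> {1..<n}" and sD: "set_mset D \<subseteq> {1..<m}" using fspec_supp by auto
    have C': "C \<subseteq># top_mon n lam" and D': "D \<subseteq># top_mon m mu" using C D by (auto simp: below_def)
    from sC C' have "scalar_qt (gprod m (raised mu D)) (gprod n (raised lam C))
        = mfps_nth (skernel n m) (join (top_mon n lam - C) (top_mon m mu - D))"
    proof (cases rule: gprod_theta)
      case (1 a)
      from sD D' show ?thesis
      proof (cases rule: gprod_theta)
        case (1 b)
        then show ?thesis using \<open>top_mon n lam - C = theta a\<close> \<open>set_mset a \<subseteq> {..<n}\<close>
            \<open>gprod n (raised lam C) = gmono a\<close>
          by (simp add: skernel_nth scalar_commute[OF gmono_pspan gmono_pspan, of b])
      next
        case 2
        then show ?thesis using scalar_commute[OF pspan_0 gprod_pspan] scalar_0_right[OF gprod_pspan]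
          by (simp add: skernel_nth_out)
      qed
    next
      case 2
      then show ?thesis using scalar_0_right[OF gprod_pspan] by (simp add: skernel_nth_out)
    qed
    then show ?thesis by simp
  qed auto
  have "scalar_qt (Qraise n lam) (Qraise m mu) = (\<Sum>C\<in>below n lam. mfps_nth (fspec n lam) C * (\<Sum>D\<in>below m mu.
      mfps_nth (fspec m mu) D * scalar_qt (gprod m (raised mu D))
        (gprod n (raised lam C))))"
    by (simp add: scalar_Qraise[OF Qraise_pspan] scalar_commute[OF gprod_pspan Qraise_pspan] scalar_Qraise[OF gprod_pspan])
  also have "\<dots> = (\<Sum>C\<in>below n lam. mfps_nth (fspec n lam) C * (\<Sum>D\<in>below m mu.
      mfps_nth (fspec m mu) D * mfps_nth (skernel n m) (join (top_mon n lam - C) (top_mon m mu - D))))"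
    unfolding sum_distrib_left by (intro sum.cong refl step)
  finally show ?thesis by (simp add: nth_inl_mult nth_inr_mult below_def)
qed

text \<open>
  The eigenvalue \<open>\<Sum> t\<^sup>n\<^sup>-\<^sup>i q\<^sup>\<lambda>\<^sup>i\<close>, rescaled and shifted so that it does not change when zero parts are
  appended to \<open>\<lambda>\<close>.
\<close>
definition eps :: "nat \<Rightarrow> (nat \<Rightarrow> nat) \<Rightarrow> Qqt" where
  "eps n lam = (t0 - 1) * (\<Sum>i=1..n. inverse t0 ^ i * q0 ^ lam i) + inverse t0 ^ n"

lemma mfps_scale_trivial: "mfps_scale (\<lambda>M. 1) F = F"
  by (rule mfps_eqI) simp

abbreviation eigen_eq :: "nat \<Rightarrow> (nat \<Rightarrow> nat) \<Rightarrow> bool" where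
  "eigen_eq n lam \<equiv> D1 n (sspec n lam) q0 t0 (fspec n lam)
      = mfps_const (\<Sum>i = 1..n. sspec n lam i) * fspec n lam"

lemma push_residue:
  assumes "mono_emb \<psi>"
  shows "mfps_push \<psi> (residue_coeff (mfps_const t) (mfps_const \<tau>) x u n i)
    = residue_coeff (mfps_const t) (mfps_const \<tau>) (\<lambda>i j. mfps_push \<psi> (x i j)) (\<lambda>i j. mfps_push \<psi> (u i j)) n i"
proof -
  interpret mono_emb \<psi> by fact
  have pow: "mfps_const \<tau> ^ k = mfps_const (\<tau> ^ k)" for k by (simp add: mfps_const_power)
  show ?thesis
    unfolding residue_coeff_def pow push_mult push_prod push_diff push_1 push_const ..
qed

lemma mfps_mono_lessThan: "i < j \<Longrightarrow> mset_set {..<j} = mset_set {i..<j} + mset_set {..<i :: nat}"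
  by (subst mset_set_Union[symmetric]) (auto simp: ivl_disj_un add.commute intro!: arg_cong[of _ _ mset_set])

lemma scalar_eigen:
  assumes L: "eigen_eq n lam" and R: "eigen_eq m mu"
  shows "eps n lam * scalar_qt (Qraise n lam) (Qraise m mu) = eps m mu * scalar_qt (Qraise n lam) (Qraise m mu)"
proof -
  let ?\<Theta> = "join (top_mon n lam) (top_mon m mu)"
  let ?f = "mfps_push (image_mset Inl) (fspec n lam) :: (nat + nat, Qqt) mfps"
  let ?g = "mfps_push (image_mset Inr) (fspec m mu) :: (nat + nat, Qqt) mfps"
  let ?rc = "residue_coeff (mfps_const t0) (mfps_const (inverse t0)) xratio (\<lambda>i j. mfps_geo (xratio i j))"
  define UL where "UL i = (\<Prod>j=1..m. (1 - mfps_mono (yw i j)) * ywinv i j)" for i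
  define UR where "UR j = (\<Prod>i=1..n. (1 - mfps_mono (yw i j)) * ywinv i j)" for j
  have cmon: "int (count (top_mon n lam) (i - 1)) - int (count (top_mon n lam) i) = int (lam i)"
    if "i \<in> {1..n}" for i n and lam :: "nat \<Rightarrow> nat"
  proof -
    have "Suc (i - 1) = i" "i - 1 < n" using that by auto
    then show ?thesis using count_theta[of "mon n (\<lambda>i. int (lam i))" "i - 1"] by (simp add: count_mon)
  qed
  interpret l: eigen_side "image_mset Inl" n lam chiL ?\<Theta> "fspec n lam" ?g "skernel n m" UL
  proof
    show "mfps_scale (chiL i) ?g = ?g" for i
      unfolding inr.scale_push inr_join chiL_def count_join by (simp add: mfps_scale_trivial)
    show "mfps_scale (chiL i) (UL i * skernel n m) = skernel n m" if "i \<in> {1..n}" for i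
      unfolding UL_def by (rule skernel_left[OF that])
    show "chiL i (A + B) = chiL i A * chiL i B" for i A B by (rule chiL_add)
    show "chiL i (image_mset Inl M) = inverse q0 powi (int (count M (i - 1)) - int (count M i))" for i M
      unfolding inl_join chiL_def count_join ..
    show "chiL i ?\<Theta> = inverse q0 ^ lam i" if "i \<in> {1..n}" for i
      unfolding chiL_def count_join cmon[OF that] by (rule power_int_of_nat)
  qed (rule L)
  interpret r: eigen_side "image_mset Inr" m mu chiR ?\<Theta> "fspec m mu" ?f "skernel n m" UR
  proof
    show "mfps_scale (chiR i) ?f = ?f" for i
      unfolding inl.scale_push inl_join chiR_def count_join by (simp add: mfps_scale_trivial)
    show "mfps_scale (chiR i) (UR i * skernel n m) = skernel n m" if "i \<in> {1..m}" for i
      unfolding UR_def by (rule skernel_right[OF that])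
    show "chiR i (A + B) = chiR i A * chiR i B" for i A B by (rule chiR_add)
    show "chiR i (image_mset Inr M) = inverse q0 powi (int (count M (i - 1)) - int (count M i))" for i M
      unfolding inr_join chiR_def count_join ..
    show "chiR i ?\<Theta> = inverse q0 ^ mu i" if "i \<in> {1..m}" for i
      unfolding chiR_def count_join cmon[OF that] by (rule power_int_of_nat)
  qed (rule R)
  define t :: "(nat + nat, Qqt) mfps" where "t = mfps_const t0"
  define \<tau> :: "(nat + nat, Qqt) mfps" where "\<tau> = mfps_const (inverse t0)"
  define xl :: "nat \<Rightarrow> nat \<Rightarrow> (nat + nat, Qqt) mfps" where "xl i j = mfps_push (image_mset Inl) (xratio i j)" for i j
  define xr :: "nat \<Rightarrow> nat \<Rightarrow> (nat + nat, Qqt) mfps" where "xr i j = mfps_push (image_mset Inr) (xratio i j)" for i j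
  define ul :: "nat \<Rightarrow> nat \<Rightarrow> (nat + nat, Qqt) mfps" where "ul i j = mfps_push (image_mset Inl) (mfps_geo (xratio i j))" for i j
  define ur :: "nat \<Rightarrow> nat \<Rightarrow> (nat + nat, Qqt) mfps" where "ur i j = mfps_push (image_mset Inr) (mfps_geo (xratio i j))" for i j
  define y :: "nat \<Rightarrow> (nat + nat, Qqt) mfps" where "y i = mfps_mono (image_mset Inl (mset_set {..<i}))" for i
  define w :: "nat \<Rightarrow> (nat + nat, Qqt) mfps" where "w j = mfps_mono (image_mset Inr (mset_set {..<j}))" for j
  have yw: "mfps_mono (yw i j) = y i * w j" for i j
    by (simp add: y_def w_def yw_def join_def mfps_mono_add)
  have tt: "t * \<tau> = 1" by (simp add: t_def \<tau>_def mfps_const_simps(2) flip: mfps_const_simps(6))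
  have rl: "mfps_push (image_mset Inl) (?rc n i) = residue_coeff t \<tau> xl ul n i" for i
    unfolding t_def \<tau>_def xl_def ul_def by (rule push_residue[OF inl_emb])
  have rr: "mfps_push (image_mset Inr) (?rc m j) = residue_coeff t \<tau> xr ur m j" for j
    unfolding t_def \<tau>_def xr_def ur_def by (rule push_residue[OF inr_emb])
  have xl: "xl i k = xl i j * xl j k" and xr: "xr i k = xr i j * xr j k" if "i < j" "j < k" for i j k
    using that by (simp_all add: xl_def xr_def xratio_mult[of i j k] inl.push_mult inr.push_mult)
  have ul: "(1 - xl i j) * ul i j = 1" if "i < j" for i j
  proof -
    have "(1 - xl i j) * ul i j = mfps_push (image_mset Inl) ((1 - xratio i j) * mfps_geo (xratio i j))"
      by (simp only: xl_def ul_def inl.push_mult inl.push_diff inl.push_1)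
    also have "\<dots> = 1" by (simp add: mfps_geo_mult[OF nth_0_xratio[OF that]])
    finally show ?thesis .
  qed
  have ur: "(1 - xr i j) * ur i j = 1" if "i < j" for i j
  proof -
    have "(1 - xr i j) * ur i j = mfps_push (image_mset Inr) ((1 - xratio i j) * mfps_geo (xratio i j))"
      by (simp only: xr_def ur_def inr.push_mult inr.push_diff inr.push_1)
    also have "\<dots> = 1" by (simp add: mfps_geo_mult[OF nth_0_xratio[OF that]])
    finally show ?thesis .
  qed
  have y: "y j = xl i j * y i" and w: "w j = xr i j * w i" if "i < j" for i j
    using that by (simp_all add: y_def w_def xl_def xr_def xratio_mono mfps_mono_lessThan[OF that] mfps_mono_add)
  have g: "(1 - t * (y i * w j)) * ywinv i j = 1" if "i \<ge> 1" for i j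
    using ywinv[OF that, of j] by (simp add: t_def yw)
  have g': "(1 - t * (w j * y i)) * ywinv i j = 1" if "i \<ge> 1" for i j
    using g[OF that, of j] by (simp add: mult.commute)
  have pow: "mfps_const (inverse t0 ^ k) = \<tau> ^ k" for k by (simp add: \<tau>_def mfps_const_power)
  have SL: "(\<Sum>i=1..n. mfps_push (image_mset Inl) (?rc n i) * UL i) + mfps_const (inverse t0 ^ n)
      = \<tau> ^ m + \<tau> ^ n - \<tau> ^ m * \<tau> ^ n
        + (\<Sum>i=1..n. \<Sum>j=1..m. residue_coeff t \<tau> xl ul n i * residue_coeff t \<tau> xr ur m j * ywinv i j)"
    unfolding rl UL_def pow yw by (rule kernel_symmetric[OF tt]) (auto intro: xl xr ul ur w g)
  have SR: "(\<Sum>j=1..m. mfps_push (image_mset Inr) (?rc m j) * UR j) + mfps_const (inverse t0 ^ m)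
      = \<tau> ^ n + \<tau> ^ m - \<tau> ^ n * \<tau> ^ m
        + (\<Sum>j=1..m. \<Sum>i=1..n. residue_coeff t \<tau> xr ur m j * residue_coeff t \<tau> xl ul n i * ywinv i j)"
    unfolding rr UR_def pow yw mult.commute[of "y _" "w _"]
    by (rule kernel_symmetric[OF tt, where g="\<lambda>j i. ywinv i j"]) (auto intro: xl xr ul ur y g')
  have swap: "(\<Sum>j=1..m. \<Sum>i=1..n. residue_coeff t \<tau> xr ur m j * residue_coeff t \<tau> xl ul n i * ywinv i j)
      = (\<Sum>i=1..n. \<Sum>j=1..m. residue_coeff t \<tau> xl ul n i * residue_coeff t \<tau> xr ur m j * ywinv i j)"
    by (subst sum.swap) (simp add: mult_ac)
  have S: "(\<Sum>i=1..n. mfps_push (image_mset Inl) (?rc n i) * UL i) + mfps_const (inverse t0 ^ n)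
      = (\<Sum>j=1..m. mfps_push (image_mset Inr) (?rc m j) * UR j) + mfps_const (inverse t0 ^ m)"
    unfolding SL SR swap by (simp add: mult.commute add.commute)
  have fg: "?g * ?f * skernel n m = ?f * ?g * skernel n m" by (simp add: mult.commute)
  have "l.eps * mfps_nth (?f * ?g * skernel n m) ?\<Theta> = r.eps * mfps_nth (?f * ?g * skernel n m) ?\<Theta>"
    using l.eps_mult r.eps_mult unfolding S fg by simp
  then show ?thesis
    unfolding scalar_Qraise_Qraise l.eps_def r.eps_def eps_def mult.assoc .
qed

lemma eps_pad:
  assumes "n \<le> N"
  shows "eps n lam = (t0 - 1) * (\<Sum>i=1..N. inverse t0 ^ i * q0 ^ (if i \<le> n then lam i else 0)) + inverse t0 ^ N"
  using assms
proof (induction N rule: dec_induct)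
  case base
  have "(\<Sum>i=1..n. inverse t0 ^ i * q0 ^ (if i \<le> n then lam i else 0)) = (\<Sum>i=1..n. inverse t0 ^ i * q0 ^ lam i)"
    by (intro sum.cong) auto
  then show ?case by (simp add: eps_def)
next
  case (step N)
  have "(t0 - 1) * inverse t0 ^ Suc N + inverse t0 ^ Suc N = inverse t0 ^ N"
    by (simp add: algebra_simps)
  then show ?case using step by (simp add: distrib_left)
qed

lemma eps_eqD:
  assumes "eps n lam = eps m mu" "1 \<le> i"
  shows "(if i \<le> n then lam i else 0) = (if i \<le> m then mu i else 0)"
proof (cases "i \<le> max n m")
  case True
  define N where "N = max n m"
  let ?k = "\<lambda>i. if i \<le> n then lam i else 0" and ?l = "\<lambda>i. if i \<le> m then mu i else 0"
  have t1: "t0 - 1 \<noteq> 0" using t0_power_neq_1[of 1] by simp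
  have "(\<Sum>i=1..N. inverse t0 ^ i * q0 ^ ?k i) = (\<Sum>i=1..N. inverse t0 ^ i * q0 ^ ?l i)"
    using assms(1) t1 unfolding eps_pad[of n N lam, OF max.cobounded1[of n m, folded N_def]]
      eps_pad[of m N mu, OF max.cobounded2[of m n, folded N_def]] by simp
  then have *: "t0 ^ N * (\<Sum>i=1..N. inverse t0 ^ i * q0 ^ ?k i) = t0 ^ N * (\<Sum>i=1..N. inverse t0 ^ i * q0 ^ ?l i)"
    by simp
  have pow: "t0 ^ N * (\<Sum>i=1..N. inverse t0 ^ i * q0 ^ h i) = (\<Sum>i=1..N. t0 ^ (N - i) * q0 ^ h i)" for h
  proof -
    have "t0 ^ N * inverse t0 ^ i = t0 ^ (N - i)" if "i \<in> {1..N}" for i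
    proof -
      have "t0 ^ N = t0 ^ (N - i) * t0 ^ i" using that by (simp flip: power_add)
      then show ?thesis by (simp add: power_inverse)
    qed
    then show ?thesis unfolding sum_distrib_left by (intro sum.cong refl) (simp add: mult.assoc[symmetric])
  qed
  show ?thesis
  proof (rule qt_sum_eqD[where e="\<lambda>i. N - i" and I="{1..N}" and k="?k" and l="?l" and i=i])
    show "(\<Sum>i=1..N. t0 ^ (N - i) * q0 ^ ?k i) = (\<Sum>i=1..N. t0 ^ (N - i) * q0 ^ ?l i)"
      using * unfolding pow .
    show "inj_on (\<lambda>i. N - i) {1..N}" by (auto intro!: inj_onI)
    show "i \<in> {1..N}" using assms(2) True by (simp add: N_def)
  qed simp
qed auto

definition plist :: "nat \<Rightarrow> (nat \<Rightarrow> nat) \<Rightarrow> nat list" where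
  "plist n lam = filter (\<lambda>r. r > 0) (map lam [1..<n + 1])"

lemma plist_pad: "n \<le> N \<Longrightarrow> plist n lam = plist N (\<lambda>i. if i \<le> n then lam i else 0)"
proof (induction N rule: dec_induct)
  case base
  show ?case unfolding plist_def by (intro arg_cong[of _ _ "filter _"] map_cong) auto
next
  case (step N)
  then show ?case by (simp add: plist_def)
qed

lemma eps_plist:
  assumes "eps n lam = eps m mu"
  shows "plist n lam = plist m mu"
proof -
  define N where "N = max n m"
  have "plist N (\<lambda>i. if i \<le> n then lam i else 0) = plist N (\<lambda>i. if i \<le> m then mu i else 0)"
    unfolding plist_def
    by (intro arg_cong[of _ _ "filter _"] map_cong refl eps_eqD[OF assms]) auto
  then show ?thesis using plist_pad[of n N lam] plist_pad[of m N mu] by (simp add: N_def)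
qed

lemma scalar_orth:
  assumes "eigen_eq n lam" "eigen_eq m mu" "plist n lam \<noteq> plist m mu"
  shows "scalar_qt (Qraise n lam) (Qraise m mu) = 0"
  using scalar_eigen[OF assms(1,2)] eps_plist[of n lam m mu] assms(3) by auto

lemma gmono_hom: "hom_deg (size M) (gmono M)"
  unfolding hom_deg_def
proof (intro allI impI)
  fix N assume "mfps_nth (gmono M) N \<noteq> 0"
  then have "(\<Sum>\<kappa>\<in>Par (size M). inverse (zmset \<kappa>) * mfps_nth (psym \<kappa>) M * mfps_nth (psym \<kappa>) N) \<noteq> 0"
    using gmono_expand[of M] by (metis (no_types, lifting) mfps_nth_const_mult mfps_nth_sum sum.cong)
  then obtain \<kappa> where "\<kappa> \<in> Par (size M)" "mfps_nth (psym \<kappa>) N \<noteq> 0"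
    by (metis (no_types, lifting) mult_zero_right sum.neutral)
  then show "size N = size M" using psym_nth_tri[of \<kappa> N] by (simp add: Par_def)
qed

lemma size_mon_lam: "size (mon n (\<lambda>i. int (lam i))) = (\<Sum>i=1..n. lam i)"
  unfolding mon_def by (subst size_sum_multiset) simp_all

lemma sum_list_filter_pos: "sum_list (filter (\<lambda>r. r > 0) xs) = sum_list (xs :: nat list)"
  by (induction xs) auto

lemma sum_list_map_interval: "sum_list (map h [1..<n + 1]) = (\<Sum>i=1..n. h i)" for h :: "nat \<Rightarrow> nat"
  by (induction n) auto

lemma sum_list_plist: "sum_list (plist n lam) = (\<Sum>i=1..n. lam i)"
  unfolding plist_def sum_list_filter_pos by (rule sum_list_map_interval)

lemma gprod_move_cases:
  assumes "mfps_nth (fspec n lam) C \<noteq> 0" "gprod n (raised lam C) \<noteq> 0"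
  shows "nonneg n (raised lam C)"
    "size (mon n (raised lam C)) = (\<Sum>i=1..n. lam i)"
proof -
  show nn: "nonneg n (raised lam C)"
    using assms(2) by (auto simp: gprod_mon split: if_splits)
  have C: "set_mset C \<subseteq> {1..<n}" by (rule fspec_supp[OF assms(1)])
  then have "count C 0 = 0" by (auto simp flip: not_in_iff)
  then show "size (mon n (raised lam C)) = (\<Sum>i=1..n. lam i)"
    using arg_cong[OF theta_mon_move[OF C nn], of "\<lambda>M. count M 0"]
    by (simp add: count_theta_0 size_mon_lam)
qed

lemma Qraise_hom: "hom_deg (sum_list (plist n lam)) (Qraise n lam)"
  unfolding hom_deg_def sum_list_plist
proof (intro allI impI)
  fix M assume "mfps_nth (Qraise n lam) M \<noteq> 0"
  then obtain C where C: "mfps_nth (mfps_const (mfps_nth (fspec n lam) C)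
      * gprod n (raised lam C)) M \<noteq> 0"
    unfolding Qraise_expand mfps_nth_sum by (rule sum.not_neutral_contains_not_neutral)
  then have nz: "mfps_nth (fspec n lam) C \<noteq> 0" "gprod n (raised lam C) \<noteq> 0" by auto
  note cases = gprod_move_cases[OF nz]
  show "size M = (\<Sum>i=1..n. lam i)"
    using C cases(1) gmono_hom[of "mon n (raised lam C)"]
    unfolding cases(2) by (simp add: gprod_mon hom_deg_def)
qed

lemma shape_mon:
  "shape (mon n b) = image_mset (\<lambda>k. nat (b k)) (mset_set {k\<in>{1..n}. b k > 0})"
proof -
  have set: "set_mset (mon n b) = (\<lambda>k. k - 1) ` {k\<in>{1..n}. b k > 0}"
  proof (intro equalityI subsetI)
    fix r assume "r \<in># mon n b"
    then have "count (mon n b) r > 0" by simp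
    then have "Suc r \<in> {k\<in>{1..n}. b k > 0}" by (auto simp: count_mon split: if_splits)
    then show "r \<in> (\<lambda>k. k - 1) ` {k\<in>{1..n}. b k > 0}" by (rule rev_image_eqI) simp
  next
    fix r assume "r \<in> (\<lambda>k. k - 1) ` {k\<in>{1..n}. b k > 0}"
    then obtain k where "r = k - 1" "k \<in> {1..n}" "b k > 0" by auto
    then have "count (mon n b) r > 0" by (auto simp: count_mon)
    then show "r \<in># mon n b" by simp
  qed
  have inj: "inj_on (\<lambda>k. k - 1) {k\<in>{1..n}. b k > 0}" by (auto intro!: inj_onI)
  show ?thesis
    unfolding shape_def set image_mset_mset_set[OF inj, symmetric] multiset.map_comp o_def
    by (intro image_mset_cong) (auto simp: count_mon)
qed

lemma sum_submset_le_take: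
  fixes xs :: "nat list"
  assumes "sorted_wrt (\<ge>) xs" "B \<subseteq># mset xs" "size B \<le> k"
  shows "sum_mset B \<le> sum_list (take k xs)"
  using assms
proof (induction xs arbitrary: B k)
  case (Cons x xs)
  show ?case
  proof (cases "B = {#}")
    case False
    then obtain k' where k: "k = Suc k'" using Cons.prems(3) by (cases k) auto
    show ?thesis
    proof (cases "x \<in># B")
      case True
      then obtain B' where B: "B = add_mset x B'" by (metis mset_add)
      then have "sum_mset B' \<le> sum_list (take k' xs)" using Cons k by (intro Cons.IH) auto
      then show ?thesis using B k by simp
    next
      case nx: False
      obtain y B' where B: "B = add_mset y B'" using False by (metis multiset_cases)
      have sub: "B \<subseteq># mset xs"
        using Cons.prems(2) nx by (metis diff_single_trivial mset.simps(2) subset_eq_diff_conv add_mset_add_single)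
      then have "y \<in># mset xs" using B by (metis mset_subset_eqD union_single_eq_member)
      then have "y \<le> x" using Cons.prems(1) by simp
      moreover have "B' \<subseteq># mset xs" using sub B by (metis mset_subset_eq_insertD subset_mset.less_imp_le)
      then have "sum_mset B' \<le> sum_list (take k' xs)" using Cons B k by (intro Cons.IH) auto
      ultimately show ?thesis using B k by simp
    qed
  qed simp
qed simp

lemma sum_list_take_filter_pos:
  fixes xs :: "nat list"
  assumes "sorted_wrt (\<ge>) xs"
  shows "sum_list (take k (filter (\<lambda>r. r > 0) xs)) = sum_list (take k xs)"
  using assms
proof (induction xs arbitrary: k)
  case (Cons x xs)
  show ?case
  proof (cases "x > 0")
    case True
    then show ?thesis using Cons by (cases k) auto
  next
    case False
    then have "\<forall>y\<in>set (x # xs). y = 0" using Cons.prems by auto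
    then have "filter (\<lambda>r. r > 0) (x # xs) = []" by simp
    moreover have "sum_list (take k (x # xs)) = 0"
      using \<open>\<forall>y\<in>set (x # xs). y = 0\<close> by (meson in_set_takeD sum_list_eq_0_iff)
    ultimately show ?thesis by (simp only: take_Nil sum_list.Nil)
  qed
qed simp

locale part_seq =
  fixes n :: nat and lam :: "nat \<Rightarrow> nat"
  assumes antitone: "\<And>i j. 1 \<le> i \<Longrightarrow> i \<le> j \<Longrightarrow> j \<le> n \<Longrightarrow> lam j \<le> lam i"
begin

lemma sorted_lam: "sorted_wrt (\<ge>) (map lam [1..<n + 1])"
  unfolding sorted_wrt_map by (rule sorted_wrt_mono_rel[OF _ sorted_upt]) (use antitone in \<open>auto simp: less_Suc_eq_le\<close>)

lemma plist_partition: "plist n lam \<in> partitions"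
proof -
  have "sorted_wrt (\<ge>) (plist n lam)" unfolding plist_def by (rule sorted_wrt_filter[OF sorted_lam])
  then show ?thesis by (simp add: partitions_def plist_def)
qed

lemma sum_take_plist: "k \<le> n \<Longrightarrow> sum_list (take k (plist n lam)) = (\<Sum>i=1..k. lam i)"
proof -
  assume "k \<le> n"
  then have "take k (map lam [1..<n + 1]) = map lam [1..<k + 1]" by (simp add: take_map take_upt del: upt_Suc)
  then show ?thesis
    unfolding plist_def sum_list_take_filter_pos[OF sorted_lam] using sum_list_map_interval[of lam k] by simp
qed

lemma length_plist: "length (plist n lam) \<le> n"
  unfolding plist_def by (metis diff_add_inverse2 length_filter_le length_map length_upt)

lemma raise_dominance:
  assumes C: "mfps_nth (fspec n lam) C \<noteq> 0" and nn: "nonneg n (raised lam C)"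
    and \<mu>: "\<mu> \<in> partitions" and sh: "shape (mon n (raised lam C)) = mset \<mu>"
  shows "(\<mu> = plist n lam \<and> C = {#}) \<or> dominance_less (plist n lam) \<mu>"
proof -
  let ?b = "raised lam C"
  have Cn: "set_mset C \<subseteq> {1..<n}" by (rule fspec_supp[OF C])
  have C0: "count C 0 = 0" using Cn by (auto simp flip: not_in_iff)
  have sumb: "(\<Sum>i=1..k. ?b i) = int (\<Sum>i=1..k. lam i) + int (count C k)" for k
    by (induction k) (auto simp: C0 move_simple_root)
  have le: "(\<Sum>i=1..k. lam i) + count C k \<le> sum_list (take k \<mu>)" if k: "k \<le> n" for k
  proof -
    let ?B = "image_mset (\<lambda>i. nat (?b i)) (mset_set {i\<in>{1..k}. ?b i > 0})"
    have "?B \<subseteq># mset \<mu>" unfolding sh[symmetric] shape_mon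
      by (intro image_mset_subseteq_mono subset_imp_msubset_mset_set) (use k in auto)
    moreover have "card {i\<in>{1..k}. ?b i > 0} \<le> k"
      by (rule order_trans[OF card_mono[of "{1..k}"]]) auto
    then have "size ?B \<le> k" by simp
    ultimately have "sum_mset ?B \<le> sum_list (take k \<mu>)"
      using \<mu> by (intro sum_submset_le_take) (auto simp: partitions_def)
    moreover have "int (sum_mset ?B) = (\<Sum>i=1..k. ?b i)"
    proof -
      have "int (sum_mset ?B) = (\<Sum>i\<in>{i\<in>{1..k}. ?b i > 0}. int (nat (?b i)))"
        unfolding sum_unfold_sum_mset[of "\<lambda>i. nat (?b i)", symmetric] by (rule of_nat_sum)
      also have "\<dots> = (\<Sum>i=1..k. ?b i)"
      proof (rule sum.mono_neutral_cong_left)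
        have "?b i \<ge> 0" if "i \<in> {1..k}" for i using nn k that by auto
        then show "\<forall>i\<in>{1..k} - {i\<in>{1..k}. ?b i > 0}. ?b i = 0" by (metis (no_types, lifting) DiffD1 DiffD2 mem_Collect_eq order_le_less)
      qed auto
      finally show ?thesis .
    qed
    ultimately show ?thesis using sumb[of k] by linarith
  qed
  have len: "length \<mu> \<le> n"
  proof -
    have "length \<mu> = size (mset \<mu>)" by simp
    also have "\<dots> = card {k\<in>{1..n}. ?b k > 0}" unfolding sh[symmetric] shape_mon by simp
    also have "\<dots> \<le> n" by (rule order_trans[OF card_mono[of "{1..n}"]]) auto
    finally show ?thesis .
  qed
  have "sum_list \<mu> = size (mon n ?b)"
    using arg_cong[OF sh, of sum_mset] by (simp add: sum_shape sum_mset_sum_list)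
  also have "\<dots> = (\<Sum>i=1..n. lam i)"
    using arg_cong[OF theta_mon_move[OF Cn nn], of "\<lambda>M. count M 0"]
    by (simp add: count_theta_0 size_mon_lam C0)
  finally have total: "sum_list \<mu> = sum_list (plist n lam)" by (simp add: sum_list_plist)
  have dom: "sum_list (take k (plist n lam)) \<le> sum_list (take k \<mu>)" for k
  proof (cases "k \<le> n")
    case True
    then show ?thesis using le[OF True] by (simp add: sum_take_plist)
  next
    case False
    then show ?thesis using len length_plist total by simp
  qed
  show ?thesis
  proof (cases "\<mu> = plist n lam")
    case True
    have "count C k = 0" for k
    proof (cases "k \<le> n")
      case kn: True
      then show ?thesis using le[OF kn] sum_take_plist[OF kn] True by simp
    next
      case False
      then show ?thesis using Cn by (auto simp flip: not_in_iff)
    qed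
    then have "C = {#}" by (auto intro: multiset_eqI)
    then show ?thesis using True by blast
  next
    case False
    then show ?thesis using dom total by (auto simp: dominance_less_def)
  qed
qed

lemma shape_mon_lam: "shape (mon n (\<lambda>i. int (lam i))) = mset (plist n lam)"
proof -
  have "mset (plist n lam) = image_mset lam (filter_mset (\<lambda>i. lam i > 0) (mset_set {1..n}))"
    unfolding plist_def mset_filter mset_map mset_upt filter_mset_image_mset
    by (simp add: atLeastLessThanSuc_atLeastAtMost o_def)
  then show ?thesis by (simp add: shape_mon filter_mset_mset_set)
qed

end

lemma qpoch_0 [simp]: "qpoch a q 0 = 1"
  by (simp add: qpoch_def)

lemma cc_0: "\<theta> = (\<lambda>i j. 0) \<Longrightarrow> cc n \<theta> s q t = 1"
  by (induction n \<theta> s q t rule: cc.induct) (simp_all add: Let_def case_prod_unfold)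

lemma fspec_nth_0: "mfps_nth (fspec n lam) {#} = 1"
proof -
  have Z: "{\<theta>\<in>Mats n. root_mon n \<theta> = {#}} = {\<lambda>i j. 0}"
  proof (intro equalityI subsetI)
    fix \<theta> assume "\<theta> \<in> {\<theta>\<in>Mats n. root_mon n \<theta> = {#}}"
    then have "\<theta> i j = 0" for i j
      using theta_le_size(2)[of i j n \<theta>] by (cases "(i, j) \<in> pairs n") (auto simp: Mats_def)
    then show "\<theta> \<in> {\<lambda>i j. 0}" by auto
  qed (auto simp: Mats_def root_mon_def intro!: sum.neutral)
  have r0: "root_mon n (\<lambda>i j. 0) = {#}" using Z by blast
  have "mfps_nth (mfps_sum (\<lambda>\<theta>. mfps_const (cc n \<theta> (sspec n lam) q0 t0) * mfps_mono (root_mon n \<theta>)) (Mats n)) {#}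
      = (\<Sum>\<theta>\<in>{\<theta>\<in>Mats n. root_mon n \<theta> = {#}}. mfps_nth (mfps_const (cc n \<theta> (sspec n lam) q0 t0) * mfps_mono (root_mon n \<theta>)) {#})"
    by (rule mfps_nth_mfps_sum) (auto simp: finite_fibre_root)
  also have "\<dots> = 1" unfolding Z by (simp add: cc_0 r0)
  finally have "mfps_nth (mfps_sum (\<lambda>\<theta>. mfps_const (cc n \<theta> (sspec n lam) q0 t0) * mfps_mono (root_mon n \<theta>)) (Mats n)) {#} = 1" .
  moreover have "mfps_nth (1 - xratio i j :: (nat, Qqt) mfps) {#} = 1" if "(i, j) \<in> pairs n" for i j
    using that nth_0_xratio[of i j] by (auto simp: pairs_def)
  then have "(\<Prod>p\<in>pairs n. mfps_nth ((case p of (k, l) \<Rightarrow> 1 - xratio k l) :: (nat, Qqt) mfps) {#}) = 1"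
    by (intro prod.neutral) auto
  ultimately show ?thesis
    unfolding fser_def root_mon mfps_nth_0_mult mfps_nth_0_prod by simp
qed

context part_seq
begin

lemma scalar_Qraise_mono_sym:
  assumes \<mu>: "\<mu> \<in> partitions"
  shows "scalar_qt (Qraise n lam) (mono_sym \<mu>) \<noteq> 0 \<Longrightarrow> \<mu> = plist n lam \<or> dominance_less (plist n lam) \<mu>"
    and "\<mu> = plist n lam \<Longrightarrow> scalar_qt (Qraise n lam) (mono_sym \<mu>) = 1"
proof -
  let ?b = "\<lambda>C. raised lam C"
  let ?T = "\<lambda>C. mfps_nth (fspec n lam) C * scalar_qt (gprod n (?b C)) (mono_sym \<mu>)"
  have ex: "scalar_qt (Qraise n lam) (mono_sym \<mu>) = (\<Sum>C\<in>below n lam. ?T C)"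
    by (rule scalar_Qraise[OF mono_sym_pspan[OF \<mu>]])
  have sc: "scalar_qt (gprod n (?b C)) (mono_sym \<mu>)
      = (if nonneg n (?b C) \<and> shape (mon n (?b C)) = mset \<mu> then 1 else 0)" for C
  proof -
    have nth: "mfps_nth (mono_sym \<mu>) M = (if shape M = mset \<mu> then 1 else 0)" for M
      by (simp add: mono_sym_msym)
    have "scalar_qt 0 (mono_sym \<mu>) = 0"
      using scalar_0_right[OF mono_sym_pspan[OF \<mu>]] scalar_commute[OF pspan_0 mono_sym_pspan[OF \<mu>]] by simp
    then show ?thesis by (simp add: gprod_mon scalar_gmono[OF mono_sym_pspan[OF \<mu>]] nth)
  qed
  {
    assume "scalar_qt (Qraise n lam) (mono_sym \<mu>) \<noteq> 0"
    then obtain C where "?T C \<noteq> 0" unfolding ex by (rule sum.not_neutral_contains_not_neutral)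
    then show "\<mu> = plist n lam \<or> dominance_less (plist n lam) \<mu>"
      using raise_dominance[OF _ _ \<mu>, of C] unfolding sc by (auto split: if_splits)
  next
    assume eq: "\<mu> = plist n lam"
    have "(\<Sum>C\<in>below n lam. ?T C) = (\<Sum>C\<in>{{#}}. ?T C)"
    proof (rule sum.mono_neutral_right[OF finite_below])
      show "\<forall>C\<in>below n lam - {{#}}. ?T C = 0"
      proof
        fix C assume "C \<in> below n lam - {{#}}"
        then have "C \<noteq> {#}" by simp
        then show "?T C = 0"
          using raise_dominance[OF _ _ \<mu>, of C] eq unfolding sc by (auto simp: dominance_less_def)
      qed
    qed (simp add: below_def)
    then show "scalar_qt (Qraise n lam) (mono_sym \<mu>) = 1"
      unfolding ex sc using eq by (simp add: fspec_nth_0 shape_mon_lam)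
  }
qed

end

text \<open>The trailing zero makes the number of rows positive also for the empty partition.\<close>
definition row :: "nat list \<Rightarrow> nat \<Rightarrow> nat" where
  "row \<nu> i = (if 1 \<le> i \<and> i \<le> length \<nu> then \<nu> ! (i - 1) else 0)"

lemma part_seq_row: "\<nu> \<in> partitions \<Longrightarrow> part_seq (Suc (length \<nu>)) (row \<nu>)"
proof
  fix i j assume \<nu>: "\<nu> \<in> partitions" and ij: "1 \<le> i" "i \<le> j" "j \<le> Suc (length \<nu>)"
  then have s: "sorted_wrt (\<ge>) \<nu>" by (simp add: partitions_def)
  show "row \<nu> j \<le> row \<nu> i"
  proof (cases "i < j \<and> j \<le> length \<nu>")
    case True
    then have "i - 1 < j - 1" "j - 1 < length \<nu>" using ij by auto
    then show ?thesis using sorted_wrt_nth_less[OF s, of "i - 1" "j - 1"] True ij by (simp add: row_def)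
  next
    case False
    then show ?thesis using ij by (auto simp: row_def)
  qed
qed

lemma plist_row: "\<nu> \<in> partitions \<Longrightarrow> plist (Suc (length \<nu>)) (row \<nu>) = \<nu>"
proof -
  assume \<nu>: "\<nu> \<in> partitions"
  have "map (row \<nu>) [1..<length \<nu> + 1] = \<nu>"
    by (rule nth_equalityI) (auto simp: row_def nth_append simp del: upt_Suc)
  then have "plist (Suc (length \<nu>)) (row \<nu>) = filter (\<lambda>r. r > 0) (\<nu> @ [0])"
    unfolding plist_def by (simp add: row_def)
  also have "\<dots> = \<nu>" using \<nu> by (auto simp: partitions_def filter_id_conv intro: gr0I)
  finally show ?thesis .
qed

theorem proposition3p1:
  fixes n :: nat and lam :: "nat \<Rightarrow> nat"
  assumes eigen: "\<And>m. m \<ge> 1 \<Longrightarrow>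
      D1 m sv (to_Qqts q0) (to_Qqts t0) (fser m sv (to_Qqts q0) (to_Qqts t0))
      = mfps_const (\<Sum>i = 1..m. sv i) * fser m sv (to_Qqts q0) (to_Qqts t0)"
    and n: "n \<ge> 1"
    and partition: "\<And>i j. 1 \<le> i \<Longrightarrow> i \<le> j \<Longrightarrow> j \<le> n \<Longrightarrow> lam j \<le> lam i"
  shows "macdonald_Q (filter (\<lambda>r. r > 0) (map lam [1..<n + 1]))
      = raise_apply n (raising_series n (\<lambda>i. t0 ^ (n - i) * q0 ^ lam i)) (\<lambda>i. int (lam i))"
proof -
  define ltop where "ltop = plist n lam"
  define N where "N \<nu> = (if \<nu> = ltop then n else Suc (length \<nu>))" for \<nu>
  define L where "L \<nu> = (if \<nu> = ltop then lam else row \<nu>)" for \<nu>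
  have lam: "part_seq n lam" using partition by (rule part_seq.intro)
  have seq: "part_seq (N \<nu>) (L \<nu>)" if "\<nu> \<in> partitions" for \<nu>
    using that lam part_seq_row by (simp add: N_def L_def)
  have pl: "plist (N \<nu>) (L \<nu>) = \<nu>" if "\<nu> \<in> partitions" for \<nu>
    using that plist_row by (simp add: N_def L_def ltop_def)
  have eig: "eigen_eq (N \<nu>) (L \<nu>)" for \<nu>
    by (rule eigen_specialized[OF eigen]) (use n in \<open>simp add: N_def\<close>)
  interpret dual_orthogonal "\<lambda>\<nu>. Qraise (N \<nu>) (L \<nu>)"
  proof
    fix \<nu> assume \<nu>: "\<nu> \<in> partitions"
    interpret part_seq "N \<nu>" "L \<nu>" by (rule seq[OF \<nu>])
    show "Qraise (N \<nu>) (L \<nu>) \<in> pspan" by (rule Qraise_pspan)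
    show "hom_deg (sum_list \<nu>) (Qraise (N \<nu>) (L \<nu>))" using Qraise_hom[of "N \<nu>" "L \<nu>"] by (simp add: pl[OF \<nu>])
    show "scalar_qt (Qraise (N \<nu>) (L \<nu>)) (mono_sym \<nu>) = 1"
      using scalar_Qraise_mono_sym(2)[OF \<nu>] pl[OF \<nu>] by simp
    fix \<mu> assume \<mu>: "\<mu> \<in> partitions"
    show "\<mu> = \<nu> \<or> dominance_less \<nu> \<mu>" if "scalar_qt (Qraise (N \<nu>) (L \<nu>)) (mono_sym \<mu>) \<noteq> 0"
      using scalar_Qraise_mono_sym(1)[OF \<mu> that] pl[OF \<nu>] by simp
    show "scalar_qt (Qraise (N \<nu>) (L \<nu>)) (Qraise (N \<mu>) (L \<mu>)) = 0" if "\<nu> \<noteq> \<mu>"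
      by (rule scalar_orth[OF eig eig]) (simp add: pl \<nu> \<mu> that)
  qed
  have "macdonald_Q ltop = Qraise (N ltop) (L ltop)"
    unfolding ltop_def by (rule macdonald_Q_eq[OF part_seq.plist_partition[OF lam]])
  then show ?thesis
    unfolding ltop_def by (simp add: N_def L_def ltop_def Qraise_def plist_def)
qed

end
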